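(* Let $\boldsymbol{f}$ be an $\mathbb{R}^n$-valued function that is piecewise constant with respect to the triangulation $\mathcal{T}$ of $\Omega$. Let $(\boldsymbol{u}_{\rm ECR},p_{\rm ECR})\in(V_{\rm ECR})^n\times Q_{\rm ECR}$ be the solution of $$(\nabla_{\rm NC}\boldsymbol{u}_{\rm ECR},\nabla_{\rm NC}\boldsymbol{v})+(\operatorname{div}_{\rm NC}\boldsymbol{v},p_{\rm ECR})=(\boldsymbol{f},\boldsymbol{v})\ \ \forall\boldsymbol{v}\in(V_{\rm ECR})^n,\qquad(\operatorname{div}_{\rm NC}\boldsymbol{u}_{\rm ECR},q)=0\ \ \forall q\in Q_{\rm ECR},$$ and let $(\boldsymbol{\sigma}_{\rm RT},\boldsymbol{u}_{\rm RT})\in(\widehat{\rm RT}(\mathcal{T}))^n\times(U_{\rm RT})^n$ be the solution of $$(\operatorname{dev}\boldsymbol{\sigma}_{\rm RT},\operatorname{dev}\boldsymbol{\tau})+(\boldsymbol{u}_{\rm RT},\operatorname{div}\boldsymbol{\tau})=0\ \ \forall\boldsymbol{\tau}\in(\widehat{\rm RT}(\mathcal{T}))^n,\qquad(\operatorname{div}\boldsymbol{\sigma}_{\rm RT},\boldsymbol{v})=-(\boldsymbol{f},\boldsymbol{v})\ \ \forall\boldsymbol{v}\in(U_{\rm RT})^n.$$ Then $$\boldsymbol{\sigma}_{\rm RT}=\nabla_{\rm NC}\boldsymbol{u}_{\rm ECR}+p_{\rm ECR}\operatorname{id}\quad\text{and}\quad\boldsymbol{u}_{\rm RT}=\Pi_0\boldsymbol{u}_{\rm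 ECR}+\mathcal{L}\boldsymbol{u}_{\rm ECR},$$ where $\mathcal{L}\boldsymbol{u}_{\rm ECR}\in(U_{\rm RT})^n$ is defined by $$(\mathcal{L}\boldsymbol{u}_{\rm ECR},\operatorname{div}\boldsymbol{\tau})=\big(\operatorname{div}_{\rm NC}\boldsymbol{u}_{\rm ECR},\tfrac1n\operatorname{tr}\boldsymbol{\tau}\big)\quad\text{for all }\boldsymbol{\tau}\in(\widehat{\rm RT}(\mathcal{T}))^n.$$
   Context: $\Omega\subset\mathbb{R}^n$ is a bounded polytopal domain; $\mathcal{T}$ is a shape-regular (conforming, i.e. face-to-face) triangulation covering $\overline\Omega$ exactly by $n$-simplices. $(\cdot,\cdot)$ is the $L^2(\Omega)$ inner product (of scalar, vector or matrix fields). $\mathcal{E}(\Omega)$ and $\mathcal{E}(\partial\Omega)$ are the sets of interior and boundary $(n-1)$-dimensional subsimplices (faces) of $\mathcal{T}$. For an interior face $E$ shared by $K^+,K^-\in\mathcal{T}$, $[v]:=v|_{K^+}-v|_{K^-}$ on $E$. $P_m(K)$ is the space of polynomials of degree $\le m$ on $K$. $\nabla_{\rm NC}$, $\operatorname{div}_{\rm NC}$ are the gradient and divergence taken elementwise with respect to $\mathcal{T}$; the gradient of a vector field is the matrix whose $i$th row is the gradient of the $i$th component. $\Pi_0$ is the $L^2$ projection onto piecewise constant functions with respect to $\mathcal{T}$ (applied componentwise). For an $n\times n$ matrix field $\boldsymbol{\tau}$: $\operatorname{div}\boldsymbol{\tau}$ is the row-wise divergence, $\operatorname{tr}\boldsymbol{\tau}=\sum_i\tau_{ii}$,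 $\operatorname{id}$ is the $n\times n$ identity matrix, $\operatorname{dev}\boldsymbol{\tau}:=\boldsymbol{\tau}-\frac1n\operatorname{tr}(\boldsymbol{\tau})\operatorname{id}$. Enriched Crouzeix--Raviart (ECR) spaces: ${\rm ECR}(K):=P_1(K)+\operatorname{span}\{\sum_{i=1}^n x_i^2\}$, $$V_{\rm ECR}:=\Big\{v\in L^2(\Omega,\mathbb{R}): v|_K\in{\rm ECR}(K)\ \forall K\in\mathcal{T},\ \int_E[v]\,dE=0\ \forall E\in\mathcal{E}(\Omega),\ \int_E v\,dE=0\ \forall E\in\mathcal{E}(\partial\Omega)\Big\},$$ $$Q_{\rm ECR}:=\Big\{q\in L^2(\Omega,\mathbb{R}):\int_\Omega q\,dx=0,\ q|_K\in P_0(K)\ \forall K\in\mathcal{T}\Big\}.$$ First order Raviart--Thomas (RT) spaces: ${\rm RT}(K):=(P_0(K))^n+xP_0(K)$, ${\rm RT}(\mathcal{T}):=\{\tau\in H(\operatorname{div},\Omega,\mathbb{R}^n):\tau|_K\in{\rm RT}(K)\ \forall K\in\mathcal{T}\}$, $U_{\rm RT}:=\{v\in L^2(\Omega,\mathbb{R}):v|_K\in P_0(K)\ \forall K\in\mathcal{T}\}$; $({\rm RT}(\mathcal{T}))^n$ is the space of $n\times n$ matrix fields all of whose rows lie in ${\rm RT}(\mathcal{T})$, and $$(\widehat{\rm RT}(\mathcal{T}))^n:=\Big\{\boldsymbol{\tau}\in({\rm RT}(\mathcal{T}))^n:\int_\Omega\operatorname{tr}\boldsymbol{\tau}\,dx=0\Big\}.$$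 *)

theory Defs
  imports "HOL-Analysis.Analysis"
begin

section \<open>Domain, mesh, faces\<close>

text \<open>Regular openness (\<open>interior (closure \<Omega>) = \<Omega>\<close>) rules out slits; it holds for every Lipschitz
  domain.\<close>

definition polytopal_domain :: "(real^'n) set \<Rightarrow> bool" where
  "polytopal_domain \<Omega> \<longleftrightarrow>
     open \<Omega> \<and> connected \<Omega> \<and> \<Omega> \<noteq> {} \<and> bounded \<Omega> \<and> interior (closure \<Omega>) = \<Omega> \<and>
     (\<exists>P. finite P \<and> (\<forall>p\<in>P. polytope p) \<and> closure \<Omega> = \<Union>P)"

text \<open>The library's \<^const>\<open>triangulation\<close> is finite and face-to-face, but admits simplices of any
  dimension.\<close>

definition mesh :: "(real^'n) set \<Rightarrow> (real^'n) set set \<Rightarrow> bool" where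
  "mesh \<Omega> T \<longleftrightarrow>
     triangulation T \<and> (\<forall>K\<in>T. int CARD('n) simplex K) \<and> \<Union>T = closure \<Omega>"

definition faces :: "(real^'n) set set \<Rightarrow> (real^'n) set set" where
  "faces T = {E. \<exists>K\<in>T. E facet_of K}"

definition boundary_faces :: "(real^'n) set \<Rightarrow> (real^'n) set set \<Rightarrow> (real^'n) set set" where
  "boundary_faces \<Omega> T = {E \<in> faces T. E \<subseteq> frontier \<Omega>}"

definition interior_faces :: "(real^'n) set \<Rightarrow> (real^'n) set set \<Rightarrow> (real^'n) set set" where
  "interior_faces \<Omega> T = faces T - boundary_faces \<Omega> T"

text \<open>The \<open>(n - 1)\<close>-dimensional measure on a set \<open>E\<close> that spans a hyperplane: Lebesgue measure on the
  slab of thickness \<open>1\<close> around \<open>E\<close>, pushed forward by the orthogonal projection onto the hyperplane.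
  For \<open>n = 1\<close> this is the point mass.\<close>

definition surface_measure :: "(real^'n) set \<Rightarrow> (real^'n) measure" where
  "surface_measure E =
     (let \<pi> = closest_point (affine hull E)
      in distr (restrict_space lborel {y. \<pi> y \<in> E \<and> dist y (\<pi> y) \<le> 1/2}) borel \<pi>)"

definition face_integral :: "(real^'n) set \<Rightarrow> (real^'n \<Rightarrow> real) \<Rightarrow> real" where
  "face_integral E g = (LINT x:E|surface_measure E. g x)"


section \<open>\<open>L\<^sup>2(\<Omega>)\<close> and \<open>H(div, \<Omega>)\<close>\<close>

text \<open>Elements of \<open>L\<^sup>2(\<Omega>)\<close> are represented by functions on the whole space; only their values almost
  everywhere on \<open>\<Omega>\<close> matter. On \<open>real^'n^'n\<close> the inner product is the Frobenius one.\<close>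

definition L2 :: "(real^'n) set \<Rightarrow> (real^'n \<Rightarrow> 'b::euclidean_space) set" where
  "L2 \<Omega> = {v. v \<in> borel_measurable (lebesgue_on \<Omega>) \<and>
               integrable (lebesgue_on \<Omega>) (\<lambda>x. (norm (v x))\<^sup>2)}"

definition l2_inner ::
    "(real^'n) set \<Rightarrow> (real^'n \<Rightarrow> 'b::euclidean_space) \<Rightarrow> (real^'n \<Rightarrow> 'b) \<Rightarrow> real" where
  "l2_inner \<Omega> u v = (LINT x|lebesgue_on \<Omega>. u x \<bullet> v x)"

definition comps :: "('a \<Rightarrow> 'b) set \<Rightarrow> ('a \<Rightarrow> 'b^'m) set" where
  "comps V = {v. \<forall>i. (\<lambda>x. v x $ i) \<in> V}"

definition grad :: "(real^'n \<Rightarrow> real) \<Rightarrow> real^'n \<Rightarrow> real^'n" where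
  "grad \<phi> x = (\<chi> j. frechet_derivative \<phi> (at x) (axis j 1))"

primrec Ck :: "nat \<Rightarrow> (real^'n \<Rightarrow> real) \<Rightarrow> bool" where
  "Ck 0 f \<longleftrightarrow> continuous_on UNIV f"
| "Ck (Suc k) f \<longleftrightarrow> (\<forall>x. f differentiable (at x)) \<and> (\<forall>j. Ck k (\<lambda>x. grad f x $ j))"

definition test_functions :: "(real^'n) set \<Rightarrow> (real^'n \<Rightarrow> real) set" where
  "test_functions \<Omega> =
     {\<phi>. (\<forall>k. Ck k \<phi>) \<and> compact (closure {x. \<phi> x \<noteq> 0}) \<and> closure {x. \<phi> x \<noteq> 0} \<subseteq> \<Omega>}"

definition has_weak_div ::
    "(real^'n) set \<Rightarrow> (real^'n \<Rightarrow> real^'n) \<Rightarrow> (real^'n \<Rightarrow> real) \<Rightarrow> bool" where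
  "has_weak_div \<Omega> \<tau> g \<longleftrightarrow>
     (\<forall>\<phi>\<in>test_functions \<Omega>. l2_inner \<Omega> \<tau> (grad \<phi>) = - l2_inner \<Omega> g \<phi>)"

definition Hdiv :: "(real^'n) set \<Rightarrow> (real^'n \<Rightarrow> real^'n) set" where
  "Hdiv \<Omega> = {\<tau> \<in> L2 \<Omega>. \<exists>g\<in>L2 \<Omega>. has_weak_div \<Omega> \<tau> g}"

definition wdiv :: "(real^'n) set \<Rightarrow> (real^'n \<Rightarrow> real^'n) \<Rightarrow> real^'n \<Rightarrow> real" where
  "wdiv \<Omega> \<tau> = (SOME g. g \<in> L2 \<Omega> \<and> has_weak_div \<Omega> \<tau> g)"

definition row_div :: "(real^'n) set \<Rightarrow> (real^'n \<Rightarrow> real^'n^'n) \<Rightarrow> real^'n \<Rightarrow> real^'n" where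
  "row_div \<Omega> \<tau> x = (\<chi> i. wdiv \<Omega> (\<lambda>y. \<tau> y $ i) x)"

definition dev :: "real^'n^'n \<Rightarrow> real^'n^'n" where
  "dev A = A - (trace A / real CARD('n)) *\<^sub>R mat 1"


section \<open>Piecewise functions\<close>

definition piecewise ::
    "(real^'n) set set \<Rightarrow> (real^'n \<Rightarrow> 'b) set \<Rightarrow> (real^'n \<Rightarrow> 'b) set" where
  "piecewise T S = {v. \<forall>K\<in>T. \<exists>p\<in>S. AE x in lebesgue_on K. v x = p x}"

text \<open>The continuous representative of \<open>v|\<^sub>K\<close> on the closed simplex \<open>K\<close>, which gives the traces of
  \<open>v|\<^sub>K\<close> on the faces of \<open>K\<close>. Its values outside \<open>K\<close> are unspecified.\<close>

definition restr :: "(real^'n) set \<Rightarrow> (real^'n \<Rightarrow> 'b::euclidean_space) \<Rightarrow> real^'n \<Rightarrow> 'b" where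
  "restr K v = (SOME g. continuous_on K g \<and> (AE x in lebesgue_on K. v x = g x))"

text \<open>The value \<open>0\<close> on the mesh skeleton, a null set, is arbitrary.\<close>

definition grad_NC ::
    "(real^'n) set set \<Rightarrow> (real^'n \<Rightarrow> real^'m) \<Rightarrow> real^'n \<Rightarrow> real^'n^'m" where
  "grad_NC T v x =
     (if \<exists>K\<in>T. x \<in> interior K
      then jacobian (restr (THE K. K \<in> T \<and> x \<in> interior K) v) (at x)
      else 0)"

definition div_NC :: "(real^'n) set set \<Rightarrow> (real^'n \<Rightarrow> real^'n) \<Rightarrow> real^'n \<Rightarrow> real" where
  "div_NC T v x = trace (grad_NC T v x)"

definition P0 :: "(real^'n \<Rightarrow> 'b) set" where
  "P0 = {p. \<exists>c. p = (\<lambda>x. c)}"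

definition ECR_shape :: "(real^'n \<Rightarrow> real) set" where
  "ECR_shape = {p. \<exists>c a b. p = (\<lambda>x. c + a \<bullet> x + b * (\<Sum>i\<in>UNIV. (x $ i)\<^sup>2))}"

definition RT_shape :: "(real^'n \<Rightarrow> real^'n) set" where
  "RT_shape = {p. \<exists>a b. p = (\<lambda>x. a + b *\<^sub>R x)}"


section \<open>Finite element spaces\<close>

definition V_ECR :: "(real^'n) set \<Rightarrow> (real^'n) set set \<Rightarrow> (real^'n \<Rightarrow> real) set" where
  "V_ECR \<Omega> T = {v \<in> L2 \<Omega> \<inter> piecewise T ECR_shape.
     (\<forall>E\<in>interior_faces \<Omega> T. \<forall>K\<in>T. \<forall>K'\<in>T. K \<noteq> K' \<and> E facet_of K \<and> E facet_of K' \<longrightarrow>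
        face_integral E (\<lambda>x. restr K v x - restr K' v x) = 0) \<and>
     (\<forall>E\<in>boundary_faces \<Omega> T. \<forall>K\<in>T. E facet_of K \<longrightarrow> face_integral E (restr K v) = 0)}"

definition Q_ECR :: "(real^'n) set \<Rightarrow> (real^'n) set set \<Rightarrow> (real^'n \<Rightarrow> real) set" where
  "Q_ECR \<Omega> T = {q \<in> L2 \<Omega> \<inter> piecewise T P0. (LINT x|lebesgue_on \<Omega>. q x) = 0}"

definition RT :: "(real^'n) set \<Rightarrow> (real^'n) set set \<Rightarrow> (real^'n \<Rightarrow> real^'n) set" where
  "RT \<Omega> T = Hdiv \<Omega> \<inter> piecewise T RT_shape"

definition U_RT :: "(real^'n) set \<Rightarrow> (real^'n) set set \<Rightarrow> (real^'n \<Rightarrow> real) set" where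
  "U_RT \<Omega> T = L2 \<Omega> \<inter> piecewise T P0"

definition RT_hat :: "(real^'n) set \<Rightarrow> (real^'n) set set \<Rightarrow> (real^'n \<Rightarrow> real^'n^'n) set" where
  "RT_hat \<Omega> T = {\<tau> \<in> comps (RT \<Omega> T). (LINT x|lebesgue_on \<Omega>. trace (\<tau> x)) = 0}"

definition L2_proj ::
    "(real^'n) set \<Rightarrow> (real^'n \<Rightarrow> real) set \<Rightarrow> (real^'n \<Rightarrow> real) \<Rightarrow> real^'n \<Rightarrow> real" where
  "L2_proj \<Omega> S v = (SOME w. w \<in> S \<and> (\<forall>q\<in>S. l2_inner \<Omega> (\<lambda>x. v x - w x) q = 0))"

definition Pi0 ::
    "(real^'n) set \<Rightarrow> (real^'n) set set \<Rightarrow> (real^'n \<Rightarrow> real^'m) \<Rightarrow> real^'n \<Rightarrow> real^'m" where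
  "Pi0 \<Omega> T v x = (\<chi> i. L2_proj \<Omega> (U_RT \<Omega> T) (\<lambda>y. v y $ i) x)"


section \<open>The two discrete Stokes problems\<close>

definition ECR_solution ::
    "(real^'n) set \<Rightarrow> (real^'n) set set \<Rightarrow> (real^'n \<Rightarrow> real^'n) \<Rightarrow>
     (real^'n \<Rightarrow> real^'n) \<Rightarrow> (real^'n \<Rightarrow> real) \<Rightarrow> bool" where
  "ECR_solution \<Omega> T f u p \<longleftrightarrow>
     u \<in> comps (V_ECR \<Omega> T) \<and> p \<in> Q_ECR \<Omega> T \<and>
     (\<forall>v\<in>comps (V_ECR \<Omega> T).
        l2_inner \<Omega> (grad_NC T u) (grad_NC T v) + l2_inner \<Omega> (div_NC T v) p = l2_inner \<Omega> f v) \<and>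
     (\<forall>q\<in>Q_ECR \<Omega> T. l2_inner \<Omega> (div_NC T u) q = 0)"

definition RT_solution ::
    "(real^'n) set \<Rightarrow> (real^'n) set set \<Rightarrow> (real^'n \<Rightarrow> real^'n) \<Rightarrow>
     (real^'n \<Rightarrow> real^'n^'n) \<Rightarrow> (real^'n \<Rightarrow> real^'n) \<Rightarrow> bool" where
  "RT_solution \<Omega> T f \<sigma> u \<longleftrightarrow>
     \<sigma> \<in> RT_hat \<Omega> T \<and> u \<in> comps (U_RT \<Omega> T) \<and>
     (\<forall>\<tau>\<in>RT_hat \<Omega> T.
        l2_inner \<Omega> (\<lambda>x. dev (\<sigma> x)) (\<lambda>x. dev (\<tau> x)) + l2_inner \<Omega> u (row_div \<Omega> \<tau>) = 0) \<and>
     (\<forall>v\<in>comps (U_RT \<Omega> T). l2_inner \<Omega> (row_div \<Omega> \<sigma>) v = - l2_inner \<Omega> f v)"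

text \<open>\<open>is_L \<Omega> T u l\<close>: the function \<open>l\<close> satisfies the conditions that define \<open>\<L> u\<close>.\<close>

definition is_L ::
    "(real^'n) set \<Rightarrow> (real^'n) set set \<Rightarrow> (real^'n \<Rightarrow> real^'n) \<Rightarrow> (real^'n \<Rightarrow> real^'n) \<Rightarrow> bool" where
  "is_L \<Omega> T u l \<longleftrightarrow>
     l \<in> comps (U_RT \<Omega> T) \<and>
     (\<forall>\<tau>\<in>RT_hat \<Omega> T.
        l2_inner \<Omega> l (row_div \<Omega> \<tau>) =
        l2_inner \<Omega> (div_NC T u) (\<lambda>x. 1 / real CARD('n) * trace (\<tau> x)))"

end

theory Submission
  imports Defs "HOL-Real_Asymp.Real_Asymp"
begin

text \<open>Let \<open>\<sigma> = \<nabla>\<^sub>N\<^sub>C u + p id\<close> be the stress of the ECR solution. On a cell the gradient of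
\<open>c + a \<bullet> x + b |x|\<^sup>2\<close> is \<open>a + 2 b x\<close>, so the rows of \<open>\<sigma>\<close> have Raviart--Thomas shape there. A field of this
shape has constant divergence on the cell and constant normal component on each facet. Green's identity
therefore sees from the function it is paired with nothing but the mean on the cell and the means on the
facets, and these are exactly the degrees of freedom of \<open>ECR(K)\<close>. This has two consequences.

\<^item> A test function may be replaced by its ECR interpolant in the momentum equation. So the rows of \<open>\<sigma>\<close>
  have weak divergence \<open>- f\<close>, and \<open>\<sigma>\<close> lies in the Raviart--Thomas space
  (\<open>ECR_stress_equilibrium\<close>).
\<^item> For \<open>\<tau>\<close> in that space \<open>(\<nabla>\<^sub>N\<^sub>C u, \<tau>) = - (u, div \<tau>)\<close>, as for a continuous \<open>u\<close> that vanishes on the boundary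
  (\<open>green_ECR_RT\<close>). Taking deviators turns this into
  \<open>(dev \<sigma>, dev \<tau>) + (\<Pi>\<^sub>0 u, div \<tau>) = - (div\<^sub>N\<^sub>C u, tr \<tau> / n)\<close> (\<open>grad_NC_dev_pairing\<close>).

The difference \<open>\<delta>\<close> of the two stresses is divergence-free, hence constant on each cell, and its trace is an
admissible pressure test function. Testing both problems with \<open>\<delta>\<close> gives \<open>(dev \<delta>, dev \<delta>) = 0\<close>, so
\<open>\<delta> = s id\<close> with a cellwise constant \<open>s\<close>. The continuity of normal components says that \<open>s\<close> has weak
gradient zero; as \<open>\<Omega>\<close> is connected, \<open>s\<close> is constant, and as \<open>tr \<delta>\<close> has mean zero, \<open>s = 0\<close>
(\<open>dev_free_RT_hat_zero\<close>).

Once the stresses agree, the first equation of the mixed problem and the deviator identity say that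
\<open>u_RT - \<Pi>\<^sub>0 u\<close> satisfies the conditions that define \<open>\<L> u\<close>. They have at most one solution because the
divergence maps the Raviart--Thomas matrices with mean-zero trace onto the piecewise constants
(\<open>row_div_RT_hat_surjective\<close>).

Behind this stands a description of \<open>H(div)\<close>: a piecewise Raviart--Thomas field belongs to it if and only if
its fluxes through each interior face cancel, and its weak divergence then has the elementwise means
(\<open>RT_iff\<close>, \<open>weak_div_cell\<close>). It is obtained from Green's identity on a simplex (\<open>green_simplex\<close>) with the help
of smooth bumps and cutoffs.\<close>

section \<open>Smooth cutoffs and bumps\<close>

lemma has_derivative_grad:
  fixes f :: "real^'n \<Rightarrow> real"
  assumes "f differentiable (at x)"
  shows "(f has_derivative (\<lambda>v. grad f x \<bullet> v)) (at x)"
proof -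
  let ?D = "frechet_derivative f (at x)"
  have D: "(f has_derivative ?D) (at x)"
    using assms frechet_derivative_works by blast
  then interpret bounded_linear ?D by (rule has_derivative_bounded_linear)
  have "?D v = grad f x \<bullet> v" for v
  proof -
    have "?D v = ?D (\<Sum>j\<in>UNIV. (v $ j) *\<^sub>R axis j 1)"
      using basis_expansion[of v] by (simp add: scalar_mult_eq_scaleR)
    also have "\<dots> = (\<Sum>j\<in>UNIV. v $ j * ?D (axis j 1))"
      by (simp add: sum scale)
    also have "\<dots> = grad f x \<bullet> v"
      by (simp add: grad_def inner_vec_def mult.commute)
    finally show ?thesis .
  qed
  then have "?D = (\<lambda>v. grad f x \<bullet> v)" by blast
  with D show ?thesis by simp
qed

lemma grad_eqI:
  fixes f :: "real^'n \<Rightarrow> real"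
  assumes "(f has_derivative (\<lambda>v. g \<bullet> v)) (at x)"
  shows "grad f x = g"
proof -
  have "frechet_derivative f (at x) = (\<lambda>v. g \<bullet> v)"
    using assms frechet_derivative_at by metis
  then show ?thesis
    by (simp add: grad_def vec_eq_iff inner_axis)
qed

lemma Ck_Suc_D: "Ck (Suc k) f \<Longrightarrow> Ck k f"
proof (induction k arbitrary: f)
  case 0
  then show ?case
    by (auto intro!: continuous_at_imp_continuous_on differentiable_imp_continuous_within)
next
  case (Suc k)
  show ?case
    unfolding Ck.simps(2)[of k]
  proof (intro conjI allI)
    fix x :: "real^'a" show "f differentiable (at x)" using Suc.prems by simp
  next
    fix j :: 'a
    have "Ck (Suc k) (\<lambda>x. grad f x $ j)" using Suc.prems Ck.simps(2) by blast
    then show "Ck k (\<lambda>x. grad f x $ j)" by (rule Suc.IH)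
  qed
qed

lemma Ck_le: "Ck m f \<Longrightarrow> k \<le> m \<Longrightarrow> Ck k f"
proof (induction m)
  case (Suc m)
  then show ?case by (cases "k = Suc m") (auto dest: Ck_Suc_D simp del: Ck.simps)
qed auto

lemma Ck_const: "Ck k (\<lambda>x. c)"
proof (induction k arbitrary: c)
  case (Suc k)
  have "grad (\<lambda>x. c) x = (0 :: real^'a)" for x
    by (rule grad_eqI) simp
  then show ?case using Suc by simp
qed simp

lemma Ck_SucI:
  assumes "\<And>x. (f has_derivative (\<lambda>v. g x \<bullet> v)) (at x)"
    and "\<And>j. Ck k (\<lambda>x. g x $ j)"
  shows "Ck (Suc k) f"
proof -
  have "grad f = g" using grad_eqI[OF assms(1)] by blast
  then show ?thesis using assms by (auto simp: differentiable_def)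
qed

lemma Ck_Suc_grad: "Ck (Suc k) f \<Longrightarrow> Ck k (\<lambda>x. grad f x $ j)"
  by simp

lemma Ck_Suc_derivative:
  "Ck (Suc k) f \<Longrightarrow> (f has_derivative (\<lambda>v. grad f x \<bullet> v)) (at x)"
  by (simp add: has_derivative_grad)

lemma Ck_add: "Ck k f \<Longrightarrow> Ck k g \<Longrightarrow> Ck k (\<lambda>x. f x + g x)"
proof (induction k arbitrary: f g)
  case 0 then show ?case by (simp add: continuous_on_add)
next
  case (Suc k)
  note d = Ck_Suc_derivative[OF Suc.prems(1)] Ck_Suc_derivative[OF Suc.prems(2)]
  show ?case
  proof (rule Ck_SucI)
    fix x show "((\<lambda>x. f x + g x) has_derivative (\<lambda>v. (grad f x + grad g x) \<bullet> v)) (at x)"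
      by (rule derivative_eq_intros d refl | simp add: inner_add_left)+
  next
    fix j show "Ck k (\<lambda>x. (grad f x + grad g x) $ j)"
      using Suc.IH[OF Ck_Suc_grad Ck_Suc_grad, OF Suc.prems] by simp
  qed
qed

lemma Ck_mult: "Ck k f \<Longrightarrow> Ck k g \<Longrightarrow> Ck k (\<lambda>x. f x * g x)"
proof (induction k arbitrary: f g)
  case 0 then show ?case by (simp add: continuous_on_mult)
next
  case (Suc k)
  note d = Ck_Suc_derivative[OF Suc.prems(1)] Ck_Suc_derivative[OF Suc.prems(2)]
  show ?case
  proof (rule Ck_SucI)
    fix x show "((\<lambda>x. f x * g x) has_derivative (\<lambda>v. (f x *\<^sub>R grad g x + g x *\<^sub>R grad f x) \<bullet> v)) (at x)"
      by (rule derivative_eq_intros d refl | simp add: inner_add_left mult.commute)+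
  next
    fix j show "Ck k (\<lambda>x. (f x *\<^sub>R grad g x + g x *\<^sub>R grad f x) $ j)"
      using Ck_add[OF Suc.IH[OF Ck_Suc_D Ck_Suc_grad, OF Suc.prems(1,2)]
          Suc.IH[OF Ck_Suc_D Ck_Suc_grad, OF Suc.prems(2,1)]]
      by simp
  qed
qed

lemma Ck_inner: "Ck k (\<lambda>x. a \<bullet> x)"
proof (cases k)
  case 0 then show ?thesis by (simp add: continuous_on_inner)
next
  case (Suc m)
  show ?thesis unfolding Suc
    by (rule Ck_SucI[where g="\<lambda>x. a"]) (auto intro!: derivative_eq_intros Ck_const)
qed

lemma Ck_nth: "Ck k (\<lambda>x. x $ j)"
  using Ck_inner[of k "axis j 1"] by (simp add: inner_axis')

lemma Ck_minus: "Ck k f \<Longrightarrow> Ck k g \<Longrightarrow> Ck k (\<lambda>x. f x - g x)"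
  using Ck_add[OF _ Ck_mult[OF Ck_const[of k "-1"], of g], of f] by simp

lemma Ck_sum: "(\<And>i. i \<in> I \<Longrightarrow> Ck k (f i)) \<Longrightarrow> Ck k (\<lambda>x. \<Sum>i\<in>I. f i x)"
  by (induction I rule: infinite_finite_induct) (auto intro: Ck_const Ck_add simp del: Ck.simps)

lemma Ck_prod: "(\<And>i. i \<in> I \<Longrightarrow> Ck k (f i)) \<Longrightarrow> Ck k (\<lambda>x. \<Prod>i\<in>I. f i x)"
  by (induction I rule: infinite_finite_induct) (auto intro: Ck_const Ck_mult simp del: Ck.simps)

text \<open>\<open>flat 0\<close> is the classical function \<open>exp (- 1 / t)\<close>, extended by zero. The other members make the family closed
under differentiation: the derivative of \<open>flat j\<close> is a combination of \<open>flat (j + 1)\<close> and \<open>flat (j + 2)\<close>.\<close>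

definition flat :: "nat \<Rightarrow> real \<Rightarrow> real" where
  "flat j t = (if t \<le> 0 then 0 else (1 / t) ^ j * exp (- (1 / t)))"

lemma flat_tendsto_0: "(flat j \<longlongrightarrow> 0) (at 0)"
proof -
  have "((\<lambda>t. (1 / t) ^ j * exp (- (1 / t))) \<longlongrightarrow> 0) (at_right (0::real))"
  proof -
    have "((\<lambda>x. x ^ j / exp x) \<longlongrightarrow> (0::real)) at_top" by (rule tendsto_power_div_exp_0)
    moreover have "filterlim (\<lambda>t::real. 1 / t) at_top (at_right 0)"
      using filterlim_inverse_at_top_right by (simp add: inverse_eq_divide)
    ultimately have "((\<lambda>t. (1/t) ^ j / exp (1/t)) \<longlongrightarrow> (0::real)) (at_right 0)"
      by (rule filterlim_compose)
    then show ?thesis by (simp add: exp_minus divide_inverse)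
  qed
  then have R: "(flat j \<longlongrightarrow> 0) (at_right 0)"
    by (rule Lim_transform_eventually)
       (auto simp: flat_def eventually_at intro!: exI[of _ 1])
  have L: "(flat j \<longlongrightarrow> 0) (at_left 0)"
    by (rule Lim_transform_eventually[OF tendsto_const])
       (auto simp: flat_def eventually_at intro!: exI[of _ 1])
  from L R show ?thesis by (simp add: filterlim_split_at)
qed

lemma flat_has_derivative:
  "(flat j has_real_derivative (flat (j + 2) t - real j * flat (j + 1) t)) (at t)"
proof -
  consider "t < 0" | "t = 0" | "t > 0" by linarith
  then show ?thesis
  proof cases
    case 1
    have "((\<lambda>t. 0) has_real_derivative 0) (at t)" by simp
    then have "(flat j has_real_derivative 0) (at t)"
      by (rule has_field_derivative_transform_within[where d="-t"])
         (use 1 in \<open>auto simp: flat_def dist_real_def\<close>)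
    then show ?thesis using 1 by (simp add: flat_def)
  next
    case 2
    (* At 0 the difference quotient of flat j is the next member of the family. *)
    have "(\<lambda>h. (flat j (0 + h) - flat j 0) / h) = flat (Suc j)"
      by (auto simp: flat_def fun_eq_iff)
    then have "(flat j has_real_derivative 0) (at 0)"
      using flat_tendsto_0[of "Suc j"] by (simp add: DERIV_def)
    then show ?thesis using 2 by (simp add: flat_def)
  next
    case 3
    have inv: "((\<lambda>t. 1 / t) has_real_derivative - ((1 / t) ^ 2)) (at t)"
      using 3 by (auto intro!: derivative_eq_intros simp: field_simps power2_eq_square)
    have "((\<lambda>t. (1 / t) ^ j * exp (- (1 / t))) has_real_derivative
        (1/t)^(j+2) * exp (-(1/t)) - real j * ((1/t)^(j+1) * exp (-(1/t)))) (at t)"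
      by (rule derivative_eq_intros inv refl)+
        (cases j; simp add: power2_eq_square algebra_simps)
    then have "(flat j has_real_derivative
        (1/t)^(j+2) * exp (-(1/t)) - real j * ((1/t)^(j+1) * exp (-(1/t)))) (at t)"
      by (rule has_field_derivative_transform_within[where d=t])
         (use 3 in \<open>auto simp: flat_def dist_real_def\<close>)
    then show ?thesis using 3 by (simp add: flat_def)
  qed
qed

lemma continuous_flat: "continuous_on S (flat j)"
  by (meson continuous_at_imp_continuous_on DERIV_isCont flat_has_derivative)

text \<open>The induction on \<open>k\<close> lets \<open>j\<close> vary, because differentiation leads to other members of the family.\<close>

lemma Ck_flat: "(\<And>k. Ck k g) \<Longrightarrow> Ck k (\<lambda>x. flat j (g x))"
proof (induction k arbitrary: j)
  case 0
  have "continuous_on UNIV g" using 0[of 0] by simp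
  then have "continuous_on UNIV (flat j \<circ> g)"
    by (intro continuous_on_compose continuous_flat)
  then show ?case by (simp add: o_def)
next
  case (Suc k)
  have d: "(g has_derivative (\<lambda>v. grad g x \<bullet> v)) (at x)" for x
    by (rule Ck_Suc_derivative[OF Suc.prems])
  show ?case
  proof (rule Ck_SucI)
    fix x
    have "((\<lambda>x. flat j (g x)) has_derivative
        (\<lambda>v. (grad g x \<bullet> v) * (flat (j + 2) (g x) - real j * flat (j + 1) (g x)))) (at x)"
      by (rule DERIV_compose_FDERIV[OF flat_has_derivative d])
    then show "((\<lambda>x. flat j (g x)) has_derivative
        (\<lambda>v. ((flat (j + 2) (g x) - real j * flat (j + 1) (g x)) *\<^sub>R grad g x) \<bullet> v)) (at x)"
      by (simp add: mult.commute)
  next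
    fix i
    have "Ck k (\<lambda>x. (flat (j + 2) (g x) - real j * flat (j + 1) (g x)) * grad g x $ i)"
      by (intro Ck_mult Ck_minus Ck_const Suc.IH Suc.prems Ck_Suc_grad[OF Suc.prems])
    then show "Ck k (\<lambda>x. ((flat (j + 2) (g x) - real j * flat (j + 1) (g x)) *\<^sub>R grad g x) $ i)"
      by simp
  qed
qed

lemma flat_nonneg: "0 \<le> flat j t"
  by (simp add: flat_def)

lemma flat_pos_iff: "0 < flat j t \<longleftrightarrow> 0 < t"
  by (auto simp: flat_def)

lemma flat_0_le_1: "flat 0 t \<le> 1"
  by (simp add: flat_def)

text \<open>With \<open>u = 1 / t\<close> this is \<open>u\<^sup>2 \<le> exp u\<close>, the square of \<open>u \<le> 1 + u / 2 + u\<^sup>2 / 8 \<le> exp (u / 2)\<close>. It bounds the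
gradient of a bump.\<close>

lemma flat_2_le_1: "flat 2 t \<le> 1"
proof (cases "t \<le> 0")
  case False
  define u where "u = 1/t"
  have u: "u > 0" using False by (simp add: u_def)
  have "exp u \<ge> 1 + u + u^2/2" using exp_lower_Taylor_quadratic u by simp
  moreover have "exp u = exp (u/2) * exp (u/2)" by (simp flip: exp_add)
  moreover have "exp (u/2) \<ge> 1 + u/2 + (u/2)^2/2" using exp_lower_Taylor_quadratic[of "u/2"] u by simp
  moreover have "1 + u/2 + (u/2)^2/2 \<ge> u"
    using zero_le_power2[of "u - 2"] by (simp add: power2_eq_square field_simps)
  ultimately have "u \<le> exp (u/2)" "exp u = exp (u/2) * exp (u/2)" by linarith+
  then have "exp u \<ge> u * u" using u by (simp add: mult_mono)
  then have "u^2 * exp (-u) \<le> 1" using u by (simp add: exp_minus field_simps power2_eq_square)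
  then show ?thesis using False by (simp add: flat_def u_def)
qed (simp add: flat_def)

definition bump :: "real \<Rightarrow> real^'n \<Rightarrow> real^'n \<Rightarrow> real" where
  "bump \<rho> c x = flat 0 (\<rho>\<^sup>2 - (x - c) \<bullet> (x - c))"

lemma Ck_norm_sq: "Ck k (\<lambda>x. (x - c) \<bullet> (x - c))"
proof -
  have "Ck k (\<lambda>x. \<Sum>i\<in>UNIV. (x $ i - c $ i) * (x $ i - c $ i))"
    by (intro Ck_sum Ck_mult Ck_minus Ck_nth Ck_const)
  then show ?thesis by (simp add: inner_vec_def)
qed

lemma Ck_bump: "Ck k (bump \<rho> c)"
  unfolding bump_def[abs_def] by (intro Ck_flat Ck_minus Ck_const Ck_norm_sq)

lemma bump_nonneg: "0 \<le> bump \<rho> c x"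
  by (simp add: bump_def flat_nonneg)

lemma bump_le_1: "bump \<rho> c x \<le> 1"
  by (simp add: bump_def flat_0_le_1)

lemma bump_pos_iff: "0 < \<rho> \<Longrightarrow> 0 < bump \<rho> c x \<longleftrightarrow> x \<in> ball c \<rho>"
  using power_strict_mono[of "dist c x" \<rho> 2] power_less_imp_less_base[of "dist c x" 2 \<rho>]
  by (auto simp: bump_def flat_pos_iff power2_norm_eq_inner[symmetric] dist_norm norm_minus_commute)

lemma bump_eq_0: "0 < \<rho> \<Longrightarrow> x \<notin> ball c \<rho> \<Longrightarrow> bump \<rho> c x = 0"
  using bump_pos_iff bump_nonneg by (metis less_eq_real_def)

lemma bump_test_function:
  assumes "0 < \<rho>" "cball c \<rho> \<subseteq> \<Omega>"
  shows "bump \<rho> c \<in> test_functions \<Omega>"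
proof -
  have "{x. bump \<rho> c x \<noteq> 0} \<subseteq> cball c \<rho>"
    using bump_eq_0[OF assms(1), of _ c] by force
  then have "closure {x. bump \<rho> c x \<noteq> 0} \<subseteq> cball c \<rho>"
    by (simp add: closure_minimal)
  moreover from this have "compact (closure {x. bump \<rho> c x \<noteq> 0})"
    by (meson bounded_cball bounded_subset closed_closure compact_eq_bounded_closed)
  ultimately show ?thesis
    using assms(2) by (auto simp: test_functions_def Ck_bump simp del: Ck.simps)
qed

lemma grad_bump: "grad (bump \<rho> c) x = (- 2 * flat 2 (\<rho>\<^sup>2 - (x - c) \<bullet> (x - c))) *\<^sub>R (x - c)"
proof (rule grad_eqI)
  have "((\<lambda>x. \<rho>\<^sup>2 - (x - c) \<bullet> (x - c)) has_derivative (\<lambda>v. - 2 * ((x - c) \<bullet> v))) (at x)"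
    by (auto intro!: derivative_eq_intros simp: inner_commute)
  from DERIV_compose_FDERIV[OF flat_has_derivative[of 0] this]
  show "(bump \<rho> c has_derivative
     (\<lambda>v. ((- 2 * flat 2 (\<rho>\<^sup>2 - (x - c) \<bullet> (x - c))) *\<^sub>R (x - c)) \<bullet> v)) (at x)"
    by (simp add: bump_def[abs_def] numeral_2_eq_2 algebra_simps)
qed

lemma borel_measurable_continuous_lebesgue_on:
  fixes f :: "'a::euclidean_space \<Rightarrow> 'b::euclidean_space"
  assumes "continuous_on UNIV f"
  shows "f \<in> borel_measurable (lebesgue_on S)"
  by (intro measurable_restrict_space1 measurable_completion)
     (simp add: borel_measurable_continuous_onI assms)

lemma Ck_continuous_on: "Ck k f \<Longrightarrow> continuous_on S f"
  using Ck_le[of k f 0] by (metis Ck.simps(1) continuous_on_subset le0 subset_UNIV)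

lemma Ck_measurable_lebesgue_on: "Ck k f \<Longrightarrow> f \<in> borel_measurable (lebesgue_on S)"
  by (intro borel_measurable_continuous_lebesgue_on Ck_continuous_on)

lemma bump_center_derivative:
  "((\<lambda>r. bump \<rho> (c + r *\<^sub>R e) x) has_real_derivative
      - (e \<bullet> grad (bump \<rho> (c + r *\<^sub>R e)) x)) (at r)"
proof -
  have "((\<lambda>r. \<rho>\<^sup>2 - (x - (c + r *\<^sub>R e)) \<bullet> (x - (c + r *\<^sub>R e))) has_real_derivative
      2 * ((x - (c + r *\<^sub>R e)) \<bullet> e)) (at r)"
    unfolding has_field_derivative_def
    by (auto intro!: derivative_eq_intros simp: inner_commute algebra_simps)
  from DERIV_chain2[OF flat_has_derivative[of 0] this] show ?thesis
    by (simp add: bump_def grad_bump numeral_2_eq_2 inner_commute mult.assoc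
        mult.left_commute[of _ 2])
qed

lemma bump_center_derivative_bound:
  assumes "0 < \<rho>"
  shows "\<bar>e \<bullet> grad (bump \<rho> c) x\<bar> \<le> 2 * \<rho> * norm e"
proof (cases "norm (x - c) < \<rho>")
  case True
  have "\<bar>e \<bullet> grad (bump \<rho> c) x\<bar> = (2 * flat 2 (\<rho>\<^sup>2 - (x - c) \<bullet> (x - c))) * \<bar>e \<bullet> (x - c)\<bar>"
    by (simp add: grad_bump abs_mult flat_nonneg)
  also have "\<dots> \<le> 2 * (norm e * norm (x - c))"
    using flat_2_le_1 flat_nonneg by (intro mult_mono) (auto simp: Cauchy_Schwarz_ineq2)
  also have "\<dots> \<le> 2 * (norm e * \<rho>)"
    using True by (intro mult_left_mono) auto
  finally show ?thesis by (simp add: mult_ac)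
next
  case False
  then have "\<rho>\<^sup>2 \<le> (x - c) \<bullet> (x - c)"
    using assms by (simp add: power2_norm_eq_inner[symmetric] power_mono)
  then show ?thesis using assms by (simp add: grad_bump flat_def)
qed

text \<open>When a bump moves with velocity \<open>e\<close>, its integral against \<open>w\<close> changes at the rate \<open>- \<integral> w (e \<bullet> grad bump)\<close>: the
difference quotients in time are bounded by \<open>2 \<rho> |e|\<close>, so dominated convergence applies. If \<open>w\<close> is weakly
constant in the direction \<open>e\<close> along the way, the integral is conserved. This is used for
piecewise constant \<open>w\<close>, once inside \<open>\<Omega>\<close> and once to carry a bump out of \<open>\<Omega>\<close>.\<close>

lemma bump_transport:
  fixes w :: "real^'n \<Rightarrow> real"
  assumes "0 < \<rho>" and w: "integrable (lebesgue_on S) w"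
    and zero: "\<And>r. 0 \<le> r \<Longrightarrow> r \<le> 1 \<Longrightarrow>
      (LINT x|lebesgue_on S. w x * (e \<bullet> grad (bump \<rho> (c + r *\<^sub>R e)) x)) = 0"
  shows "(LINT x|lebesgue_on S. w x * bump \<rho> (c + e) x) = (LINT x|lebesgue_on S. w x * bump \<rho> c x)"
proof -
  let ?M = "lebesgue_on S"
  let ?b = "\<lambda>r x. bump \<rho> (c + r *\<^sub>R e) x"
  let ?g = "\<lambda>r x. - (e \<bullet> grad (bump \<rho> (c + r *\<^sub>R e)) x)"
  define D where "D r = (LINT x|?M. w x * ?b r x)" for r
  have bm: "?b r \<in> borel_measurable ?M" for r
    by (rule Ck_measurable_lebesgue_on[OF Ck_bump])
  have wm: "w \<in> borel_measurable ?M" using w by simp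
  have gm: "?g r \<in> borel_measurable ?M" for r
  proof -
    have "(\<lambda>x. \<Sum>j\<in>UNIV. e $ j * grad (?b r) x $ j) \<in> borel_measurable ?M"
      by (intro borel_measurable_sum borel_measurable_times borel_measurable_const
          Ck_measurable_lebesgue_on[OF Ck_Suc_grad[OF Ck_bump]])
    then show ?thesis by (simp add: inner_vec_def)
  qed
  have int: "integrable ?M (\<lambda>x. w x * ?b r x)" for r
    by (rule Bochner_Integration.integrable_bound[OF w])
       (use bm[of r] wm in \<open>auto simp: abs_mult bump_nonneg bump_le_1 intro!: mult_left_le\<close>)
  have lip: "\<bar>?b (r + h) x - ?b r x\<bar> \<le> 2 * \<rho> * norm e * \<bar>h\<bar>" for r h x
  proof -
    have "norm (?b (r + h) x - ?b r x) \<le> 2 * \<rho> * norm e * norm ((r + h) - r)"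
    proof (rule field_differentiable_bound[of UNIV])
      fix z
      show "((\<lambda>r. ?b r x) has_field_derivative ?g z x) (at z within UNIV)"
        by (rule bump_center_derivative)
      show "norm (?g z x) \<le> 2 * \<rho> * norm e"
        using bump_center_derivative_bound[OF assms(1)] by simp
    qed auto
    then show ?thesis by simp
  qed
  have der: "(D has_real_derivative (LINT x|?M. w x * ?g r x)) (at r)" for r
    unfolding DERIV_def tendsto_at_iff_sequentially comp_def
  proof (intro allI impI)
    fix X :: "nat \<Rightarrow> real" assume X0: "\<forall>i. X i \<in> UNIV - {0}" and X: "X \<longlonglongrightarrow> 0"
    have eq: "(D (r + X i) - D r) / X i = (LINT x|?M. w x * ((?b (r + X i) x - ?b r x) / X i))" for i
    proof -
      have "D (r + X i) - D r = (LINT x|?M. w x * ?b (r + X i) x - w x * ?b r x)"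
        unfolding D_def by (rule Bochner_Integration.integral_diff[symmetric]) (rule int)+
      then have "(D (r + X i) - D r) / X i = (LINT x|?M. (w x * ?b (r + X i) x - w x * ?b r x) / X i)"
        by simp
      also have "\<dots> = (LINT x|?M. w x * ((?b (r + X i) x - ?b r x) / X i))"
        by (simp only: right_diff_distrib[symmetric] times_divide_eq_right)
      finally show ?thesis .
    qed
    have "(\<lambda>i. LINT x|?M. w x * ((?b (r + X i) x - ?b r x) / X i)) \<longlonglongrightarrow> (LINT x|?M. w x * ?g r x)"
    proof (rule integral_dominated_convergence[where w="\<lambda>x. \<bar>w x\<bar> * (2 * \<rho> * norm e)"])
      show "integrable ?M (\<lambda>x. \<bar>w x\<bar> * (2 * \<rho> * norm e))" using w by simp
      show "(\<lambda>x. w x * ?g r x) \<in> borel_measurable ?M"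
        by (intro borel_measurable_times wm gm)
      show "(\<lambda>x. w x * ((?b (r + X i) x - ?b r x) / X i)) \<in> borel_measurable ?M" for i
        by (intro borel_measurable_times wm borel_measurable_divide borel_measurable_diff bm
            borel_measurable_const)
      show "AE x in ?M. (\<lambda>i. w x * ((?b (r + X i) x - ?b r x) / X i)) \<longlonglongrightarrow> w x * ?g r x"
      proof (intro AE_I2 tendsto_mult_left)
        fix x
        have "((\<lambda>h. (?b (r + h) x - ?b r x) / h) \<longlongrightarrow> ?g r x) (at 0)"
          using bump_center_derivative[of \<rho> c e x r] by (simp add: DERIV_def)
        then show "(\<lambda>i. (?b (r + X i) x - ?b r x) / X i) \<longlonglongrightarrow> ?g r x"
          using X0 X by (auto simp: tendsto_at_iff_sequentially comp_def)
      qed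
      show "AE x in ?M. norm (w x * ((?b (r + X i) x - ?b r x) / X i)) \<le> \<bar>w x\<bar> * (2 * \<rho> * norm e)" for i
      proof (intro AE_I2)
        fix x
        have "\<bar>(?b (r + X i) x - ?b r x) / X i\<bar> \<le> 2 * \<rho> * norm e"
          using lip[of r "X i" x] X0 by (simp add: divide_le_eq)
        then show "norm (w x * ((?b (r + X i) x - ?b r x) / X i)) \<le> \<bar>w x\<bar> * (2 * \<rho> * norm e)"
          unfolding real_norm_def abs_mult by (rule mult_left_mono) simp
      qed
    qed
    then show "(\<lambda>i. (D (r + X i) - D r) / X i) \<longlonglongrightarrow> (LINT x|?M. w x * ?g r x)"
      by (simp only: eq)
  qed
  have "D 1 = D 0"
  proof (rule DERIV_isconst_end[of 0 1 D])
    show "continuous_on {0..1} D"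
      using der DERIV_isCont continuous_at_imp_continuous_on by blast
    fix r :: real assume "0 < r" "r < 1"
    then show "DERIV D r :> 0" using der[of r] zero[of r] by simp
  qed simp
  then show ?thesis by (simp add: D_def)
qed

text \<open>A product with one factor for each half-space \<open>a \<bullet> x \<le> b\<close> of the polytope. The argument \<open>k (b - a \<bullet> x) - 1\<close>
is negative within a distance of order \<open>1 / k\<close> of the boundary, which keeps the support inside, and tends to infinity
at each interior point.\<close>

lemma polytope_cutoffs:
  fixes P :: "(real^'n) set"
  assumes "polytope P"
  obtains \<psi> :: "nat \<Rightarrow> real^'n \<Rightarrow> real"
  where "\<And>k. \<psi> k \<in> test_functions (interior P)"
    and "\<And>k x. 0 \<le> \<psi> k x" "\<And>k x. \<psi> k x \<le> 1"
    and "\<And>x. x \<in> interior P \<Longrightarrow> (\<lambda>k. \<psi> k x) \<longlonglongrightarrow> 1"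
proof -
  have "polyhedron P" using assms by (rule polytope_imp_polyhedron)
  then obtain H where H: "finite H" "P = \<Inter>H"
    and "\<forall>h\<in>H. \<exists>a b. a \<noteq> 0 \<and> h = {x. a \<bullet> x \<le> b}"
    unfolding polyhedron_def by blast
  then obtain a b where ab: "\<And>h. h \<in> H \<Longrightarrow> a h \<noteq> (0::real^'n)" "\<And>h. h \<in> H \<Longrightarrow> h = {x. a h \<bullet> x \<le> b h}"
    by metis
  have P: "P = {x. \<forall>h\<in>H. a h \<bullet> x \<le> b h}" using H(2) ab(2) by blast
  have interior: "interior P = {x. \<forall>h\<in>H. a h \<bullet> x < b h}"
  proof -
    have "interior (\<Inter>H') = \<Inter>(interior ` H')" if "finite H'" for H' :: "(real^'n) set set"
      using that by induction auto
    from this[OF H(1)] have "interior P = \<Inter>(interior ` H)"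
      by (simp only: H(2))
    moreover have "interior h = {x. a h \<bullet> x < b h}" if "h \<in> H" for h
      using interior_halfspace_le[OF ab(1)[OF that], of "b h"] ab(2)[OF that] by simp
    ultimately have "interior P = (\<Inter>h\<in>H. {x. a h \<bullet> x < b h})"
      by simp
    also have "\<dots> = {x. \<forall>h\<in>H. a h \<bullet> x < b h}"
      by blast
    finally show ?thesis .
  qed
  define \<psi> where "\<psi> k x = (\<Prod>h\<in>H. flat 0 (real k * (b h - a h \<bullet> x) - 1))" for k x
  show thesis
  proof
    fix k x
    show "0 \<le> \<psi> k x" by (simp add: \<psi>_def prod_nonneg flat_nonneg)
    show "\<psi> k x \<le> 1" by (simp add: \<psi>_def prod_le_1 flat_nonneg flat_0_le_1)
  next
    fix k
    let ?C = "{x. \<forall>h\<in>H. a h \<bullet> x \<le> b h - 1 / real k}"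
    have sub: "{x. \<psi> k x \<noteq> 0} \<subseteq> (if k = 0 \<and> H \<noteq> {} then {} else ?C)"
    proof
      fix x assume "x \<in> {x. \<psi> k x \<noteq> 0}"
      then have "\<And>h. h \<in> H \<Longrightarrow> flat 0 (real k * (b h - a h \<bullet> x) - 1) \<noteq> 0"
        using H(1) by (simp add: \<psi>_def)
      then have *: "\<And>h. h \<in> H \<Longrightarrow> 0 < real k * (b h - a h \<bullet> x) - 1"
        by (metis flat_def linorder_not_less)
      have "a h \<bullet> x \<le> b h - 1 / real k" if "h \<in> H" for h
        using *[OF that] by (cases "k = 0") (auto simp: field_simps)
      then show "x \<in> (if k = 0 \<and> H \<noteq> {} then {} else ?C)"
        using * by auto
    qed
    have "closed ?C"
      by (simp add: Collect_ball_eq closed_INT closed_halfspace_le)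
    then have cl: "closure {x. \<psi> k x \<noteq> 0} \<subseteq> (if k = 0 \<and> H \<noteq> {} then {} else ?C)"
      using sub by (simp add: closure_minimal)
    moreover have "(if k = 0 \<and> H \<noteq> {} then {} else ?C) \<subseteq> interior P"
      unfolding interior by (auto split: if_splits) (smt (verit) of_nat_0_less_iff zero_less_divide_1_iff)
    ultimately have cl: "closure {x. \<psi> k x \<noteq> 0} \<subseteq> interior P" by blast
    then have "bounded (closure {x. \<psi> k x \<noteq> 0})"
      by (meson assms bounded_subset interior_subset polytope_imp_bounded)
    moreover have "Ck m (\<psi> k)" for m
      unfolding \<psi>_def by (intro Ck_prod Ck_flat Ck_minus Ck_mult Ck_const Ck_inner)
    ultimately show "\<psi> k \<in> test_functions (interior P)"
      using cl by (simp add: test_functions_def compact_eq_bounded_closed)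
  next
    fix x assume x: "x \<in> interior P"
    have "(\<lambda>k. flat 0 (real k * (b h - a h \<bullet> x) - 1)) \<longlonglongrightarrow> 1" if h: "h \<in> H" for h
    proof -
      have pos: "b h - a h \<bullet> x > 0" using x h by (simp add: interior)
      have lim: "filterlim (\<lambda>k. real k * (b h - a h \<bullet> x) - 1) at_top sequentially"
        using pos by real_asymp
      have "(flat 0 \<longlongrightarrow> 1) at_top"
      proof (rule Lim_transform_eventually)
        show "((\<lambda>t::real. exp (- (1 / t))) \<longlongrightarrow> 1) at_top" by real_asymp
        show "\<forall>\<^sub>F t in at_top. exp (- (1 / t)) = flat 0 t"
          using eventually_gt_at_top[of "0::real"] by eventually_elim (simp add: flat_def)
      qed
      then show ?thesis using lim by (rule filterlim_compose)
    qed
    then have "(\<lambda>k. \<psi> k x) \<longlonglongrightarrow> (\<Prod>h\<in>H. 1)"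
      unfolding \<psi>_def by (rule tendsto_prod)
    then show "(\<lambda>k. \<psi> k x) \<longlonglongrightarrow> 1" by simp
  qed
qed

section \<open>Integration over a cone with a flat base\<close>

lemma nn_integral_lborel_affine:
  fixes t :: "'a::euclidean_space"
  assumes [measurable]: "f \<in> borel_measurable borel" and "c > 0"
  shows "(\<integral>\<^sup>+x. f x \<partial>lborel) = (\<integral>\<^sup>+x. ennreal (c ^ DIM('a)) * f (t + c *\<^sub>R x) \<partial>lborel)"
proof -
  have "(\<integral>\<^sup>+x. f x \<partial>lborel) =
    (\<integral>\<^sup>+x. f x \<partial>density (distr lborel borel (\<lambda>x. t + c *\<^sub>R x)) (\<lambda>_. ennreal (c ^ DIM('a))))"
    using lborel_affine[of c t] assms(2) by (simp add: ennreal_power[symmetric])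
  also have "\<dots> = (\<integral>\<^sup>+x. ennreal (c ^ DIM('a)) * f (t + c *\<^sub>R x) \<partial>lborel)"
    by (simp add: nn_integral_density nn_integral_distr)
  finally show ?thesis .
qed

definition hyperplane_proj :: "'a::euclidean_space \<Rightarrow> real \<Rightarrow> 'a \<Rightarrow> 'a" where
  "hyperplane_proj \<nu> \<beta> z = z - (\<nu> \<bullet> z - \<beta>) *\<^sub>R \<nu>"

text \<open>The set that carries the surface measure of \<open>F\<close>, for \<open>F\<close> in the hyperplane \<open>\<nu> \<bullet> x = \<beta>\<close> with unit normal \<open>\<nu>\<close>.\<close>

definition slab :: "'a::euclidean_space \<Rightarrow> real \<Rightarrow> 'a set \<Rightarrow> 'a set" where
  "slab \<nu> \<beta> F = {z. hyperplane_proj \<nu> \<beta> z \<in> F \<and> \<bar>\<nu> \<bullet> z - \<beta>\<bar> \<le> 1/2}"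

lemma hyperplane_proj_measurable [measurable]: "hyperplane_proj \<nu> \<beta> \<in> borel_measurable borel"
  unfolding hyperplane_proj_def[abs_def] by measurable

lemma slab_measurable [measurable]:
  assumes [measurable]: "F \<in> sets borel"
  shows "slab \<nu> \<beta> F \<in> sets borel"
  unfolding slab_def by measurable

lemma inner_hyperplane_proj: "norm \<nu> = 1 \<Longrightarrow> \<nu> \<bullet> hyperplane_proj \<nu> \<beta> z = \<beta>"
  by (simp add: hyperplane_proj_def inner_diff_right power2_norm_eq_inner[symmetric])

text \<open>The cone over \<open>F\<close> without its apex \<open>p\<close>. With \<open>h = \<beta> - \<nu> \<bullet> p\<close>, the ray from \<open>p\<close> through \<open>x\<close> meets the hyperplane
\<open>\<nu> \<bullet> y = \<beta>\<close> in \<open>p + (h / (\<nu> \<bullet> (x - p))) (x - p)\<close>.\<close>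

definition cone_set :: "'a::euclidean_space \<Rightarrow> real \<Rightarrow> 'a set \<Rightarrow> 'a \<Rightarrow> 'a set" where
  "cone_set \<nu> \<beta> F p = {x. 0 < \<nu> \<bullet> (x - p) \<and> \<nu> \<bullet> (x - p) \<le> \<beta> - \<nu> \<bullet> p \<and>
      p + ((\<beta> - \<nu> \<bullet> p) / (\<nu> \<bullet> (x - p))) *\<^sub>R (x - p) \<in> F}"

lemma cone_set_measurable [measurable]:
  assumes [measurable]: "F \<in> sets borel"
  shows "cone_set \<nu> \<beta> F p \<in> sets borel"
  unfolding cone_set_def by measurable

text \<open>The change of variables \<open>x = p + t (y - p)\<close> with height \<open>t\<close> and base point \<open>y\<close>, where the integral over \<open>y\<close> is
taken over the slab of thickness 1 and \<open>y\<close> is the projection of \<open>z\<close>. For fixed \<open>t\<close>, scaling about \<open>p\<close> maps the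
slab to one of thickness \<open>t\<close> around the slice of the cone at height \<open>t\<close>, with factor \<open>t\<close> to the power \<open>- n\<close>. Then the
height \<open>t\<close> is exchanged for the signed distance \<open>r\<close> of the slab point from the slice, and a translation along \<open>\<nu>\<close>
makes the integrand depend on \<open>r\<close> only through the thickness. Only scalings, translations and Tonelli's
theorem are involved, so that no determinant has to be computed.\<close>

lemma nn_integral_cone:
  fixes \<nu> p :: "'a::euclidean_space" and G :: "'a \<Rightarrow> ennreal"
  assumes [measurable]: "F \<in> sets borel" "G \<in> borel_measurable borel"
    and \<nu>: "norm \<nu> = 1" and h: "h = \<beta> - \<nu> \<bullet> p" "h > 0"
  shows "(\<integral>\<^sup>+x. indicator (cone_set \<nu> \<beta> F p) x * G x \<partial>lborel) =
    (\<integral>\<^sup>+t. \<integral>\<^sup>+z. ennreal (h * t ^ (DIM('a) - 1)) * indicator {0<..1} t * indicator (slab \<nu> \<beta> F) z *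
        G (p + t *\<^sub>R (hyperplane_proj \<nu> \<beta> z - p)) \<partial>lborel \<partial>lborel)"
proof -
  define H where "H x = indicator F (p + (h / (\<nu> \<bullet> (x - p))) *\<^sub>R (x - p)) * G x" for x
  have [measurable]: "H \<in> borel_measurable borel" unfolding H_def[abs_def] by measurable
  have \<nu>\<nu>: "\<nu> \<bullet> \<nu> = 1" using \<nu> by (simp add: power2_norm_eq_inner[symmetric])
  define \<tau> where "\<tau> x = \<nu> \<bullet> (x - p) / h" for x
  have [measurable]: "\<tau> \<in> borel_measurable borel" unfolding \<tau>_def[abs_def] by measurable
  (* J r x is the contribution of the point x of the cone, at height \<tau> x, that is reached from a point of the
     scaled slab at signed distance r; the factor 1 / \<tau> x compensates for the thickness of that slab. *)
  define J where "J r x = (indicator {0<..1} (\<tau> x) * ennreal (1 / \<tau> x) * indicator {- \<tau> x / 2..\<tau> x / 2} r) * H x"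
    for r x
  have [measurable]: "(\<lambda>(r, x). J r x) \<in> borel_measurable (lborel \<Otimes>\<^sub>M lborel)"
  proof -
    have [measurable]: "(\<lambda>(r, x). indicator {- \<tau> x / 2..\<tau> x / 2} r :: ennreal) \<in> borel_measurable (lborel \<Otimes>\<^sub>M lborel)"
    proof -
      have "(\<lambda>(r, x). indicator {- \<tau> x / 2..\<tau> x / 2} r :: ennreal) =
         (\<lambda>p. if - \<tau> (snd p) / 2 \<le> fst p \<and> fst p \<le> \<tau> (snd p) / 2 then 1 else 0)"
        by (auto simp: fun_eq_iff indicator_def)
      then show ?thesis by simp
    qed
    show ?thesis unfolding J_def[abs_def] by measurable
  qed
  have "(\<integral>\<^sup>+t. \<integral>\<^sup>+z. ennreal (h * t ^ (DIM('a) - 1)) * indicator {0<..1} t * indicator (slab \<nu> \<beta> F) z *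
        G (p + t *\<^sub>R (hyperplane_proj \<nu> \<beta> z - p)) \<partial>lborel \<partial>lborel)
      = (\<integral>\<^sup>+t. \<integral>\<^sup>+x. ennreal h * J (t * h - \<nu> \<bullet> (x - p)) (x + (t * h - \<nu> \<bullet> (x - p)) *\<^sub>R \<nu>) \<partial>lborel \<partial>lborel)"
  proof (rule nn_integral_cong)
    fix t :: real
    show "(\<integral>\<^sup>+z. ennreal (h * t ^ (DIM('a) - 1)) * indicator {0<..1} t * indicator (slab \<nu> \<beta> F) z *
        G (p + t *\<^sub>R (hyperplane_proj \<nu> \<beta> z - p)) \<partial>lborel)
      = (\<integral>\<^sup>+x. ennreal h * J (t * h - \<nu> \<bullet> (x - p)) (x + (t * h - \<nu> \<bullet> (x - p)) *\<^sub>R \<nu>) \<partial>lborel)"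
    proof (cases "0 < t \<and> t \<le> 1")
      case False
      have "\<tau> (x + (t * h - \<nu> \<bullet> (x - p)) *\<^sub>R \<nu>) = t" for x
        using h(2) by (simp add: \<tau>_def inner_diff_right inner_add_right \<nu>\<nu>)
      then show ?thesis using False by (simp add: J_def)
    next
      case True
      have "(\<integral>\<^sup>+z. ennreal (h * t ^ (DIM('a) - 1)) * indicator {0<..1} t * indicator (slab \<nu> \<beta> F) z *
          G (p + t *\<^sub>R (hyperplane_proj \<nu> \<beta> z - p)) \<partial>lborel)
        = (\<integral>\<^sup>+x. ennreal ((1 / t) ^ DIM('a)) * (ennreal (h * t ^ (DIM('a) - 1)) * indicator {0<..1} t *
            indicator (slab \<nu> \<beta> F) ((p - (1/t) *\<^sub>R p) + (1/t) *\<^sub>R x) *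
            G (p + t *\<^sub>R (hyperplane_proj \<nu> \<beta> ((p - (1/t) *\<^sub>R p) + (1/t) *\<^sub>R x) - p))) \<partial>lborel)"
        using True by (subst nn_integral_lborel_affine[where c="1/t" and t="p - (1/t) *\<^sub>R p"]) auto
      also have "\<dots> = (\<integral>\<^sup>+x. ennreal h * J (t * h - \<nu> \<bullet> (x - p)) (x + (t * h - \<nu> \<bullet> (x - p)) *\<^sub>R \<nu>) \<partial>lborel)"
      proof (rule nn_integral_cong)
        fix x
        let ?z = "(p - (1/t) *\<^sub>R p) + (1/t) *\<^sub>R x"
        let ?x = "x + (t * h - \<nu> \<bullet> (x - p)) *\<^sub>R \<nu>"
        have t: "t > 0" using True by simp
        have \<tau>x: "\<tau> ?x = t" "\<nu> \<bullet> (?x - p) = t * h"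
          using h(2) by (simp_all add: \<tau>_def inner_diff_right inner_add_right \<nu>\<nu>)
        have \<nu>z: "\<nu> \<bullet> ?z - \<beta> = - (t * h - \<nu> \<bullet> (x - p)) / t"
          using t h(1) by (simp add: inner_diff_right inner_add_right divide_simps) (simp add: algebra_simps)
        have P: "t *\<^sub>R (hyperplane_proj \<nu> \<beta> ?z - p) = ?x - p"
        proof -
          have "t *\<^sub>R (?z - (- s / t) *\<^sub>R \<nu> - p) = (x + s *\<^sub>R \<nu>) - p" for s
            using t by (simp add: algebra_simps)
          then show ?thesis unfolding hyperplane_proj_def \<nu>z .
        qed
        have P': "p + (h / (t * h)) *\<^sub>R (?x - p) = hyperplane_proj \<nu> \<beta> ?z"
          unfolding P[symmetric] using t h(2) by simp
        have abs: "\<bar>- s / t\<bar> \<le> 1 / 2 \<longleftrightarrow> - t / 2 \<le> s \<and> s \<le> t / 2" for s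
          using t by (simp add: divide_le_eq) (auto simp: abs_le_iff)
        have ind: "indicator (slab \<nu> \<beta> F) ?z =
          (indicator F (hyperplane_proj \<nu> \<beta> ?z) * indicator {- t / 2..t / 2} (t * h - \<nu> \<bullet> (x - p)) :: ennreal)"
          unfolding slab_def mem_Collect_eq indicator_def \<nu>z abs by simp
        have J: "J (t * h - \<nu> \<bullet> (x - p)) ?x =
          ennreal (1 / t) * indicator {- t / 2..t / 2} (t * h - \<nu> \<bullet> (x - p)) *
            (indicator F (hyperplane_proj \<nu> \<beta> ?z) * G ?x)"
          unfolding J_def H_def \<tau>x P' using True by simp
        have "(1 / t) ^ Suc m * (h * t ^ m) = h * (1 / t)" for m
          using t by (simp add: power_divide)
        from this[of "DIM('a) - 1"]
        have "(1 / t) ^ DIM('a) * (h * t ^ (DIM('a) - 1)) = h * (1 / t)"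
          using DIM_positive[where 'a='a] by (simp only: Suc_diff_1)
        then have c: "ennreal ((1 / t) ^ DIM('a)) * ennreal (h * t ^ (DIM('a) - 1)) = ennreal h * ennreal (1 / t)"
          using t h(2) by (simp add: ennreal_mult[symmetric])
        have "ennreal ((1 / t) ^ DIM('a)) * (ennreal (h * t ^ (DIM('a) - 1)) * indicator {0<..1} t *
            indicator (slab \<nu> \<beta> F) ?z * G (p + t *\<^sub>R (hyperplane_proj \<nu> \<beta> ?z - p)))
          = (ennreal ((1 / t) ^ DIM('a)) * ennreal (h * t ^ (DIM('a) - 1))) * indicator (slab \<nu> \<beta> F) ?z * G ?x"
          unfolding P using True by (simp add: mult.assoc)
        also have "\<dots> = ennreal h * J (t * h - \<nu> \<bullet> (x - p)) ?x"
          unfolding c ind J by (simp add: mult_ac)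
        finally show "ennreal ((1 / t) ^ DIM('a)) * (ennreal (h * t ^ (DIM('a) - 1)) * indicator {0<..1} t *
            indicator (slab \<nu> \<beta> F) ?z * G (p + t *\<^sub>R (hyperplane_proj \<nu> \<beta> ?z - p)))
          = ennreal h * J (t * h - \<nu> \<bullet> (x - p)) ?x" .
      qed
      finally show ?thesis .
    qed
  qed
  also have "\<dots> = (\<integral>\<^sup>+x. \<integral>\<^sup>+t. ennreal h * J (t * h - \<nu> \<bullet> (x - p)) (x + (t * h - \<nu> \<bullet> (x - p)) *\<^sub>R \<nu>) \<partial>lborel \<partial>lborel)"
    by (rule lborel_pair.Fubini'[symmetric]) measurable
  also have "\<dots> = (\<integral>\<^sup>+x. \<integral>\<^sup>+r. J r (x + r *\<^sub>R \<nu>) \<partial>lborel \<partial>lborel)"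
  proof (rule nn_integral_cong)
    fix x
    have "(\<integral>\<^sup>+t. ennreal h * J (t * h - \<nu> \<bullet> (x - p)) (x + (t * h - \<nu> \<bullet> (x - p)) *\<^sub>R \<nu>) \<partial>lborel)
      = (\<integral>\<^sup>+r. ennreal (1 / h) * (ennreal h * J r (x + r *\<^sub>R \<nu>)) \<partial>lborel)"
      using h(2) by (subst nn_integral_lborel_affine[where c="1/h" and t="\<nu> \<bullet> (x - p) / h"])
        (auto simp: field_simps)
    also have "\<dots> = (\<integral>\<^sup>+r. J r (x + r *\<^sub>R \<nu>) \<partial>lborel)"
      using h(2) by (simp add: mult.assoc[symmetric] ennreal_mult[symmetric])
    finally show "(\<integral>\<^sup>+t. ennreal h * J (t * h - \<nu> \<bullet> (x - p)) (x + (t * h - \<nu> \<bullet> (x - p)) *\<^sub>R \<nu>) \<partial>lborel)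
      = (\<integral>\<^sup>+r. J r (x + r *\<^sub>R \<nu>) \<partial>lborel)" .
  qed
  also have "\<dots> = (\<integral>\<^sup>+r. \<integral>\<^sup>+x. J r (x + r *\<^sub>R \<nu>) \<partial>lborel \<partial>lborel)"
    by (rule lborel_pair.Fubini') measurable
  also have "\<dots> = (\<integral>\<^sup>+r. \<integral>\<^sup>+x. J r x \<partial>lborel \<partial>lborel)"
  proof (rule nn_integral_cong)
    fix r
    show "(\<integral>\<^sup>+x. J r (x + r *\<^sub>R \<nu>) \<partial>lborel) = (\<integral>\<^sup>+x. J r x \<partial>lborel)"
      by (subst (2) nn_integral_lborel_affine[where c=1 and t="r *\<^sub>R \<nu>"]) (auto simp: add.commute)
  qed
  also have "\<dots> = (\<integral>\<^sup>+x. \<integral>\<^sup>+r. J r x \<partial>lborel \<partial>lborel)"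
    by (rule lborel_pair.Fubini') measurable
  also have "\<dots> = (\<integral>\<^sup>+x. indicator {0<..1} (\<tau> x) * H x \<partial>lborel)"
  proof (rule nn_integral_cong)
    fix x
    have "(\<integral>\<^sup>+r. J r x \<partial>lborel) =
      (\<integral>\<^sup>+r. (indicator {0<..1} (\<tau> x) * ennreal (1 / \<tau> x) * H x) * indicator {- \<tau> x / 2..\<tau> x / 2} r \<partial>lborel)"
      by (simp add: J_def mult_ac)
    also have "\<dots> = (indicator {0<..1} (\<tau> x) * ennreal (1 / \<tau> x) * H x) * emeasure lborel {- \<tau> x / 2..\<tau> x / 2}"
      by (simp add: nn_integral_cmult)
    also have "\<dots> = indicator {0<..1} (\<tau> x) * H x"
    proof (cases "0 < \<tau> x \<and> \<tau> x \<le> 1")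
      case True
      then have "ennreal (1 / \<tau> x) * emeasure lborel {- \<tau> x / 2..\<tau> x / 2} = 1"
        by (simp add: ennreal_mult[symmetric])
      then show ?thesis by (metis (no_types, lifting) mult.assoc mult.commute mult.right_neutral)
    qed auto
    finally show "(\<integral>\<^sup>+r. J r x \<partial>lborel) = indicator {0<..1} (\<tau> x) * H x" .
  qed
  also have "\<dots> = (\<integral>\<^sup>+x. indicator (cone_set \<nu> \<beta> F p) x * G x \<partial>lborel)"
  proof (rule nn_integral_cong)
    fix x
    have "0 < \<tau> x \<longleftrightarrow> 0 < \<nu> \<bullet> (x - p)" "\<tau> x \<le> 1 \<longleftrightarrow> \<nu> \<bullet> (x - p) \<le> h"
      using h(2) by (auto simp: \<tau>_def zero_less_divide_iff)
    then show "indicator {0<..1} (\<tau> x) * H x = indicator (cone_set \<nu> \<beta> F p) x * G x"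
      by (auto simp: H_def cone_set_def h(1)[symmetric] indicator_def)
  qed
  finally show ?thesis by simp
qed

text \<open>Links the projection used in the definition of the surface measure to an explicit formula.\<close>

lemma closest_point_hyperplane:
  assumes \<nu>: "norm \<nu> = 1"
  shows "closest_point {x. \<nu> \<bullet> x = \<beta>} = hyperplane_proj \<nu> \<beta>"
proof
  fix z
  have "hyperplane_proj \<nu> \<beta> z = closest_point {x. \<nu> \<bullet> x = \<beta>} z"
  proof (rule closest_point_unique)
    show "convex {x. \<nu> \<bullet> x = \<beta>}" by (rule convex_hyperplane)
    show "closed {x. \<nu> \<bullet> x = \<beta>}" by (rule closed_hyperplane)
    show "hyperplane_proj \<nu> \<beta> z \<in> {x. \<nu> \<bullet> x = \<beta>}" using inner_hyperplane_proj[OF \<nu>] by simp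
    show "\<forall>y\<in>{x. \<nu> \<bullet> x = \<beta>}. dist z (hyperplane_proj \<nu> \<beta> z) \<le> dist z y"
    proof
      fix y assume "y \<in> {x. \<nu> \<bullet> x = \<beta>}"
      then have "\<nu> \<bullet> z - \<beta> = \<nu> \<bullet> (z - y)" by (simp add: inner_diff_right)
      then have "\<bar>\<nu> \<bullet> z - \<beta>\<bar> \<le> norm \<nu> * norm (z - y)" by (metis Cauchy_Schwarz_ineq2)
      then show "dist z (hyperplane_proj \<nu> \<beta> z) \<le> dist z y"
        by (simp add: hyperplane_proj_def dist_norm \<nu>)
    qed
  qed
  then show "closest_point {x. \<nu> \<bullet> x = \<beta>} z = hyperplane_proj \<nu> \<beta> z" by simp
qed

lemma face_integral_slab:
  fixes F :: "(real^'n) set"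
  assumes \<nu>: "norm \<nu> = 1" and hull: "affine hull F = {x. \<nu> \<bullet> x = \<beta>}"
    and F: "closed F" and g: "continuous_on F g"
  shows "face_integral F g =
    (LINT z|lborel. indicator (slab \<nu> \<beta> F) z * g (hyperplane_proj \<nu> \<beta> z))"
proof -
  let ?\<pi> = "hyperplane_proj \<nu> \<beta>"
  have [measurable]: "F \<in> sets borel" using F by simp
  have dist: "dist z (?\<pi> z) = \<bar>\<nu> \<bullet> z - \<beta>\<bar>" for z
    by (simp add: hyperplane_proj_def dist_norm \<nu>)
  have [measurable]: "(\<lambda>x. indicator F x * g x) \<in> borel_measurable borel"
    using borel_measurable_continuous_on_indicator[OF _ g] by simp
  have "surface_measure F = distr (restrict_space lborel (slab \<nu> \<beta> F)) borel ?\<pi>"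
    unfolding surface_measure_def Let_def hull closest_point_hyperplane[OF \<nu>] dist slab_def ..
  then have "face_integral F g =
     (LINT x|distr (restrict_space lborel (slab \<nu> \<beta> F)) borel ?\<pi>. indicator F x * g x)"
    by (simp add: face_integral_def set_lebesgue_integral_def)
  also have "\<dots> = (LINT z|restrict_space lborel (slab \<nu> \<beta> F). indicator F (?\<pi> z) * g (?\<pi> z))"
    by (rule integral_distr) (auto intro: measurable_restrict_space1)
  also have "\<dots> = (LINT z|lborel. indicator (slab \<nu> \<beta> F) z *\<^sub>R (indicator F (?\<pi> z) * g (?\<pi> z)))"
    by (rule integral_restrict_space) simp
  also have "\<dots> = (LINT z|lborel. indicator (slab \<nu> \<beta> F) z * g (?\<pi> z))"
    by (intro Bochner_Integration.integral_cong) (auto simp: indicator_def slab_def)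
  finally show ?thesis .
qed

text \<open>The formula for nonnegative integrands says that two measures agree; this transfers it to signed ones.\<close>

lemma cone_integral:
  fixes \<nu> p :: "'a::euclidean_space" and G :: "'a \<Rightarrow> real"
  assumes [measurable]: "F \<in> sets borel" "G \<in> borel_measurable borel"
    and \<nu>: "norm \<nu> = 1" and h: "h = \<beta> - \<nu> \<bullet> p" "h > 0"
    and int: "integrable lborel (\<lambda>x. indicator (cone_set \<nu> \<beta> F p) x * G x)"
  shows "(LINT x|lborel. indicator (cone_set \<nu> \<beta> F p) x * G x) =
    (LINT z|lborel. LINT t|lborel. h * t ^ (DIM('a) - 1) * indicator {0<..1} t * indicator (slab \<nu> \<beta> F) z *
        G (p + t *\<^sub>R (hyperplane_proj \<nu> \<beta> z - p)))"
proof -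
  define w where "w = (\<lambda>(t, z). h * t ^ (DIM('a) - 1) * indicator {0<..1} t * indicator (slab \<nu> \<beta> F) z)"
  define \<Phi> where "\<Phi> = (\<lambda>(t, z). p + t *\<^sub>R (hyperplane_proj \<nu> \<beta> z - p))"
  let ?L = "lborel \<Otimes>\<^sub>M lborel :: (real \<times> 'a) measure"
  have [measurable]: "w \<in> borel_measurable ?L" unfolding w_def by measurable
  have [measurable]: "\<Phi> \<in> ?L \<rightarrow>\<^sub>M borel" unfolding \<Phi>_def by measurable
  have w0: "0 \<le> w x" for x
    using h(2) by (auto simp: w_def split: prod.splits) (simp add: indicator_def)
  let ?c = "\<lambda>x. indicator (cone_set \<nu> \<beta> F p) x :: real"
  have eq: "density lborel (\<lambda>x. ennreal (?c x)) = distr (density ?L (\<lambda>x. ennreal (w x))) borel \<Phi>"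
  proof (rule measure_eqI)
    fix A :: "'a set" assume "A \<in> sets (density lborel (\<lambda>x. ennreal (?c x)))"
    then have [measurable]: "A \<in> sets borel" by simp
    have "emeasure (density lborel (\<lambda>x. ennreal (?c x))) A =
        (\<integral>\<^sup>+x. indicator (cone_set \<nu> \<beta> F p) x * indicator A x \<partial>lborel)"
      by (subst emeasure_density) (auto simp: ennreal_indicator)
    also have "\<dots> = (\<integral>\<^sup>+t. \<integral>\<^sup>+z. ennreal (h * t ^ (DIM('a) - 1)) * indicator {0<..1} t *
        indicator (slab \<nu> \<beta> F) z * indicator A (p + t *\<^sub>R (hyperplane_proj \<nu> \<beta> z - p)) \<partial>lborel \<partial>lborel)"
      by (rule nn_integral_cone) (use \<nu> h in auto)
    also have "\<dots> = (\<integral>\<^sup>+t. \<integral>\<^sup>+z. ennreal (w (t, z)) * indicator A (\<Phi> (t, z)) \<partial>lborel \<partial>lborel)"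
      using h(2) by (intro nn_integral_cong) (auto simp: w_def \<Phi>_def indicator_def)
    also have "\<dots> = (\<integral>\<^sup>+x. ennreal (w x) * indicator A (\<Phi> x) \<partial>?L)"
      by (rule lborel.nn_integral_fst) measurable
    also have "\<dots> = emeasure (distr (density ?L (\<lambda>x. ennreal (w x))) borel \<Phi>) A"
    proof -
      have [measurable]: "\<Phi> -` A \<inter> space ?L \<in> sets ?L" by (rule measurable_sets[of _ _ borel]) measurable
      then have "emeasure (distr (density ?L (\<lambda>x. ennreal (w x))) borel \<Phi>) A
          = (\<integral>\<^sup>+x. ennreal (w x) * indicator (\<Phi> -` A \<inter> space ?L) x \<partial>?L)"
        by (subst emeasure_distr) (simp_all add: emeasure_density)
      also have "\<dots> = (\<integral>\<^sup>+x. ennreal (w x) * indicator A (\<Phi> x) \<partial>?L)"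
        by (intro nn_integral_cong) (auto simp: indicator_def)
      finally show ?thesis by simp
    qed
    finally show "emeasure (density lborel (\<lambda>x. ennreal (?c x))) A =
        emeasure (distr (density ?L (\<lambda>x. ennreal (w x))) borel \<Phi>) A" .
  qed simp
  have i1: "integrable (density lborel (\<lambda>x. ennreal (?c x))) G"
    by (subst integrable_density) (use int in auto)
  have i2: "integrable ?L (\<lambda>x. w x * G (\<Phi> x))"
  proof -
    have "integrable (density ?L (\<lambda>x. ennreal (w x))) (\<lambda>x. G (\<Phi> x))"
      using i1 unfolding eq by (subst (asm) integrable_distr_eq) auto
    then show ?thesis by (subst (asm) integrable_density) (use w0 in auto)
  qed
  have "(LINT x|lborel. ?c x * G x) = (LINT x|density lborel (\<lambda>x. ennreal (?c x)). G x)"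
    by (subst integral_density) auto
  also have "\<dots> = (LINT x|density ?L (\<lambda>x. ennreal (w x)). G (\<Phi> x))"
    unfolding eq by (subst integral_distr) auto
  also have "\<dots> = (LINT x|?L. w x * G (\<Phi> x))"
    by (subst integral_density) (use w0 in auto)
  also have "\<dots> = (LINT z|lborel. LINT t|lborel. w (t, z) * G (\<Phi> (t, z)))"
    using lborel_pair.integral_snd[of "\<lambda>t z. w (t, z) * G (\<Phi> (t, z))"] i2
    by (simp add: case_prod_unfold)
  finally show ?thesis by (simp add: w_def \<Phi>_def)
qed

lemma Ck_grad_continuous:
  assumes "Ck (Suc 0) \<phi>"
  shows "continuous_on S (grad \<phi>)"
proof -
  have "continuous_on S (\<lambda>x. \<chi> i. grad \<phi> x $ i)"
    by (intro continuous_on_vec_lambda Ck_continuous_on[OF Ck_Suc_grad[OF assms]])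
  then show ?thesis by simp
qed

lemma integral_lebesgue_on_lborel:
  fixes g :: "'a::euclidean_space \<Rightarrow> real"
  assumes [measurable]: "K \<in> sets borel" "g \<in> borel_measurable borel"
  shows "(LINT x|lebesgue_on K. g x) = (LINT x|lborel. indicator K x * g x)"
proof -
  have "(LINT x|lebesgue_on K. g x) = (LINT x|lebesgue. indicator K x *\<^sub>R g x)"
    by (rule integral_restrict_space) simp
  also have "\<dots> = (LINT x|lborel. indicator K x *\<^sub>R g x)"
    by (rule integral_completion) measurable
  finally show ?thesis by simp
qed

lemma convex_hull_insert_cone_set:
  fixes C :: "'a::euclidean_space set"
  assumes ne: "C \<noteq> {}" and F: "F = convex hull C" "F \<subseteq> {x. \<nu> \<bullet> x = \<beta>}" and p: "\<nu> \<bullet> p < \<beta>"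
  shows "convex hull (insert p C) - {p} = cone_set \<nu> \<beta> F p"
proof (intro set_eqI iffI)
  fix x assume x: "x \<in> convex hull (insert p C) - {p}"
  then obtain u v y where uv: "0 \<le> u" "0 \<le> v" "u + v = 1" "y \<in> F" "x = u *\<^sub>R p + v *\<^sub>R y"
    using convex_hull_insert[OF ne, of p] F(1) by auto
  have xp: "x - p = v *\<^sub>R (y - p)" using uv(3,5) by (simp add: algebra_simps eq_diff_eq flip: scaleR_add_left)
  have "v \<noteq> 0" using x xp by auto
  then have v: "0 < v" "v \<le> 1" using uv by auto
  have "\<nu> \<bullet> (y - p) = \<beta> - \<nu> \<bullet> p" using F(2) uv(4) by (auto simp: inner_diff_right)
  then have "\<nu> \<bullet> (x - p) = v * (\<beta> - \<nu> \<bullet> p)" unfolding xp by simp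
  then show "x \<in> cone_set \<nu> \<beta> F p"
    unfolding cone_set_def mem_Collect_eq using v p uv(4) by (simp add: xp mult_left_le_one_le)
next
  fix x assume x: "x \<in> cone_set \<nu> \<beta> F p"
  define t where "t = \<nu> \<bullet> (x - p) / (\<beta> - \<nu> \<bullet> p)"
  define y where "y = p + ((\<beta> - \<nu> \<bullet> p) / (\<nu> \<bullet> (x - p))) *\<^sub>R (x - p)"
  have t: "0 < t" "t \<le> 1" using x p by (auto simp: cone_set_def t_def)
  have "y \<in> F" using x by (simp add: cone_set_def y_def)
  moreover have "x = (1 - t) *\<^sub>R p + t *\<^sub>R y"
  proof -
    have "t * ((\<beta> - \<nu> \<bullet> p) / (\<nu> \<bullet> (x - p))) = 1"
      using x p by (simp add: t_def cone_set_def)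
    moreover have "t *\<^sub>R (y - p) = (t * ((\<beta> - \<nu> \<bullet> p) / (\<nu> \<bullet> (x - p)))) *\<^sub>R (x - p)"
      by (simp only: y_def add_diff_cancel_left' scaleR_scaleR)
    ultimately have "t *\<^sub>R (y - p) = x - p" by (simp only: scaleR_one)
    then show ?thesis by (simp add: algebra_simps)
  qed
  ultimately have "x \<in> convex hull (insert p C)"
    using convexD[OF convex_convex_hull, of p "insert p C" y "1 - t" t] t F(1)
      hull_mono[OF subset_insertI, of convex C p] hull_inc[of p "insert p C"] by auto
  moreover have "x \<noteq> p" using x by (auto simp: cone_set_def)
  ultimately show "x \<in> convex hull (insert p C) - {p}" by simp
qed

text \<open>Along the ray \<open>p + t (y - p)\<close> the integrand, multiplied by \<open>t\<close> to the power \<open>n - 1\<close>, is the derivative of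
\<open>t\<^sup>n \<phi> (p + t (y - p))\<close>. So the inner integral of the cone formula is \<open>\<phi> y\<close>.\<close>

lemma green_cone:
  fixes C :: "(real^'n) set"
  assumes C: "finite C" "C \<noteq> {}" and F: "F = convex hull C" and hull: "affine hull F = {x. \<nu> \<bullet> x = \<beta>}"
    and \<nu>: "norm \<nu> = 1" and p: "\<nu> \<bullet> p < \<beta>" and \<phi>: "Ck (Suc 0) \<phi>"
  shows "(LINT x|lebesgue_on (convex hull (insert p C)). (x - p) \<bullet> grad \<phi> x + real CARD('n) * \<phi> x) =
    (\<beta> - \<nu> \<bullet> p) * face_integral F \<phi>"
proof -
  let ?K = "convex hull (insert p C)"
  let ?n = "CARD('n)"
  define h where "h = \<beta> - \<nu> \<bullet> p"
  have h: "h > 0" using p by (simp add: h_def)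
  define G where "G x = (x - p) \<bullet> grad \<phi> x + real ?n * \<phi> x" for x
  have \<phi>c: "continuous_on S \<phi>" for S using Ck_continuous_on[OF \<phi>] .
  have Gc: "continuous_on S G" for S
    unfolding G_def[abs_def] by (intro continuous_intros Ck_grad_continuous \<phi> \<phi>c)
  have [measurable]: "G \<in> borel_measurable borel"
    using Gc by (rule borel_measurable_continuous_onI)
  have K: "compact ?K" "compact F" using C F by (auto intro: finite_imp_compact_convex_hull)
  have [measurable]: "?K \<in> sets borel" "F \<in> sets borel"
    using K by (simp_all add: borel_compact)
  have Fsub: "F \<subseteq> {x. \<nu> \<bullet> x = \<beta>}" using hull_subset[of F affine] hull by simp
  have cone: "?K - {p} = cone_set \<nu> \<beta> F p"
    by (rule convex_hull_insert_cone_set[OF C(2) F Fsub p])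
  have int: "integrable lborel (\<lambda>x. indicator ?K x * G x)"
    using borel_integrable_compact[OF K(1) Gc] by simp
  have ae: "AE x in lborel. indicator ?K x * G x = indicator (cone_set \<nu> \<beta> F p) x * G x"
    using AE_lborel_singleton[of p] unfolding cone[symmetric]
    by eventually_elim (auto simp: indicator_def)
  have int': "integrable lborel (\<lambda>x. indicator (cone_set \<nu> \<beta> F p) x * G x)"
    by (rule integrable_cong_AE_imp[OF int _ ae]) measurable
  have "(LINT x|lebesgue_on ?K. G x) = (LINT x|lborel. indicator ?K x * G x)"
    by (rule integral_lebesgue_on_lborel) measurable
  also have "\<dots> = (LINT x|lborel. indicator (cone_set \<nu> \<beta> F p) x * G x)"
    by (rule integral_cong_AE[OF _ _ ae]) measurable
  also have "\<dots> = (LINT z|lborel. LINT t|lborel. h * t ^ (?n - 1) * indicator {0<..1} t *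
      indicator (slab \<nu> \<beta> F) z * G (p + t *\<^sub>R (hyperplane_proj \<nu> \<beta> z - p)))"
    using cone_integral[OF _ _ \<nu> h_def h int'] by simp
  also have "\<dots> = (LINT z|lborel. h * (indicator (slab \<nu> \<beta> F) z * \<phi> (hyperplane_proj \<nu> \<beta> z)))"
  proof (rule Bochner_Integration.integral_cong[OF refl])
    fix z
    let ?y = "hyperplane_proj \<nu> \<beta> z"
    define \<gamma> where "\<gamma> t = p + t *\<^sub>R (?y - p)" for t
    have n: "Suc (?n - 1) = ?n" by simp
    have "(LINT t|lborel. (t ^ (?n - 1) * G (\<gamma> t)) * indicator {0..1} t) = 1 ^ ?n * \<phi> (\<gamma> 1) - 0 ^ ?n * \<phi> (\<gamma> 0)"
    proof (rule integral_FTC_Icc_real[where F="\<lambda>t. t ^ ?n * \<phi> (\<gamma> t)"])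
      fix t
      have "((\<lambda>t. \<phi> (\<gamma> t)) has_real_derivative grad \<phi> (\<gamma> t) \<bullet> (?y - p)) (at t)"
      proof -
        have "(\<gamma> has_derivative (\<lambda>s. s *\<^sub>R (?y - p))) (at t)"
          unfolding \<gamma>_def[abs_def] by (auto intro!: derivative_eq_intros)
        from has_derivative_compose[OF this Ck_Suc_derivative[OF \<phi>]]
        show ?thesis by (simp add: has_field_derivative_def mult.commute[of _ "grad \<phi> (\<gamma> t) \<bullet> (?y - p)"])
      qed
      then have "((\<lambda>t. t ^ ?n * \<phi> (\<gamma> t)) has_real_derivative
          t ^ ?n * (grad \<phi> (\<gamma> t) \<bullet> (?y - p)) + (real ?n * t ^ (?n - 1)) * \<phi> (\<gamma> t)) (at t)"
        by (auto intro!: derivative_eq_intros)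
      also have "t ^ ?n * (grad \<phi> (\<gamma> t) \<bullet> (?y - p)) + (real ?n * t ^ (?n - 1)) * \<phi> (\<gamma> t) = t ^ (?n - 1) * G (\<gamma> t)"
        using power_Suc[of t "?n - 1"] unfolding n
        by (simp add: G_def \<gamma>_def inner_commute algebra_simps)
      finally show "((\<lambda>t. t ^ ?n * \<phi> (\<gamma> t)) has_real_derivative t ^ (?n - 1) * G (\<gamma> t)) (at t)" .
    next
      have \<gamma>c: "continuous_on UNIV \<gamma>" unfolding \<gamma>_def[abs_def] by (intro continuous_intros)
      have "continuous_on UNIV (\<lambda>t. t ^ (?n - 1) * G (\<gamma> t))"
        by (intro continuous_intros continuous_on_compose2[OF Gc \<gamma>c]) auto
      then show "isCont (\<lambda>t. t ^ (?n - 1) * G (\<gamma> t)) t" for t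
        by (simp add: continuous_on_eq_continuous_at)
    qed simp
    then have "(LINT t|lborel. (t ^ (?n - 1) * G (\<gamma> t)) * indicator {0..1} t) = \<phi> ?y"
      by (simp add: \<gamma>_def)
    moreover have "(LINT t|lborel. (t ^ (?n - 1) * G (\<gamma> t)) * indicator {0..1} t) =
        (LINT t|lborel. (t ^ (?n - 1) * G (\<gamma> t)) * indicator {0<..1} t)"
    proof (rule integral_cong_AE)
      have \<gamma>c: "continuous_on UNIV \<gamma>" unfolding \<gamma>_def[abs_def] by (intro continuous_intros)
      have [measurable]: "\<gamma> \<in> borel_measurable borel" using \<gamma>c by (rule borel_measurable_continuous_onI)
      show "(\<lambda>t. t ^ (?n - 1) * G (\<gamma> t) * indicator {0..1} t) \<in> borel_measurable lborel"
        "(\<lambda>t. t ^ (?n - 1) * G (\<gamma> t) * indicator {0<..1} t) \<in> borel_measurable lborel"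
        by measurable
      show "AE t in lborel. t ^ (?n - 1) * G (\<gamma> t) * indicator {0..1} t =
          t ^ (?n - 1) * G (\<gamma> t) * indicator {0<..1} t"
        using AE_lborel_singleton[of "0::real"] by eventually_elim (auto simp: indicator_def)
    qed
    ultimately have *: "(LINT t|lborel. (t ^ (?n - 1) * G (\<gamma> t)) * indicator {0<..1} t) = \<phi> ?y"
      by simp
    have "(LINT t|lborel. h * t ^ (?n - 1) * indicator {0<..1} t * indicator (slab \<nu> \<beta> F) z * G (\<gamma> t))
       = (LINT t|lborel. (h * indicator (slab \<nu> \<beta> F) z) * ((t ^ (?n - 1) * G (\<gamma> t)) * indicator {0<..1} t))"
      by (intro Bochner_Integration.integral_cong) (auto simp: mult_ac)
    also have "\<dots> = h * (indicator (slab \<nu> \<beta> F) z * \<phi> ?y)"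
      by (simp only: integral_mult_right_zero *)
    finally show "(LINT t|lborel. h * t ^ (?n - 1) * indicator {0<..1} t *
      indicator (slab \<nu> \<beta> F) z * G (p + t *\<^sub>R (?y - p))) = h * (indicator (slab \<nu> \<beta> F) z * \<phi> ?y)"
      by (simp add: \<gamma>_def)
  qed
  also have "\<dots> = h * face_integral F \<phi>"
    using face_integral_slab[OF \<nu> hull compact_imp_closed[OF K(2)] \<phi>c] by simp
  finally show ?thesis by (simp add: G_def h_def)
qed

section \<open>Green's identity and unisolvence on a simplex\<close>

text \<open>\<open>\<nu>\<close> is the outer unit normal of \<open>K\<close> on the facet \<open>F\<close>, and \<open>\<beta>\<close> the offset of the hyperplane that carries \<open>F\<close>.\<close>

definition supporting :: "(real^'n) set \<Rightarrow> (real^'n) set \<Rightarrow> real^'n \<Rightarrow> real \<Rightarrow> bool" where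
  "supporting K F \<nu> \<beta> \<longleftrightarrow> norm \<nu> = 1 \<and> affine hull F = {x. \<nu> \<bullet> x = \<beta>} \<and> K \<subseteq> {x. \<nu> \<bullet> x \<le> \<beta>}"

definition normal :: "(real^'n) set \<Rightarrow> (real^'n) set \<Rightarrow> real^'n" where
  "normal K F = fst (SOME (\<nu>, \<beta>). supporting K F \<nu> \<beta>)"

definition offset :: "(real^'n) set \<Rightarrow> (real^'n) set \<Rightarrow> real" where
  "offset K F = snd (SOME (\<nu>, \<beta>). supporting K F \<nu> \<beta>)"

text \<open>The normal component of the field \<open>a + b x\<close> on \<open>F\<close>, which is constant because \<open>\<nu> \<bullet> x = \<beta>\<close> there.\<close>

definition flux :: "(real^'n) set \<Rightarrow> (real^'n) set \<Rightarrow> real^'n \<Rightarrow> real \<Rightarrow> real" where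
  "flux K F a b = a \<bullet> normal K F + b * offset K F"

abbreviation facets :: "(real^'n) set \<Rightarrow> (real^'n) set set" where
  "facets K \<equiv> {F. F facet_of K}"

lemma supporting_normal_offset:
  "supporting K F \<nu> \<beta> \<Longrightarrow> supporting K F (normal K F) (offset K F)"
  using someI[of "\<lambda>(\<nu>, \<beta>). supporting K F \<nu> \<beta>" "(\<nu>, \<beta>)"]
  by (simp add: normal_def offset_def case_prod_unfold)

lemma flux_linear:
  "flux K F (a + a') (b + b') = flux K F a b + flux K F a' b'"
  "flux K F (a - a') (b - b') = flux K F a b - flux K F a' b'"
  "flux K F (r *\<^sub>R a) (r * b) = r * flux K F a b"
  by (simp_all add: flux_def algebra_simps inner_add_left inner_diff_left)

lemma flux_sum: "flux K F (\<Sum>i\<in>I. a i) (\<Sum>i\<in>I. b i) = (\<Sum>i\<in>I. flux K F (a i) (b i))"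
  by (simp add: flux_def inner_sum_left sum_distrib_right sum.distrib)

lemma simplex_facet:
  fixes C :: "(real^'n) set"
  assumes C: "\<not> affine_dependent C" "card C = CARD('n) + 1" and p: "p \<in> C"
  defines "K \<equiv> convex hull C" and "F \<equiv> convex hull (C - {p})"
  shows "F facet_of K" "supporting K F (normal K F) (offset K F)" "normal K F \<bullet> p < offset K F"
    and "\<And>q. q \<in> C - {p} \<Longrightarrow> normal K F \<bullet> q = offset K F"
proof -
  have fin: "finite C" using C by (simp add: aff_independent_finite)
  have card': "card (C - {p}) = CARD('n)" using C(2) p fin by simp
  then have ne: "C - {p} \<noteq> {}" by (metis card.empty less_irrefl zero_less_card_finite)
  show "F facet_of K"
    unfolding facet_of_convex_hull_affine_independent[OF C(1)] K_def F_def using ne p by auto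
  have ind: "\<not> affine_dependent (C - {p})"
    using C(1) affine_independent_subset[of C "C - {p}"] by blast
  have "aff_dim F = int (DIM(real^'n)) - 1"
    unfolding F_def aff_dim_convex_hull using aff_dim_affine_independent[OF ind] card' by simp
  then obtain a b where a: "a \<noteq> 0" and ab: "affine hull F = {x. a \<bullet> x = b}"
    using aff_dim_eq_hyperplane[of F] by auto
  have pn: "p \<notin> affine hull F"
    using C(1) p by (auto simp: affine_dependent_def F_def)
  define s where "s = (if a \<bullet> p < b then 1 else - 1 :: real) / norm a"
  have s0: "s \<noteq> 0" using a by (simp add: s_def)
  have hull: "affine hull F = {x. (s *\<^sub>R a) \<bullet> x = s * b}" using ab s0 by simp
  have nrm: "norm (s *\<^sub>R a) = 1" using a by (simp add: s_def)
  have ps: "(s *\<^sub>R a) \<bullet> p < s * b"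
  proof (cases "a \<bullet> p < b")
    case True then show ?thesis using a by (simp add: s_def divide_strict_right_mono)
  next
    case False
    then have "b < a \<bullet> p" using pn ab by force
    then show ?thesis using a False by (simp add: s_def divide_strict_right_mono)
  qed
  have "C \<subseteq> {x. (s *\<^sub>R a) \<bullet> x \<le> s * b}"
  proof
    fix x assume "x \<in> C"
    show "x \<in> {x. (s *\<^sub>R a) \<bullet> x \<le> s * b}"
    proof (cases "x = p")
      case False
      then have "x \<in> affine hull F" using \<open>x \<in> C\<close> by (auto simp: F_def hull_inc)
      then have "(s *\<^sub>R a) \<bullet> x = s * b" unfolding hull by blast
      then show ?thesis by (simp only: mem_Collect_eq order_refl)
    qed (use ps in simp)
  qed
  then have "K \<subseteq> {x. (s *\<^sub>R a) \<bullet> x \<le> s * b}"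
    unfolding K_def by (intro hull_minimal convex_halfspace_le)
  then have "supporting K F (s *\<^sub>R a) (s * b)"
    using hull nrm unfolding supporting_def by blast
  then show sup: "supporting K F (normal K F) (offset K F)" by (rule supporting_normal_offset)
  show "normal K F \<bullet> q = offset K F" if "q \<in> C - {p}" for q
    using sup hull_inc[of q "C - {p}"] that unfolding supporting_def F_def by auto
  have "p \<in> K" using p by (simp add: K_def hull_inc)
  then show "normal K F \<bullet> p < offset K F"
    using sup pn unfolding supporting_def by force
qed

lemma simplex_obtain_vertices:
  fixes K :: "(real^'n) set"
  assumes "int CARD('n) simplex K"
  obtains C where "\<not> affine_dependent C" "card C = CARD('n) + 1" "K = convex hull C" "finite C"
    "facets K = (\<lambda>p. convex hull (C - {p})) ` C" "inj_on (\<lambda>p. convex hull (C - {p})) C"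
    "affine hull C = UNIV"
proof -
  obtain C where C: "\<not> affine_dependent C" "int (card C) = int CARD('n) + 1" "K = convex hull C"
    using assms by (auto simp: simplex_def)
  have card: "card C = CARD('n) + 1" using C(2) by linarith
  have fin: "finite C" using C by (simp add: aff_independent_finite)
  have "facets K = (\<lambda>p. convex hull (C - {p})) ` C"
  proof
    show "facets K \<subseteq> (\<lambda>p. convex hull (C - {p})) ` C"
      unfolding C(3) facet_of_convex_hull_affine_independent[OF C(1)] by auto
    show "(\<lambda>p. convex hull (C - {p})) ` C \<subseteq> facets K"
      using simplex_facet(1)[OF C(1) card] unfolding C(3) by auto
  qed
  moreover have "inj_on (\<lambda>p. convex hull (C - {p})) C"
  proof (rule inj_onI)
    fix p q assume pq: "p \<in> C" "q \<in> C" "convex hull (C - {p}) = convex hull (C - {q})"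
    show "p = q"
    proof (rule ccontr)
      assume "p \<noteq> q"
      then show False
        using simplex_facet(3)[OF C(1) card pq(1)] simplex_facet(4)[OF C(1) card pq(2), of p] pq by simp
    qed
  qed
  moreover have "affine hull C = UNIV"
    using affine_independent_span_eq[OF C(1)] card by simp
  ultimately show thesis using that[OF C(1) card C(3) fin] by blast
qed

lemma integrable_lebesgue_on_compact:
  fixes g :: "'a::euclidean_space \<Rightarrow> real"
  assumes "compact K" "continuous_on K g"
  shows "integrable (lebesgue_on K) g"
proof -
  have "integrable lborel (\<lambda>x. indicator K x *\<^sub>R g x)"
    by (rule borel_integrable_compact[OF assms])
  then have "integrable lebesgue (\<lambda>x. indicator K x *\<^sub>R g x)"
    using integrable_completion[of _ lborel] by fastforce
  then show ?thesis
    using borel_compact[OF assms(1)] by (subst integrable_restrict_space) auto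
qed

lemma simplex_facets_finite:
  "int CARD('n) simplex (K :: (real^'n) set) \<Longrightarrow> finite (facets K)"
  by (erule simplex_obtain_vertices) simp

text \<open>Both sides are linear in the field, and the fields \<open>x - p\<close> with a vertex \<open>p\<close> span, since the vertices
affinely span the space. The normal component of \<open>x - p\<close> vanishes on each facet through \<open>p\<close>, and the remaining facet is
the base of a cone with apex \<open>p\<close>.\<close>

lemma green_simplex:
  fixes K :: "(real^'n) set"
  assumes K: "int CARD('n) simplex K" and \<phi>: "Ck (Suc 0) \<phi>"
  shows "(LINT x|lebesgue_on K. (a + b *\<^sub>R x) \<bullet> grad \<phi> x + real CARD('n) * b * \<phi> x) =
    (\<Sum>F\<in>facets K. flux K F a b * face_integral F \<phi>)"
proof -
  obtain C where C: "\<not> affine_dependent C" "card C = CARD('n) + 1" "K = convex hull C" "finite C"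
    and fac: "facets K = (\<lambda>p. convex hull (C - {p})) ` C" "inj_on (\<lambda>p. convex hull (C - {p})) C"
    and aff: "affine hull C = UNIV"
    by (rule simplex_obtain_vertices[OF K])
  define L where "L a b = (LINT x|lebesgue_on K. (a + b *\<^sub>R x) \<bullet> grad \<phi> x + real CARD('n) * b * \<phi> x)
     - (\<Sum>F\<in>facets K. flux K F a b * face_integral F \<phi>)" for a b
  have int: "integrable (lebesgue_on K) (\<lambda>x. (a + b *\<^sub>R x) \<bullet> grad \<phi> x + real CARD('n) * b * \<phi> x)" for a b
    by (intro integrable_lebesgue_on_compact[OF compact_simplex[OF K]] continuous_intros
        Ck_grad_continuous[OF \<phi>] Ck_continuous_on[OF \<phi>])
  have Lr: "L (r *\<^sub>R a) (r * b) = r * L a b" for r a b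
  proof -
    have "(LINT x|lebesgue_on K. (r *\<^sub>R a + (r * b) *\<^sub>R x) \<bullet> grad \<phi> x + real CARD('n) * (r * b) * \<phi> x)
      = (LINT x|lebesgue_on K. r * ((a + b *\<^sub>R x) \<bullet> grad \<phi> x + real CARD('n) * b * \<phi> x))"
      by (intro Bochner_Integration.integral_cong) (auto simp: algebra_simps inner_add_left)
    then show ?thesis
      by (simp add: L_def flux_linear sum_distrib_left mult.assoc right_diff_distrib)
  qed
  have Ladd: "L (a + a') (b + b') = L a b + L a' b'" for a a' b b'
  proof -
    have "(LINT x|lebesgue_on K. ((a + a') + (b + b') *\<^sub>R x) \<bullet> grad \<phi> x + real CARD('n) * (b + b') * \<phi> x)
      = (LINT x|lebesgue_on K. ((a + b *\<^sub>R x) \<bullet> grad \<phi> x + real CARD('n) * b * \<phi> x)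
          + ((a' + b' *\<^sub>R x) \<bullet> grad \<phi> x + real CARD('n) * b' * \<phi> x))"
      by (intro Bochner_Integration.integral_cong) (auto simp: algebra_simps inner_add_left)
    also have "\<dots> = (LINT x|lebesgue_on K. ((a + b *\<^sub>R x) \<bullet> grad \<phi> x + real CARD('n) * b * \<phi> x))
          + (LINT x|lebesgue_on K. ((a' + b' *\<^sub>R x) \<bullet> grad \<phi> x + real CARD('n) * b' * \<phi> x))"
      by (rule Bochner_Integration.integral_add) (rule int)+
    finally show ?thesis
      by (simp add: L_def flux_linear sum.distrib distrib_right)
  qed
  have vert: "L (- p) 1 = 0" if p: "p \<in> C" for p
  proof -
    let ?F = "\<lambda>q. convex hull (C - {q})"
    have sup: "supporting K (?F p) (normal K (?F p)) (offset K (?F p))"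
      and lt: "normal K (?F p) \<bullet> p < offset K (?F p)"
      using simplex_facet[OF C(1,2) p] by (simp_all add: C(3))
    have ne: "C - {p} \<noteq> {}"
      using C(2,4) p by (metis card.empty card_Diff_singleton diff_add_inverse2 less_irrefl zero_less_card_finite)
    have g: "(LINT x|lebesgue_on K. (x - p) \<bullet> grad \<phi> x + real CARD('n) * \<phi> x) =
        (offset K (?F p) - normal K (?F p) \<bullet> p) * face_integral (?F p) \<phi>"
      using green_cone[OF _ ne refl _ _ lt \<phi>] sup C(4) p
      by (simp add: supporting_def C(3) insert_absorb)
    have "(\<Sum>F\<in>facets K. flux K F (- p) 1 * face_integral F \<phi>) =
        (\<Sum>q\<in>C. flux K (?F q) (- p) 1 * face_integral (?F q) \<phi>)"
      unfolding fac(1) by (simp add: sum.reindex[OF fac(2)])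
    also have "\<dots> = (\<Sum>q\<in>C. if q = p then flux K (?F p) (- p) 1 * face_integral (?F p) \<phi> else 0)"
    proof (rule sum.cong[OF refl])
      fix q assume q: "q \<in> C"
      show "flux K (?F q) (- p) 1 * face_integral (?F q) \<phi> =
          (if q = p then flux K (?F p) (- p) 1 * face_integral (?F p) \<phi> else 0)"
        using simplex_facet(4)[OF C(1,2) q, of p] p
        by (auto simp: flux_def C(3) inner_commute)
    qed
    also have "\<dots> = flux K (?F p) (- p) 1 * face_integral (?F p) \<phi>"
      using p C(4) by simp
    finally show ?thesis
      using g by (simp add: L_def flux_def inner_commute)
  qed
  have L1: "L (- x) 1 = 0" for x
  proof -
    have "affine {x. L (- x) 1 = 0}"
      unfolding affine_def
    proof (intro ballI allI impI CollectI)
      fix x y u v assume xy: "x \<in> {x. L (- x) 1 = 0}" "y \<in> {x. L (- x) 1 = 0}" and uv: "u + v = (1::real)"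
      have "L (- (u *\<^sub>R x + v *\<^sub>R y)) 1 = L (u *\<^sub>R (- x) + v *\<^sub>R (- y)) (u * 1 + v * 1)"
        using uv by simp
      also have "\<dots> = 0" using xy by (simp only: Ladd Lr) simp
      finally show "L (- (u *\<^sub>R x + v *\<^sub>R y)) 1 = 0" .
    qed
    then have "affine hull C \<subseteq> {x. L (- x) 1 = 0}"
      using vert by (intro hull_minimal) auto
    then show ?thesis using aff by auto
  qed
  have "L a b = L (- (- a) + (b - 1) *\<^sub>R (- 0)) (1 + (b - 1) * 1)" by simp
  also have "\<dots> = L (- (- a)) 1 + (b - 1) * L (- 0) 1" by (simp only: Ladd Lr)
  also have "\<dots> = 0" using L1[of "- a"] L1[of 0] by simp
  finally show ?thesis by (simp add: L_def)
qed

lemma green_simplex_field: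
  fixes K :: "(real^'n) set"
  assumes K: "int CARD('n) simplex K" and \<phi>: "Ck (Suc 0) \<phi>"
  shows "(LINT x|lebesgue_on K. (a + b *\<^sub>R x) \<bullet> grad \<phi> x) =
    (\<Sum>F\<in>facets K. flux K F a b * face_integral F \<phi>) - real CARD('n) * b * (LINT x|lebesgue_on K. \<phi> x)"
proof -
  have i1: "integrable (lebesgue_on K) (\<lambda>x. (a + b *\<^sub>R x) \<bullet> grad \<phi> x)"
    and i2: "integrable (lebesgue_on K) (\<lambda>x. real CARD('n) * b * \<phi> x)"
    by (intro integrable_lebesgue_on_compact[OF compact_simplex[OF K]] continuous_intros
        Ck_grad_continuous Ck_continuous_on[OF \<phi>] \<phi>)+
  show ?thesis
    using green_simplex[OF K \<phi>, of a b] Bochner_Integration.integral_add[OF i1 i2]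
    by (simp only: integral_mult_right_zero)
qed

text \<open>The fields \<open>x - p\<close> with a vertex \<open>p\<close>, which have flux through one facet only, form a dual basis up to scaling.\<close>

lemma RT_unisolvence:
  fixes K :: "(real^'n) set"
  assumes K: "int CARD('n) simplex K"
  obtains a b where "\<And>F. F facet_of K \<Longrightarrow> flux K F a b = d F"
proof -
  obtain C where C: "\<not> affine_dependent C" "card C = CARD('n) + 1" "K = convex hull C" "finite C"
    and fac: "facets K = (\<lambda>p. convex hull (C - {p})) ` C" "inj_on (\<lambda>p. convex hull (C - {p})) C"
    and "affine hull C = UNIV"
    by (rule simplex_obtain_vertices[OF K])
  let ?F = "\<lambda>q. convex hull (C - {q})"
  define r where "r p = d (?F p) / flux K (?F p) (- p) 1" for p
  have "flux K F (\<Sum>p\<in>C. r p *\<^sub>R (- p)) (\<Sum>p\<in>C. r p * 1) = d F" if F: "F facet_of K" for F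
  proof -
    obtain q where q: "q \<in> C" "F = ?F q" using F fac(1) by blast
    have pos: "flux K (?F q) (- q) 1 \<noteq> 0"
      using simplex_facet(3)[OF C(1,2) q(1)] by (simp add: flux_def C(3) inner_commute)
    have "flux K F (\<Sum>p\<in>C. r p *\<^sub>R (- p)) (\<Sum>p\<in>C. r p * 1) = (\<Sum>p\<in>C. r p * flux K F (- p) 1)"
      by (simp only: flux_sum flux_linear)
    also have "\<dots> = (\<Sum>p\<in>C. if p = q then r q * flux K F (- q) 1 else 0)"
    proof (rule sum.cong[OF refl])
      fix p assume p: "p \<in> C"
      show "r p * flux K F (- p) 1 = (if p = q then r q * flux K F (- q) 1 else 0)"
        using simplex_facet(4)[OF C(1,2) q(1), of p] p by (auto simp: flux_def C(3) inner_commute q(2))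
    qed
    also have "\<dots> = d F" using q C(4) pos by (simp add: r_def)
    finally show ?thesis .
  qed
  then show thesis using that by blast
qed

section \<open>Enriched Crouzeix--Raviart polynomials on a simplex\<close>

definition ecr :: "real \<Rightarrow> real^'n \<Rightarrow> real \<Rightarrow> real^'n \<Rightarrow> real" where
  "ecr c a b x = c + a \<bullet> x + b * (\<Sum>i\<in>UNIV. (x $ i)\<^sup>2)"

lemma ECR_shape_eq: "ECR_shape = {ecr c a b | c a b. True}"
  by (auto simp: ECR_shape_def ecr_def[abs_def])

lemma Ck_ecr: "Ck k (ecr c a b)"
  unfolding ecr_def[abs_def] power2_eq_square
  by (intro Ck_add Ck_const Ck_mult Ck_inner Ck_sum Ck_nth)

lemma grad_ecr: "grad (ecr c a b) x = a + (2 * b) *\<^sub>R x"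
proof (rule grad_eqI)
  have eq: "ecr c a b = (\<lambda>x. c + a \<bullet> x + b * (x \<bullet> x))"
    by (simp add: ecr_def[abs_def] inner_vec_def power2_eq_square)
  show "(ecr c a b has_derivative (\<lambda>v. (a + (2 * b) *\<^sub>R x) \<bullet> v)) (at x)"
    unfolding eq by (auto intro!: derivative_eq_intros simp: inner_add_left inner_add_right inner_commute)
qed

lemma simplex_interior_nonempty:
  fixes K :: "(real^'n) set"
  assumes "int CARD('n) simplex K"
  shows "interior K \<noteq> {}" "K = closure (interior K)"
proof -
  obtain C where C: "\<not> affine_dependent C" "card C = CARD('n) + 1" "K = convex hull C" "finite C"
    and fac: "facets K = (\<lambda>p. convex hull (C - {p})) ` C" "inj_on (\<lambda>p. convex hull (C - {p})) C"
    and aff: "affine hull C = UNIV"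
    by (rule simplex_obtain_vertices[OF assms])
  have "rel_interior K = interior K"
    by (rule rel_interior_interior) (simp add: C(3) aff)
  moreover have "K \<noteq> {}" using C by auto
  ultimately show ne: "interior K \<noteq> {}"
    using convex_simplex[OF assms] by (metis rel_interior_eq_empty)
  show "K = closure (interior K)"
    using convex_closure_interior[OF convex_simplex[OF assms] ne] closed_simplex[OF assms] by simp
qed

lemma AE_lebesgue_on_open:
  fixes U :: "'a::euclidean_space set"
  assumes "AE x in lebesgue_on K. P x" "K \<in> sets lebesgue" "open U" "U \<noteq> {}" "U \<subseteq> K"
  obtains x where "x \<in> U" "P x"
proof -
  have "AE x in lebesgue. x \<in> K \<longrightarrow> P x"
    using assms(1,2) by (simp add: AE_restrict_space_iff)
  then obtain N where "negligible N" "{x. \<not> (x \<in> K \<longrightarrow> P x)} \<subseteq> N"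
    unfolding eventually_ae_filter_negligible by blast
  then have "\<exists>x\<in>U. P x"
    using open_not_negligible[OF assms(3,4)] assms(5) negligible_subset[of N U] by blast
  then show thesis using that by blast
qed

lemma integral_nonneg_continuous_eq_0:
  fixes g :: "'a::euclidean_space \<Rightarrow> real"
  assumes K: "compact K" and g: "continuous_on K g" "\<And>x. x \<in> K \<Longrightarrow> 0 \<le> g x"
    and 0: "(LINT x|lebesgue_on K. g x) = 0" and x: "x \<in> interior K"
  shows "g x = 0"
proof (rule ccontr)
  assume "g x \<noteq> 0"
  have Ks: "K \<in> sets lebesgue" using borel_compact[OF K] by simp
  have "AE x in lebesgue_on K. 0 \<le> g x" by (rule AE_I2) (use g(2) in simp)
  then have "AE x in lebesgue_on K. g x = 0"
    using 0 integral_nonneg_eq_0_iff_AE[OF integrable_lebesgue_on_compact[OF K g(1)]] by blast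
  moreover have "open (interior K \<inter> g -` (- {0}))"
    using continuous_on_subset[OF g(1) interior_subset] open_interior
    by (intro continuous_open_preimage) auto
  moreover have "interior K \<inter> g -` (- {0}) \<noteq> {}" using x \<open>g x \<noteq> 0\<close> by blast
  ultimately obtain y where "y \<in> interior K \<inter> g -` (- {0})" "g y = 0"
    using AE_lebesgue_on_open[OF _ Ks, of "\<lambda>x. g x = 0" "interior K \<inter> g -` (- {0})"] interior_subset by blast
  then show False by simp
qed

lemma simplex_measure_pos:
  fixes K :: "(real^'n) set"
  assumes "int CARD('n) simplex K"
  shows "0 < (LINT x|lebesgue_on K. (1::real))"
proof -
  have "(LINT x|lebesgue_on K. (1::real)) \<noteq> 0"
    using integral_nonneg_continuous_eq_0[OF compact_simplex[OF assms], of "\<lambda>x. 1"]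
      simplex_interior_nonempty(1)[OF assms] by auto
  moreover have "0 \<le> (LINT x|lebesgue_on K. (1::real))" by simp
  ultimately show ?thesis by linarith
qed

text \<open>The gradient of the polynomial sought is a field of Raviart--Thomas shape. By Green's identity the prescribed
facet integrals and the prescribed mean determine its \<open>L\<^sup>2\<close> inner product with every field \<open>z\<close> of this shape,
namely \<open>l z\<close>. So the gradient is the representer of the functional \<open>l\<close> with respect to the inner product \<open>B\<close>, and
the constant term is then fitted to the mean.\<close>

lemma ECR_unisolvence:
  fixes K :: "(real^'n) set"
  assumes K: "int CARD('n) simplex K"
  obtains c a b where "\<And>F. F facet_of K \<Longrightarrow> face_integral F (ecr c a b) = d F"
    and "(LINT x|lebesgue_on K. ecr c a b x) = m"
proof -
  let ?n = "real CARD('n)"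
  have Kc: "compact K" by (rule compact_simplex[OF K])
  define B :: "(real^'n) \<times> real \<Rightarrow> (real^'n) \<times> real \<Rightarrow> real" where
    "B y z = (LINT x|lebesgue_on K. (fst y + snd y *\<^sub>R x) \<bullet> (fst z + snd z *\<^sub>R x))" for y z
  define l where "l z = (\<Sum>F\<in>facets K. flux K F (fst z) (snd z) * d F) - ?n * snd z * m" for z
  have int: "integrable (lebesgue_on K) (\<lambda>x. (fst y + snd y *\<^sub>R x) \<bullet> (fst z + snd z *\<^sub>R x))" for y z :: "(real^'n) \<times> real"
    by (intro integrable_lebesgue_on_compact[OF Kc] continuous_intros)
  have Badd: "B y (z + z') = B y z + B y z'" for y z z'
    unfolding B_def Bochner_Integration.integral_add[OF int int, symmetric]
    by (intro Bochner_Integration.integral_cong) (auto simp: algebra_simps inner_add_left inner_add_right)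
  have Bscale: "B y (r *\<^sub>R z) = r * B y z" for y z r
    unfolding B_def integral_mult_right_zero[symmetric]
    by (intro Bochner_Integration.integral_cong) (auto simp: algebra_simps inner_add_left inner_add_right)
  have Bsym: "B y z = B z y" for y z by (simp add: B_def inner_commute)
  have linB: "linear (B y)" for y by (rule linearI) (simp_all add: Badd Bscale)
  have linl: "linear l"
    by (rule linearI) (simp_all add: l_def flux_linear algebra_simps sum.distrib sum_distrib_left)
  have pos: "y = 0" if "B y y = 0" for y
  proof -
    have z: "fst y + snd y *\<^sub>R x = 0" if "x \<in> interior K" for x
    proof -
      have "(fst y + snd y *\<^sub>R x) \<bullet> (fst y + snd y *\<^sub>R x) = 0"
        by (rule integral_nonneg_continuous_eq_0[OF Kc _ _ \<open>B y y = 0\<close>[unfolded B_def] that])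
           (intro continuous_intros inner_ge_zero)+
      then show ?thesis by simp
    qed
    obtain x0 where x0: "x0 \<in> interior K" using simplex_interior_nonempty[OF K] by blast
    then obtain e where e: "e > 0" "ball x0 e \<subseteq> interior K" using open_contains_ball open_interior by blast
    obtain i :: 'n where True by simp
    define x1 where "x1 = x0 + (e / 2) *\<^sub>R axis i 1"
    have "x1 \<in> ball x0 e" using e by (simp add: x1_def dist_norm)
    then have "snd y *\<^sub>R x1 = snd y *\<^sub>R x0" using z[OF x0] z[of x1] e
      by (metis add_left_imp_eq subsetD)
    then have "snd y = 0" using e by (auto simp: x1_def)
    then show "y = 0" using z[OF x0] by (simp add: prod_eq_iff)
  qed
  (* R f represents the linear functional f with respect to the euclidean inner product. *)
  define R where "R f = (\<Sum>e\<in>Basis. f e *\<^sub>R e)" for f :: "(real^'n) \<times> real \<Rightarrow> real"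
  have R: "R f \<bullet> z = f z" if "linear f" for f z
  proof -
    have "f z = f (\<Sum>e\<in>Basis. (z \<bullet> e) *\<^sub>R e)" by (simp only: euclidean_representation)
    also have "\<dots> = (\<Sum>e\<in>Basis. (z \<bullet> e) * f e)"
      using that by (simp add: linear_sum linear_scale)
    also have "\<dots> = (\<Sum>e\<in>Basis. f e * (e \<bullet> z))"
      by (simp add: inner_commute mult.commute)
    also have "\<dots> = R f \<bullet> z"
      by (simp add: R_def inner_sum_left)
    finally show ?thesis by simp
  qed
  have "linear (\<lambda>y. R (B y))"
  proof (rule linearI)
    show "R (B (y + y')) = R (B y) + R (B y')" for y y'
      by (simp add: R_def Bsym[of "_ + _"] Badd scaleR_add_left sum.distrib) (simp add: Bsym)
    show "R (B (r *\<^sub>R y)) = r *\<^sub>R R (B y)" for r y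
      by (simp add: R_def Bsym[of "_ *\<^sub>R _"] Bscale scaleR_sum_right) (simp add: Bsym)
  qed
  moreover have "inj (\<lambda>y. R (B y))"
    unfolding linear_injective_0[OF calculation]
  proof (intro allI impI)
    fix y assume "R (B y) = 0"
    then have "B y y = 0" using R[OF linB, of y y] by simp
    then show "y = 0" by (rule pos)
  qed
  ultimately have "surj (\<lambda>y. R (B y))" by (rule linear_inj_imp_surj)
  then obtain y where y: "R (B y) = R l" by (metis surjD)
  have By: "B y z = l z" for z using R[OF linB, of y z] R[OF linl, of z] y by simp
  let ?poly = "ecr 0 (fst y) (snd y / 2)"
  let ?V = "LINT x|lebesgue_on K. (1::real)"
  define c where "c = (m - (LINT x|lebesgue_on K. ?poly x)) / ?V"
  let ?q = "ecr c (fst y) (snd y / 2)"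
  have V: "?V > 0" by (rule simplex_measure_pos[OF K])
  have qi: "integrable (lebesgue_on K) (ecr c a b)" for c a b
    by (intro integrable_lebesgue_on_compact[OF Kc] Ck_continuous_on[OF Ck_ecr])
  have "(LINT x|lebesgue_on K. ?q x) = (LINT x|lebesgue_on K. c * 1 + ?poly x)"
    by (intro Bochner_Integration.integral_cong) (simp_all add: ecr_def)
  also have "\<dots> = (LINT x|lebesgue_on K. c * 1) + (LINT x|lebesgue_on K. ?poly x)"
    using qi[of c 0 0] by (intro Bochner_Integration.integral_add qi) (simp add: ecr_def[abs_def])
  also have "\<dots> = c * ?V + (LINT x|lebesgue_on K. ?poly x)"
    by (simp only: integral_mult_right_zero)
  also have "\<dots> = m" using V by (simp add: c_def)
  finally have mean: "(LINT x|lebesgue_on K. ?q x) = m" .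
  have "face_integral F ?q = d F" if F: "F facet_of K" for F
  proof -
    obtain a b where ab: "\<And>G. G facet_of K \<Longrightarrow> flux K G a b = (if G = F then 1 else 0)"
      using RT_unisolvence[OF K, of "\<lambda>G. if G = F then 1 else 0"] by blast
    have fin: "finite (facets K)" by (rule simplex_facets_finite[OF K])
    have delta: "(\<Sum>G\<in>facets K. flux K G a b * g G) = g F" for g :: "(real^'n) set \<Rightarrow> real"
    proof -
      have "(\<Sum>G\<in>facets K. flux K G a b * g G) = (\<Sum>G\<in>facets K. if G = F then g F else 0)"
        using ab by (intro sum.cong) auto
      then show ?thesis using F fin by simp
    qed
    have "face_integral F ?q = (LINT x|lebesgue_on K. (a + b *\<^sub>R x) \<bullet> grad ?q x + ?n * b * ?q x)"
      using green_simplex[OF K Ck_ecr, where a=a and b=b] delta by simp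
    also have "\<dots> = (LINT x|lebesgue_on K. (fst y + snd y *\<^sub>R x) \<bullet> (a + b *\<^sub>R x) + (?n * b) * ?q x)"
      by (simp add: grad_ecr inner_commute)
    also have "\<dots> = B y (a, b) + (?n * b) * m"
      using int[of y "(a, b)"] qi mean by (subst Bochner_Integration.integral_add) (auto simp: B_def)
    also have "\<dots> = d F" using By[of "(a, b)"] delta by (simp add: l_def)
    finally show ?thesis .
  qed
  then show thesis using that mean by blast
qed

lemma face_integral_cong:
  assumes "\<And>x. x \<in> F \<Longrightarrow> g x = h x"
  shows "face_integral F g = face_integral F h"
  unfolding face_integral_def using assms
  by (auto intro!: Bochner_Integration.integral_cong simp: set_lebesgue_integral_def indicator_def)

lemma face_integral_zero: "(\<And>x. x \<in> F \<Longrightarrow> g x = 0) \<Longrightarrow> face_integral F g = 0"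
  using face_integral_cong[of F g "\<lambda>x. 0"] by (simp add: face_integral_def)

lemma simplex_facet_supporting:
  fixes K :: "(real^'n) set"
  assumes "int CARD('n) simplex K" "F facet_of K"
  shows "supporting K F (normal K F) (offset K F)" "compact F" "convex F"
proof -
  obtain C where C: "\<not> affine_dependent C" "card C = CARD('n) + 1" "K = convex hull C" "finite C"
    and fac: "facets K = (\<lambda>p. convex hull (C - {p})) ` C" "inj_on (\<lambda>p. convex hull (C - {p})) C"
    and aff: "affine hull C = UNIV"
    by (rule simplex_obtain_vertices[OF assms(1)])
  obtain p where p: "p \<in> C" "F = convex hull (C - {p})" using fac(1) assms(2) by blast
  show "supporting K F (normal K F) (offset K F)"
    using simplex_facet(2)[OF C(1,2) p(1)] p C(3) by simp
  show "compact F" "convex F" using p C(4) by (auto intro: finite_imp_compact_convex_hull)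
qed

lemma slab_integrand_integrable:
  fixes F :: "(real^'n) set" and g :: "real^'n \<Rightarrow> real"
  assumes \<nu>: "norm \<nu> = 1" and F: "compact F" and g: "continuous_on F g"
  shows "integrable lborel (\<lambda>z. indicator (slab \<nu> \<beta> F) z * g (hyperplane_proj \<nu> \<beta> z))"
proof -
  have cp: "continuous_on S (hyperplane_proj \<nu> \<beta>)" for S
    unfolding hyperplane_proj_def[abs_def] by (intro continuous_intros)
  have "closed (slab \<nu> \<beta> F)"
  proof -
    have "closed ((hyperplane_proj \<nu> \<beta>) -` F \<inter> {z. \<bar>\<nu> \<bullet> z - \<beta>\<bar> \<le> 1/2})"
      by (intro closed_Int closed_Collect_le continuous_intros continuous_closed_vimage compact_imp_closed[OF F])
         (use cp continuous_on_eq_continuous_at in blast)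
    then show ?thesis by (simp add: slab_def Int_def)
  qed
  moreover have "bounded (slab \<nu> \<beta> F)"
  proof -
    obtain b where b: "\<And>x. x \<in> F \<Longrightarrow> norm x \<le> b"
      using compact_imp_bounded[OF F] by (auto simp: bounded_iff)
    have "norm z \<le> b + 1/2" if "z \<in> slab \<nu> \<beta> F" for z
    proof -
      have "z = hyperplane_proj \<nu> \<beta> z + (\<nu> \<bullet> z - \<beta>) *\<^sub>R \<nu>" by (simp add: hyperplane_proj_def)
      then have "norm z \<le> norm (hyperplane_proj \<nu> \<beta> z) + \<bar>\<nu> \<bullet> z - \<beta>\<bar>"
        using norm_triangle_ineq[of "hyperplane_proj \<nu> \<beta> z" "(\<nu> \<bullet> z - \<beta>) *\<^sub>R \<nu>"] \<nu> by simp
      then show ?thesis using that b by (force simp: slab_def)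
    qed
    then show ?thesis by (auto simp: bounded_iff)
  qed
  ultimately have "compact (slab \<nu> \<beta> F)" by (simp add: compact_eq_bounded_closed)
  moreover have "continuous_on (slab \<nu> \<beta> F) (\<lambda>z. g (hyperplane_proj \<nu> \<beta> z))"
    by (rule continuous_on_compose2[OF g cp]) (auto simp: slab_def)
  ultimately have "integrable lborel (\<lambda>z. indicator (slab \<nu> \<beta> F) z *\<^sub>R g (hyperplane_proj \<nu> \<beta> z))"
    by (rule borel_integrable_compact)
  then show ?thesis by simp
qed

text \<open>All points near \<open>c\<close> project into \<open>F\<close>, so the integrand over the slab is positive on a ball around \<open>c\<close>.\<close>

lemma face_integral_pos:
  fixes K :: "(real^'n) set"
  assumes K: "int CARD('n) simplex K" and F: "F facet_of K"
    and g: "continuous_on UNIV g" "\<And>x. 0 \<le> g x" and c: "c \<in> rel_interior F" "0 < g c"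
  shows "0 < face_integral F g"
proof -
  define \<nu> \<beta> where "\<nu> = normal K F" and "\<beta> = offset K F"
  note sf = simplex_facet_supporting[OF K F, folded \<nu>_def \<beta>_def]
  have \<nu>: "norm \<nu> = 1" and hull: "affine hull F = {x. \<nu> \<bullet> x = \<beta>}"
    using sf(1) by (auto simp: supporting_def)
  let ?f = "\<lambda>z. indicator (slab \<nu> \<beta> F) z * g (hyperplane_proj \<nu> \<beta> z)"
  have gF: "continuous_on F g" using g(1) continuous_on_subset by blast
  have eq: "face_integral F g = (LINT z|lborel. ?f z)"
    by (rule face_integral_slab[OF \<nu> hull compact_imp_closed[OF sf(2)] gF])
  have int: "integrable lborel ?f" by (rule slab_integrand_integrable[OF \<nu> sf(2) gF])
  have nn: "0 \<le> ?f z" for z using g(2) by simp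
  obtain e1 where e1: "e1 > 0" "ball c e1 \<inter> affine hull F \<subseteq> F" and cF: "c \<in> F"
    using c(1) by (auto simp: mem_rel_interior_ball)
  have "open (g -` {0<..})" using g(1) open_vimage[of "{0<..}" g] by simp
  then obtain e2 where e2: "e2 > 0" "ball c e2 \<subseteq> g -` {0<..}"
    using c(2) unfolding open_contains_ball by force
  define e where "e = min (min e1 e2) (1/2)"
  have e: "e > 0" using e1 e2 by (simp add: e_def)
  have c\<nu>: "\<nu> \<bullet> c = \<beta>" using hull_inc[OF cF, of affine] hull by auto
  have fpos: "?f z \<noteq> 0" if z: "z \<in> ball c e" for z
  proof -
    let ?y = "hyperplane_proj \<nu> \<beta> z"
    have zc: "norm (z - c) < e" using z by (simp add: dist_norm norm_minus_commute)
    have \<nu>z: "\<nu> \<bullet> z - \<beta> = \<nu> \<bullet> (z - c)" using c\<nu> by (simp add: inner_diff_right)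
    have "\<bar>\<nu> \<bullet> (z - c)\<bar> \<le> norm (z - c)" using Cauchy_Schwarz_ineq2[of \<nu> "z - c"] \<nu> by simp
    then have 1: "\<bar>\<nu> \<bullet> z - \<beta>\<bar> \<le> 1/2" using zc \<nu>z by (simp add: e_def)
    have "?y - c = (z - c) - (\<nu> \<bullet> (z - c)) *\<^sub>R \<nu>" by (simp add: hyperplane_proj_def \<nu>z)
    moreover have "(norm (w - (\<nu> \<bullet> w) *\<^sub>R \<nu>))\<^sup>2 = (norm w)\<^sup>2 - (\<nu> \<bullet> w)\<^sup>2" for w
      using \<nu> unfolding power2_norm_eq_inner norm_eq_1
      by (simp add: inner_diff_left inner_diff_right inner_commute power2_eq_square)
    ultimately have "(norm (?y - c))\<^sup>2 = (norm (z - c))\<^sup>2 - (\<nu> \<bullet> (z - c))\<^sup>2"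
      by metis
    then have "norm (?y - c) \<le> norm (z - c)"
      by (intro power2_le_imp_le[OF _ norm_ge_zero]) simp
    then have 2: "?y \<in> ball c e" using zc by (simp add: dist_norm norm_minus_commute)
    then have "?y \<in> F" using e1(2) inner_hyperplane_proj[OF \<nu>, of \<beta> z] unfolding hull by (auto simp: e_def)
    moreover have "g ?y > 0" using 2 e2(2) by (auto simp: e_def)
    ultimately show ?thesis using 1 by (simp add: slab_def)
  qed
  have "(LINT z|lborel. ?f z) \<noteq> 0"
  proof
    assume "(LINT z|lborel. ?f z) = 0"
    then have "AE z in lborel. ?f z = 0"
      using integral_nonneg_eq_0_iff_AE[OF int] nn by simp
    then have "AE z in lebesgue. ?f z = 0" by (rule AE_completion)
    then have "AE z in lebesgue_on UNIV. ?f z = 0" unfolding lebesgue_on_UNIV_eq .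
    then obtain z where "z \<in> ball c e" "?f z = 0"
      by (rule AE_lebesgue_on_open[where U="ball c e"]) (use e in auto)
    then show False using fpos by blast
  qed
  moreover have "0 \<le> (LINT z|lborel. ?f z)" using nn by simp
  ultimately show ?thesis unfolding eq by linarith
qed

lemma face_integral_one_pos:
  fixes K :: "(real^'n) set"
  assumes K: "int CARD('n) simplex K" and F: "F facet_of K"
  shows "0 < face_integral F (\<lambda>x. 1)"
proof -
  have "F \<noteq> {}" using F by (simp add: facet_of_def)
  then obtain c where "c \<in> rel_interior F"
    using simplex_facet_supporting(3)[OF K F] rel_interior_eq_empty by blast
  then show ?thesis by (intro face_integral_pos[OF K F]) auto
qed

text \<open>A simplex is the closure of its interior, and continuous functions that agree almost everywhere agree on the interior.
This makes the continuous representative of a piecewise polynomial explicit.\<close>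

lemma restr_eq:
  fixes q :: "real^'n \<Rightarrow> 'b::euclidean_space"
  assumes K: "int CARD('n) simplex K" and q: "continuous_on K q" and v: "AE x in lebesgue_on K. v x = q x"
    and x: "x \<in> K"
  shows "restr K v x = q x"
proof -
  define g where "g = restr K v"
  have "continuous_on K g \<and> (AE x in lebesgue_on K. v x = g x)"
    unfolding g_def restr_def by (rule someI[of _ q]) (use q v in simp)
  then have g: "continuous_on K g" "AE x in lebesgue_on K. v x = g x" by auto
  have Ks: "K \<in> sets lebesgue" using borel_compact[OF compact_simplex[OF K]] by simp
  have ae: "AE x in lebesgue_on K. g x = q x" using g(2) v by eventually_elim simp
  have inn: "g y = q y" if y: "y \<in> interior K" for y
  proof (rule ccontr)
    assume ne: "g y \<noteq> q y"
    let ?U = "interior K \<inter> (\<lambda>x. g x - q x) -` (- {0})"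
    have "open ?U"
      using g(1) q interior_subset
      by (intro continuous_open_preimage continuous_intros) (auto intro: continuous_on_subset)
    moreover have "?U \<noteq> {}" using y ne by auto
    ultimately obtain z where "z \<in> ?U" "g z = q z"
      using AE_lebesgue_on_open[OF ae Ks, of ?U] interior_subset by blast
    then show False by simp
  qed
  have "x \<in> closure (interior K)" using simplex_interior_nonempty[OF K] x by simp
  then have "g x - q x = 0"
    using continuous_constant_on_closure[of "interior K" "\<lambda>x. g x - q x" 0 x] inn g(1) q
      simplex_interior_nonempty(2)[OF K] by (auto intro: continuous_intros)
  then show ?thesis by (simp add: g_def)
qed

section \<open>Piecewise functions on a mesh\<close>

text \<open>Lebesgue measure is complete, so that \<open>g\<close> inherits measurability from \<open>h\<close>.\<close>

lemma lebesgue_on_cong_AE: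
  fixes g h :: "'a::euclidean_space \<Rightarrow> 'b::euclidean_space"
  assumes K: "K \<in> sets lebesgue" and h: "h \<in> borel_measurable (lebesgue_on K)"
    and ae: "AE x in lebesgue_on K. g x = h x"
  shows "g \<in> borel_measurable (lebesgue_on K)"
    and "integral\<^sup>L (lebesgue_on K) g = integral\<^sup>L (lebesgue_on K) h"
    and "integrable (lebesgue_on K) g \<longleftrightarrow> integrable (lebesgue_on K) h"
proof -
  have "AE x in lebesgue. (if x \<in> K then h x else 0) = (if x \<in> K then g x else 0)"
  proof -
    have "AE x in lebesgue. x \<in> K \<longrightarrow> g x = h x"
      using ae K by (simp add: AE_restrict_space_iff)
    then show ?thesis by eventually_elim auto
  qed
  then have "(\<lambda>x. if x \<in> K then g x else 0) \<in> borel_measurable lebesgue"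
    by (rule borel_measurable_AE[OF borel_measurable_if_I[OF h K]])
  then show g: "g \<in> borel_measurable (lebesgue_on K)" by (rule borel_measurable_if_D)
  show "integral\<^sup>L (lebesgue_on K) g = integral\<^sup>L (lebesgue_on K) h"
    by (rule integral_cong_AE[OF g h ae])
  show "integrable (lebesgue_on K) g \<longleftrightarrow> integrable (lebesgue_on K) h"
    by (rule integrable_cong_AE[OF g h ae])
qed

lemma AE_arg_cong: "AE x in M. u x = p x \<Longrightarrow> AE x in M. f (u x) = f (p x)"
  by (auto elim: eventually_mono)

locale meshed =
  fixes \<Omega> :: "(real^'n) set" and T :: "(real^'n) set set"
  assumes domain: "polytopal_domain \<Omega>" and mesh: "mesh \<Omega> T"
begin

lemma finite_T: "finite T"
  and simplex_T: "K \<in> T \<Longrightarrow> int CARD('n) simplex K"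
  and Union_T: "\<Union>T = closure \<Omega>"
  and face_of_T: "K \<in> T \<Longrightarrow> K' \<in> T \<Longrightarrow> K \<inter> K' face_of K"
  using mesh unfolding mesh_def triangulation_def by blast+

lemma open_\<Omega>: "open \<Omega>" and connected_\<Omega>: "connected \<Omega>" and interior_closure_\<Omega>: "interior (closure \<Omega>) = \<Omega>"
  using domain unfolding polytopal_domain_def by blast+

lemma compact_T: "K \<in> T \<Longrightarrow> compact K"
  by (rule compact_simplex[OF simplex_T])

lemma convex_T: "K \<in> T \<Longrightarrow> convex K"
  by (rule convex_simplex[OF simplex_T])

lemma sets_T: "K \<in> T \<Longrightarrow> K \<in> sets lebesgue"
  using borel_compact[OF compact_T] by simp

lemma sets_\<Omega>: "\<Omega> \<in> sets lebesgue"
  using open_\<Omega> by simp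

lemma interior_subset_\<Omega>: "K \<in> T \<Longrightarrow> interior K \<subseteq> \<Omega>"
  by (metis Sup_upper Union_T interior_closure_\<Omega> interior_mono)

text \<open>Two cells meet in a common face, and a face that meets the interior of a cell is the whole cell.\<close>

lemma disjoint_interiors: "K \<in> T \<Longrightarrow> K' \<in> T \<Longrightarrow> K \<noteq> K' \<Longrightarrow> K \<inter> interior K' = {}"
proof -
  assume K: "K \<in> T" "K' \<in> T" "K \<noteq> K'"
  show ?thesis
  proof (cases "K' \<inter> K = K'")
    case False
    have "(K' \<inter> K) \<inter> interior K' = {}"
      by (rule face_of_disjoint_interior[OF face_of_T[OF K(2,1)] False])
    then show ?thesis using interior_subset[of K'] by blast
  next
    case True
    then have sub: "K' \<subseteq> K" and ne: "K \<inter> K' \<noteq> K" using K(3) by blast+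
    have "(K \<inter> K') \<inter> interior K = {}"
      by (rule face_of_disjoint_interior[OF face_of_T[OF K(1,2)] ne])
    then have "interior K' = {}"
      using sub interior_mono[OF sub] interior_subset[of K'] by blast
    then show ?thesis by simp
  qed
qed

lemma interior_unique: "K \<in> T \<Longrightarrow> K' \<in> T \<Longrightarrow> x \<in> interior K \<Longrightarrow> x \<in> interior K' \<Longrightarrow> K = K'"
  using disjoint_interiors[of K K'] interior_subset[of K] by blast

definition skeleton :: "(real^'n) set" where "skeleton = (\<Union>K\<in>T. frontier K)"

lemma negligible_skeleton: "negligible skeleton"
  unfolding skeleton_def
  by (rule negligible_Union) (auto simp: finite_T intro: negligible_convex_frontier convex_T)

lemma AE_off_skeleton: "AE x in lebesgue. x \<notin> skeleton"
  using negligible_skeleton unfolding eventually_ae_filter_negligible by auto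

lemma off_skeleton_interior: "K \<in> T \<Longrightarrow> x \<in> K \<Longrightarrow> x \<notin> skeleton \<Longrightarrow> x \<in> interior K"
  unfolding skeleton_def frontier_def using closure_subset by blast

lemma off_skeleton_mem: "x \<notin> skeleton \<Longrightarrow> x \<in> \<Omega> \<longleftrightarrow> (\<exists>K\<in>T. x \<in> interior K)"
  using Union_T closure_subset[of \<Omega>] off_skeleton_interior interior_subset_\<Omega> by blast

lemma AE_mesh_iff: "(AE x in lebesgue_on \<Omega>. P x) \<longleftrightarrow> (\<forall>K\<in>T. AE x in lebesgue_on K. P x)"
proof -
  have "(AE x in lebesgue_on \<Omega>. P x) \<longleftrightarrow> (AE x in lebesgue. x \<in> \<Omega> \<longrightarrow> P x)"
    using sets_\<Omega> by (simp add: AE_restrict_space_iff)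
  also have "\<dots> \<longleftrightarrow> (AE x in lebesgue. \<forall>K\<in>T. x \<in> K \<longrightarrow> P x)"
  proof
    assume "AE x in lebesgue. x \<in> \<Omega> \<longrightarrow> P x"
    with AE_off_skeleton show "AE x in lebesgue. \<forall>K\<in>T. x \<in> K \<longrightarrow> P x"
      by eventually_elim (use off_skeleton_mem off_skeleton_interior in blast)
  next
    assume "AE x in lebesgue. \<forall>K\<in>T. x \<in> K \<longrightarrow> P x"
    with AE_off_skeleton show "AE x in lebesgue. x \<in> \<Omega> \<longrightarrow> P x"
      by eventually_elim (use off_skeleton_mem interior_subset in blast)
  qed
  also have "\<dots> \<longleftrightarrow> (\<forall>K\<in>T. AE x in lebesgue. x \<in> K \<longrightarrow> P x)"
    using finite_T by (rule AE_finite_all)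
  also have "\<dots> \<longleftrightarrow> (\<forall>K\<in>T. AE x in lebesgue_on K. P x)"
    using sets_T by (simp add: AE_restrict_space_iff)
  finally show ?thesis .
qed

lemma AE_interior: "K \<in> T \<Longrightarrow> AE x in lebesgue_on K. x \<in> interior K"
proof -
  assume K: "K \<in> T"
  from AE_off_skeleton have "AE x in lebesgue. x \<in> K \<longrightarrow> x \<in> interior K"
    by eventually_elim (use off_skeleton_interior K in blast)
  then show ?thesis using sets_T[OF K] by (simp add: AE_restrict_space_iff)
qed

lemma indicator_sum_AE: "AE x in lebesgue. indicator \<Omega> x *\<^sub>R g x = (\<Sum>K\<in>T. indicator K x *\<^sub>R (g x :: 'b::real_vector))"
  using AE_off_skeleton
proof eventually_elim
  fix x assume x: "x \<notin> skeleton"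
  show "indicator \<Omega> x *\<^sub>R g x = (\<Sum>K\<in>T. indicator K x *\<^sub>R g x)"
  proof (cases "x \<in> \<Omega>")
    case True
    then obtain K where K: "K \<in> T" "x \<in> interior K" using off_skeleton_mem[OF x] by blast
    have "(\<Sum>K'\<in>T. indicator K' x *\<^sub>R g x) = (\<Sum>K'\<in>T. if K' = K then g x else 0)"
      using disjoint_interiors[OF _ K(1)] K(2) interior_subset by (intro sum.cong) (auto simp: indicator_def)
    then show ?thesis using True K(1) finite_T by simp
  next
    case False
    then have "x \<notin> K" if "K \<in> T" for K
      using off_skeleton_mem[OF x] off_skeleton_interior[OF that _ x] that by blast
    then show ?thesis using False by simp
  qed
qed

lemma
  fixes g :: "real^'n \<Rightarrow> 'b::euclidean_space"
  assumes "\<And>K. K \<in> T \<Longrightarrow> integrable (lebesgue_on K) g"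
  shows integrable_mesh: "integrable (lebesgue_on \<Omega>) g"
    and integral_mesh: "(LINT x|lebesgue_on \<Omega>. g x) = (\<Sum>K\<in>T. LINT x|lebesgue_on K. g x)"
proof -
  have i: "integrable lebesgue (\<lambda>x. indicator K x *\<^sub>R g x)" if "K \<in> T" for K
    using assms[OF that] sets_T[OF that] by (simp add: integrable_restrict_space)
  then have s: "integrable lebesgue (\<lambda>x. \<Sum>K\<in>T. indicator K x *\<^sub>R g x)" by simp
  have ae: "AE x in lebesgue. (\<Sum>K\<in>T. indicator K x *\<^sub>R g x) = indicator \<Omega> x *\<^sub>R g x"
    using indicator_sum_AE[of g] by eventually_elim simp
  have m: "(\<lambda>x. indicator \<Omega> x *\<^sub>R g x) \<in> borel_measurable lebesgue"
    by (rule borel_measurable_AE[OF borel_measurable_integrable[OF s] ae])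
  have "integrable lebesgue (\<lambda>x. indicator \<Omega> x *\<^sub>R g x)"
    by (rule integrable_cong_AE_imp[OF s m ae])
  then show "integrable (lebesgue_on \<Omega>) g" using sets_\<Omega> by (simp add: integrable_restrict_space)
  have "(LINT x|lebesgue_on \<Omega>. g x) = (LINT x|lebesgue. indicator \<Omega> x *\<^sub>R g x)"
    using sets_\<Omega> by (simp add: integral_restrict_space)
  also have "\<dots> = (LINT x|lebesgue. (\<Sum>K\<in>T. indicator K x *\<^sub>R g x))"
    by (rule integral_cong_AE[OF m borel_measurable_integrable[OF s] indicator_sum_AE])
  also have "\<dots> = (\<Sum>K\<in>T. LINT x|lebesgue. indicator K x *\<^sub>R g x)"
    by (rule Bochner_Integration.integral_sum) (rule i)
  also have "\<dots> = (\<Sum>K\<in>T. LINT x|lebesgue_on K. g x)"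
    using sets_T by (intro sum.cong) (simp_all add: integral_restrict_space)
  finally show "(LINT x|lebesgue_on \<Omega>. g x) = (\<Sum>K\<in>T. LINT x|lebesgue_on K. g x)" .
qed

lemma integrable_mesh_cell:
  fixes g :: "real^'n \<Rightarrow> 'b::euclidean_space"
  assumes g: "integrable (lebesgue_on \<Omega>) g" and K: "K \<in> T"
  shows "integrable (lebesgue_on K) g"
proof -
  have i: "integrable lebesgue (\<lambda>x. indicator \<Omega> x *\<^sub>R g x)"
    using g sets_\<Omega> by (simp add: integrable_restrict_space)
  have i2: "integrable lebesgue (\<lambda>x. indicator K x *\<^sub>R (indicator \<Omega> x *\<^sub>R g x))"
    using sets_T[OF K] by (rule integrable_mult_indicator) (rule i)
  have ae: "AE x in lebesgue. indicator K x *\<^sub>R (indicator \<Omega> x *\<^sub>R g x) = indicator K x *\<^sub>R g x"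
    using AE_off_skeleton
  proof eventually_elim
    fix x assume x: "x \<notin> skeleton"
    have "x \<in> \<Omega>" if "x \<in> K"
      using interior_subset_\<Omega>[OF K] off_skeleton_interior[OF K that x] by blast
    then show "indicator K x *\<^sub>R (indicator \<Omega> x *\<^sub>R g x) = indicator K x *\<^sub>R g x"
      by (simp add: indicator_def)
  qed
  have m: "(\<lambda>x. indicator K x *\<^sub>R g x) \<in> borel_measurable lebesgue"
    by (rule borel_measurable_AE[OF borel_measurable_integrable[OF i2] ae])
  have "integrable lebesgue (\<lambda>x. indicator K x *\<^sub>R g x)"
    by (rule integrable_cong_AE_imp[OF i2 m ae])
  then show ?thesis using sets_T[OF K] by (simp add: integrable_restrict_space)
qed

text \<open>The value \<open>0\<close> on the skeleton is the one that \<open>grad_NC\<close> takes there; elementwise gradients of piecewise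
polynomials are then equal to glued functions at every point.\<close>

definition glue :: "((real^'n) set \<Rightarrow> real^'n \<Rightarrow> 'b::real_vector) \<Rightarrow> real^'n \<Rightarrow> 'b" where
  "glue q x = (\<Sum>K\<in>T. indicator (interior K) x *\<^sub>R q K x)"

lemma glue_interior: "K \<in> T \<Longrightarrow> x \<in> interior K \<Longrightarrow> glue q x = q K x"
proof -
  assume K: "K \<in> T" "x \<in> interior K"
  have "glue q x = (\<Sum>K'\<in>T. if K' = K then q K x else 0)"
    unfolding glue_def
  proof (rule sum.cong[OF refl])
    fix K' assume "K' \<in> T"
    then have "x \<in> interior K' \<longleftrightarrow> K' = K" using interior_unique[OF K(1) _ K(2)] K(2) by blast
    then show "indicator (interior K') x *\<^sub>R q K' x = (if K' = K then q K x else 0)"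
      by (simp add: indicator_def)
  qed
  then show ?thesis using K(1) finite_T by simp
qed

lemma glue_AE:
  assumes "K \<in> T"
  shows "AE x in lebesgue_on K. glue q x = q K x"
  using AE_interior[OF assms] by eventually_elim (rule glue_interior[OF assms])

lemma glue_eqI: "(\<And>x K. K \<in> T \<Longrightarrow> x \<in> interior K \<Longrightarrow> g x = q K x) \<Longrightarrow>
    (\<And>x. (\<forall>K\<in>T. x \<notin> interior K) \<Longrightarrow> g x = 0) \<Longrightarrow> g = glue q"
proof
  fix x assume 1: "\<And>x K. K \<in> T \<Longrightarrow> x \<in> interior K \<Longrightarrow> g x = q K x"
    and 2: "\<And>x. (\<forall>K\<in>T. x \<notin> interior K) \<Longrightarrow> g x = 0"
  show "g x = glue q x"
  proof (cases "\<exists>K\<in>T. x \<in> interior K")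
    case True
    then obtain K where "K \<in> T" "x \<in> interior K" by blast
    then show ?thesis using 1[of K x] glue_interior[of K x q] by simp
  next
    case False then show ?thesis using 2[of x] by (simp add: glue_def)
  qed
qed

lemma
  fixes g :: "real^'n \<Rightarrow> real"
  assumes h: "\<And>K. K \<in> T \<Longrightarrow> integrable (lebesgue_on K) (h K)"
    and ae: "\<And>K. K \<in> T \<Longrightarrow> AE x in lebesgue_on K. g x = h K x"
  shows integrable_cells: "integrable (lebesgue_on \<Omega>) g"
    and integral_cells: "(LINT x|lebesgue_on \<Omega>. g x) = (\<Sum>K\<in>T. LINT x|lebesgue_on K. h K x)"
proof -
  have c: "integral\<^sup>L (lebesgue_on K) g = integral\<^sup>L (lebesgue_on K) (h K)"
    and g: "integrable (lebesgue_on K) g" if K: "K \<in> T" for K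
    using lebesgue_on_cong_AE[OF sets_T[OF K] borel_measurable_integrable[OF h[OF K]] ae[OF K]]
      h[OF K] by simp_all
  show "integrable (lebesgue_on \<Omega>) g" by (rule integrable_mesh[OF g])
  show "(LINT x|lebesgue_on \<Omega>. g x) = (\<Sum>K\<in>T. LINT x|lebesgue_on K. h K x)"
    using integral_mesh[OF g] c by simp
qed

lemma integrable_continuous_cell:
  "K \<in> T \<Longrightarrow> continuous_on K g \<Longrightarrow> integrable (lebesgue_on K) (g :: real^'n \<Rightarrow> real)"
  by (rule integrable_lebesgue_on_compact[OF compact_T])

lemma
  fixes g :: "real^'n \<Rightarrow> real"
  assumes q: "\<And>K. K \<in> T \<Longrightarrow> continuous_on K (q K)"
    and ae: "\<And>K. K \<in> T \<Longrightarrow> AE x in lebesgue_on K. g x = q K x"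
  shows integrable_pw: "integrable (lebesgue_on \<Omega>) g"
    and integral_pw: "(LINT x|lebesgue_on \<Omega>. g x) = (\<Sum>K\<in>T. LINT x|lebesgue_on K. q K x)"
proof -
  have i: "integrable (lebesgue_on K) (q K)" if "K \<in> T" for K
    by (rule integrable_continuous_cell[OF that q[OF that]])
  show "integrable (lebesgue_on \<Omega>) g" by (rule integrable_cells[where h=q]) (rule i ae, assumption)+
  show "(LINT x|lebesgue_on \<Omega>. g x) = (\<Sum>K\<in>T. LINT x|lebesgue_on K. q K x)"
    by (rule integral_cells[where h=q]) (rule i ae, assumption)+
qed

lemma measurable_pw:
  fixes g :: "real^'n \<Rightarrow> real"
  assumes "\<And>K. K \<in> T \<Longrightarrow> continuous_on K (q K)"
    and "\<And>K. K \<in> T \<Longrightarrow> AE x in lebesgue_on K. g x = q K x"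
  shows "g \<in> borel_measurable (lebesgue_on \<Omega>)"
proof (rule borel_measurable_integrable, rule integrable_pw[where q=q and g=g])
  fix K assume "K \<in> T"
  then show "continuous_on K (q K)" "AE x in lebesgue_on K. g x = q K x"
    using assms by simp_all
qed

lemma L2_pw:
  fixes v :: "real^'n \<Rightarrow> 'b::euclidean_space"
  assumes c: "\<And>K. K \<in> T \<Longrightarrow> continuous_on K (q K)"
    and ae: "\<And>K. K \<in> T \<Longrightarrow> AE x in lebesgue_on K. v x = q K x"
  shows "v \<in> L2 \<Omega>"
proof -
  have "integrable (lebesgue_on \<Omega>) (\<lambda>x. (norm (v x))\<^sup>2)"
  proof (rule integrable_pw[where q="\<lambda>K x. (norm (q K x))\<^sup>2"])
    fix K assume K: "K \<in> T"
    show "continuous_on K (\<lambda>x. (norm (q K x))\<^sup>2)" by (intro continuous_intros c K)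
    show "AE x in lebesgue_on K. (norm (v x))\<^sup>2 = (norm (q K x))\<^sup>2" using ae[OF K] by eventually_elim simp
  qed
  moreover have "v \<in> borel_measurable (lebesgue_on \<Omega>)"
    unfolding borel_measurable_euclidean_space[of v]
  proof
    fix i :: 'b assume "i \<in> Basis"
    show "(\<lambda>x. v x \<bullet> i) \<in> borel_measurable (lebesgue_on \<Omega>)"
    proof (rule measurable_pw[where q="\<lambda>K x. q K x \<bullet> i"])
      fix K assume K: "K \<in> T"
      show "continuous_on K (\<lambda>x. q K x \<bullet> i)" by (intro continuous_intros c K)
      show "AE x in lebesgue_on K. v x \<bullet> i = q K x \<bullet> i" using ae[OF K] by eventually_elim simp
    qed
  qed
  ultimately show ?thesis by (simp add: L2_def)
qed

lemma l2_inner_pw: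
  fixes u v :: "real^'n \<Rightarrow> 'b::euclidean_space"
  assumes "\<And>K. K \<in> T \<Longrightarrow> AE x in lebesgue_on K. u x = p K x"
    and "\<And>K. K \<in> T \<Longrightarrow> AE x in lebesgue_on K. v x = q K x"
    and "\<And>K. K \<in> T \<Longrightarrow> continuous_on K (p K)" "\<And>K. K \<in> T \<Longrightarrow> continuous_on K (q K)"
  shows "l2_inner \<Omega> u v = (\<Sum>K\<in>T. LINT x|lebesgue_on K. p K x \<bullet> q K x)"
  unfolding l2_inner_def
proof (rule integral_pw)
  fix K assume K: "K \<in> T"
  show "continuous_on K (\<lambda>x. p K x \<bullet> q K x)" by (intro continuous_intros assms K)
  show "AE x in lebesgue_on K. u x \<bullet> v x = p K x \<bullet> q K x"
    using assms(1,2)[OF K] by eventually_elim simp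
qed

lemma L2_integrable_times:
  fixes g h :: "real^'n \<Rightarrow> real"
  assumes "g \<in> L2 \<Omega>" "h \<in> L2 \<Omega>"
  shows "integrable (lebesgue_on \<Omega>) (\<lambda>x. g x * h x)"
proof (rule Bochner_Integration.integrable_bound)
  show "integrable (lebesgue_on \<Omega>) (\<lambda>x. (norm (g x))\<^sup>2 + (norm (h x))\<^sup>2)"
    using assms by (simp add: L2_def)
  show "(\<lambda>x. g x * h x) \<in> borel_measurable (lebesgue_on \<Omega>)"
    using assms by (auto simp: L2_def)
  have "\<bar>a * b\<bar> \<le> a\<^sup>2 + b\<^sup>2" for a b :: real
  proof -
    have "2 * (\<bar>a\<bar> * \<bar>b\<bar>) \<le> \<bar>a\<bar>\<^sup>2 + \<bar>b\<bar>\<^sup>2"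
      using zero_le_power2[of "\<bar>a\<bar> - \<bar>b\<bar>"] by (simp add: power2_diff)
    moreover have "0 \<le> \<bar>a\<bar> * \<bar>b\<bar>" by simp
    ultimately show ?thesis unfolding abs_mult power2_abs by linarith
  qed
  then show "AE x in lebesgue_on \<Omega>. norm (g x * h x) \<le> norm ((norm (g x))\<^sup>2 + (norm (h x))\<^sup>2)"
    by (intro AE_I2) (simp add: abs_of_nonneg)
qed

lemma L2_const: "(\<lambda>x. c :: real) \<in> L2 \<Omega>"
  by (rule L2_pw[where q="\<lambda>K x. c"]) auto

lemma L2_integrable: "g \<in> L2 \<Omega> \<Longrightarrow> integrable (lebesgue_on \<Omega>) (g :: real^'n \<Rightarrow> real)"
  using L2_integrable_times[OF _ L2_const[of 1]] by simp

end

section \<open>Raviart--Thomas fields and their fluxes\<close>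

lemma test_function_Ck: "\<phi> \<in> test_functions U \<Longrightarrow> Ck k \<phi>"
  by (simp add: test_functions_def)

lemma test_function_zero:
  assumes "\<phi> \<in> test_functions U" "x \<notin> U"
  shows "\<phi> x = 0" "grad \<phi> x = 0"
proof -
  have x: "x \<notin> closure {x. \<phi> x \<noteq> 0}" using assms by (auto simp: test_functions_def)
  then show "\<phi> x = 0" using closure_subset[of "{x. \<phi> x \<noteq> 0}"] by auto
  have "(\<phi> has_derivative (\<lambda>v. 0)) (at x)"
  proof (rule has_derivative_transform_within_open[where s="- closure {x. \<phi> x \<noteq> 0}"])
    show "((\<lambda>x. 0) has_derivative (\<lambda>v. 0)) (at x)" by simp
    show "0 = \<phi> y" if "y \<in> - closure {x. \<phi> x \<noteq> 0}" for y
      using closure_subset[of "{x. \<phi> x \<noteq> 0}"] that by auto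
  qed (use x in auto)
  then show "grad \<phi> x = 0" by (intro grad_eqI) simp
qed

lemma test_function_mono: "\<phi> \<in> test_functions U \<Longrightarrow> U \<subseteq> V \<Longrightarrow> \<phi> \<in> test_functions V"
  by (auto simp: test_functions_def)

lemma test_function_mult:
  assumes \<psi>: "\<psi> \<in> test_functions U" and \<phi>: "\<And>k. Ck k \<phi>"
  shows "(\<lambda>x. \<psi> x * \<phi> x) \<in> test_functions U"
proof -
  have "closure {x. \<psi> x * \<phi> x \<noteq> 0} \<subseteq> closure {x. \<psi> x \<noteq> 0}"
    by (intro closure_mono) auto
  moreover have "compact (closure {x. \<psi> x \<noteq> 0})" "closure {x. \<psi> x \<noteq> 0} \<subseteq> U"
    using \<psi> by (simp_all add: test_functions_def)
  ultimately have "compact (closure {x. \<psi> x * \<phi> x \<noteq> 0})" "closure {x. \<psi> x * \<phi> x \<noteq> 0} \<subseteq> U"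
    by (meson bounded_subset closed_closure compact_eq_bounded_closed subset_trans)+
  moreover have "Ck k (\<lambda>x. \<psi> x * \<phi> x)" for k
    by (rule Ck_mult[OF test_function_Ck[OF \<psi>] \<phi>])
  ultimately show ?thesis unfolding test_functions_def by blast
qed

context meshed
begin

lemma facet_props:
  assumes "K \<in> T" "F facet_of K"
  shows "F \<in> faces T" "compact F" "convex F" "F \<subseteq> K" "F \<inter> interior K = {}" "F face_of K"
    "aff_dim F = int CARD('n) - 1"
proof -
  have f: "F face_of K" "F \<noteq> {}" "aff_dim F = aff_dim K - 1" using assms(2) by (auto simp: facet_of_def)
  show "F \<in> faces T" using assms by (auto simp: faces_def)
  show "compact F" "convex F" using simplex_facet_supporting[OF simplex_T[OF assms(1)] assms(2)] by auto
  show "F \<subseteq> K" using f(1) by (rule face_of_imp_subset)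
  have "F \<noteq> K" using f(3) by auto
  then show "F \<inter> interior K = {}" using f(1) face_of_disjoint_interior by blast
  show "F face_of K" by (rule f)
  have "aff_dim K = int CARD('n)"
    using aff_dim_simplex[OF simplex_T[OF assms(1)]] .
  then show "aff_dim F = int CARD('n) - 1" using f(3) by simp
qed

lemma finite_faces: "finite (faces T)"
proof -
  have "faces T = (\<Union>K\<in>T. facets K)" by (auto simp: faces_def)
  then show ?thesis using finite_T simplex_facets_finite[OF simplex_T] by auto
qed

text \<open>The sum of the outward fluxes through \<open>F\<close> from the cells that have \<open>F\<close> as a facet. On an interior face it measures the
jump of the normal component. As a sum over all such cells it covers interior and boundary faces alike.\<close>

definition netflux :: "((real^'n) set \<Rightarrow> real^'n) \<Rightarrow> ((real^'n) set \<Rightarrow> real) \<Rightarrow> (real^'n) set \<Rightarrow> real" where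
  "netflux a b F = (\<Sum>K\<in>{K\<in>T. F facet_of K}. flux K F (a K) (b K))"

lemma sum_facets_swap:
  "(\<Sum>K\<in>T. \<Sum>F\<in>facets K. flux K F (a K) (b K) * M F) = (\<Sum>F\<in>faces T. netflux a b F * M F)"
proof -
  have "(\<Sum>K\<in>T. \<Sum>F\<in>facets K. flux K F (a K) (b K) * M F)
      = (\<Sum>K\<in>T. \<Sum>F\<in>{F. F \<in> faces T \<and> F facet_of K}. flux K F (a K) (b K) * M F)"
    by (intro sum.cong) (auto simp: faces_def)
  also have "\<dots> = (\<Sum>F\<in>faces T. \<Sum>K\<in>{K. K \<in> T \<and> F facet_of K}. flux K F (a K) (b K) * M F)"
    by (rule sum.swap_restrict[OF finite_T finite_faces])
  finally show ?thesis by (simp add: netflux_def sum_distrib_right)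
qed

lemma boundary_face_integral:
  assumes "\<phi> \<in> test_functions \<Omega>" "F \<in> boundary_faces \<Omega> T"
  shows "face_integral F \<phi> = 0"
proof (rule face_integral_zero)
  fix x assume "x \<in> F"
  then have "x \<notin> \<Omega>" using assms(2) open_\<Omega> by (auto simp: boundary_faces_def frontier_def interior_open)
  then show "\<phi> x = 0" using test_function_zero[OF assms(1)] by blast
qed

lemma sum_interior_faces:
  assumes "\<And>F. F \<in> boundary_faces \<Omega> T \<Longrightarrow> M F = 0"
    and "\<And>F. F \<in> interior_faces \<Omega> T \<Longrightarrow> netflux a b F = 0"
  shows "(\<Sum>K\<in>T. \<Sum>F\<in>facets K. flux K F (a K) (b K) * M F) = 0"
  unfolding sum_facets_swap
  by (rule sum.neutral) (use assms in \<open>auto simp: interior_faces_def\<close>)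

definition rt_data :: "(real^'n \<Rightarrow> real^'n) \<Rightarrow> ((real^'n) set \<Rightarrow> real^'n) \<Rightarrow> ((real^'n) set \<Rightarrow> real) \<Rightarrow> bool" where
  "rt_data \<tau> a b \<longleftrightarrow> (\<forall>K\<in>T. AE x in lebesgue_on K. \<tau> x = a K + b K *\<^sub>R x)"

lemma rt_dataD: "rt_data \<tau> a b \<Longrightarrow> K \<in> T \<Longrightarrow> AE x in lebesgue_on K. \<tau> x = a K + b K *\<^sub>R x"
  by (simp add: rt_data_def)

lemma rt_data_exists:
  assumes "\<tau> \<in> piecewise T RT_shape"
  obtains a b where "rt_data \<tau> a b"
proof -
  have "\<forall>K\<in>T. \<exists>a b. AE x in lebesgue_on K. \<tau> x = a + b *\<^sub>R x"
    using assms by (fastforce simp: piecewise_def RT_shape_def)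
  then show thesis using that unfolding rt_data_def by metis
qed

lemma rt_data_piecewise: "rt_data \<tau> a b \<Longrightarrow> \<tau> \<in> piecewise T RT_shape"
  by (fastforce simp: piecewise_def RT_shape_def rt_data_def)

lemma rt_data_L2: "rt_data \<tau> a b \<Longrightarrow> \<tau> \<in> L2 \<Omega>"
  by (rule L2_pw[where q="\<lambda>K x. a K + b K *\<^sub>R x"]) (auto intro!: continuous_intros dest: rt_dataD)

lemma l2_inner_rt_grad:
  assumes \<tau>: "rt_data \<tau> a b" and \<phi>: "Ck (Suc 0) \<phi>"
  shows "l2_inner \<Omega> \<tau> (grad \<phi>) = (\<Sum>K\<in>T. \<Sum>F\<in>facets K. flux K F (a K) (b K) * face_integral F \<phi>)
     - (\<Sum>K\<in>T. real CARD('n) * b K * (LINT x|lebesgue_on K. \<phi> x))"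
proof -
  have "l2_inner \<Omega> \<tau> (grad \<phi>) = (\<Sum>K\<in>T. LINT x|lebesgue_on K. (a K + b K *\<^sub>R x) \<bullet> grad \<phi> x)"
    by (rule l2_inner_pw[OF rt_dataD[OF \<tau>]])
       (auto intro!: continuous_intros Ck_grad_continuous \<phi>)
  also have "\<dots> = (\<Sum>K\<in>T. (\<Sum>F\<in>facets K. flux K F (a K) (b K) * face_integral F \<phi>)
     - real CARD('n) * b K * (LINT x|lebesgue_on K. \<phi> x))"
    by (intro sum.cong refl green_simplex_field simplex_T \<phi>)
  finally show ?thesis by (simp add: sum_subtractf)
qed

text \<open>Test the weak divergence with \<open>\<psi>\<^sub>k \<phi>\<close>, where the cutoffs \<open>\<psi>\<^sub>k\<close> are supported inside \<open>K\<close> and tend to \<open>1\<close> there. Green's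
identity then has no facet terms, and dominated convergence removes the cutoff. The function \<open>\<phi>\<close> itself may be
nonzero on the boundary of \<open>K\<close>; with \<open>\<phi> = 1\<close> the lemma computes the mean of the weak divergence.\<close>

lemma weak_div_cell:
  assumes \<tau>: "rt_data \<tau> a b" and g: "g \<in> L2 \<Omega>" "has_weak_div \<Omega> \<tau> g"
    and \<phi>: "\<And>k. Ck k \<phi>" and K: "K \<in> T"
  shows "(LINT x|lebesgue_on K. g x * \<phi> x) = real CARD('n) * b K * (LINT x|lebesgue_on K. \<phi> x)"
proof -
  obtain \<psi> where \<psi>: "\<And>k. \<psi> k \<in> test_functions (interior K)" "\<And>k x. 0 \<le> \<psi> k x" "\<And>k x. \<psi> k x \<le> 1"
    and lim: "\<And>x. x \<in> interior K \<Longrightarrow> (\<lambda>k. \<psi> k x) \<longlonglongrightarrow> 1"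
    by (rule polytope_cutoffs[OF simplex_imp_polytope[OF simplex_T[OF K]]]) blast
  have \<phi>L2: "\<phi> \<in> L2 \<Omega>"
    by (rule L2_pw[where q="\<lambda>K. \<phi>"]) (auto intro: Ck_continuous_on[OF \<phi>])
  have g\<phi>: "integrable (lebesgue_on K) (\<lambda>x. g x * \<phi> x)"
    by (rule integrable_mesh_cell[OF L2_integrable_times[OF g(1) \<phi>L2] K])
  have \<phi>i: "integrable (lebesgue_on K) \<phi>"
    by (rule integrable_lebesgue_on_compact[OF compact_T[OF K] Ck_continuous_on[OF \<phi>]])
  have \<psi>m: "\<psi> k \<in> borel_measurable (lebesgue_on S)" for k S
    using Ck_measurable_lebesgue_on[of 0 "\<psi> k"] test_function_Ck[OF \<psi>(1)] by blast
  have step: "(LINT x|lebesgue_on K. (g x * \<phi> x) * \<psi> k x) = real CARD('n) * b K * (LINT x|lebesgue_on K. \<phi> x * \<psi> k x)" for k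
  proof -
    define f where "f x = \<psi> k x * \<phi> x" for x
    have f: "f \<in> test_functions (interior K)"
      unfolding f_def[abs_def] by (rule test_function_mult[OF \<psi>(1) \<phi>])
    have f\<Omega>: "f \<in> test_functions \<Omega>"
      by (rule test_function_mono[OF f interior_subset_\<Omega>[OF K]])
    have fC: "Ck j f" for j by (rule test_function_Ck[OF f])
    have fL2: "f \<in> L2 \<Omega>"
      by (rule L2_pw[where q="\<lambda>K. f"]) (auto intro: Ck_continuous_on[OF fC])
    have off: "f x = 0" if "K' \<in> T" "x \<in> K'" "K' \<noteq> K" for x K'
      using test_function_zero(1)[OF f, of x] disjoint_interiors[OF that(1) K that(3)] that(2) by blast
    have "face_integral F f = 0" if "K' \<in> T" "F facet_of K'" for K' F
    proof (rule face_integral_zero)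
      fix x assume "x \<in> F"
      then show "f x = 0"
        using facet_props[OF that] off[OF that(1)] test_function_zero(1)[OF f, of x] by (cases "K' = K") blast+
    qed
    then have "l2_inner \<Omega> \<tau> (grad f) = - (\<Sum>K'\<in>T. real CARD('n) * b K' * (LINT x|lebesgue_on K'. f x))"
      unfolding l2_inner_rt_grad[OF \<tau> fC] by simp
    also have "(\<Sum>K'\<in>T. real CARD('n) * b K' * (LINT x|lebesgue_on K'. f x)) =
        (\<Sum>K'\<in>T. if K' = K then real CARD('n) * b K * (LINT x|lebesgue_on K. f x) else 0)"
    proof (rule sum.cong[OF refl])
      fix K' assume K': "K' \<in> T"
      have "(LINT x|lebesgue_on K'. f x) = (LINT x|lebesgue_on K'. 0)" if "K' \<noteq> K"
        by (rule Bochner_Integration.integral_cong[OF refl]) (use off[OF K' _ that] in simp)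
      then show "real CARD('n) * b K' * (LINT x|lebesgue_on K'. f x) =
          (if K' = K then real CARD('n) * b K * (LINT x|lebesgue_on K. f x) else 0)" by simp
    qed
    also have "\<dots> = real CARD('n) * b K * (LINT x|lebesgue_on K. f x)" using K finite_T by simp
    finally have 1: "l2_inner \<Omega> \<tau> (grad f) = - (real CARD('n) * b K * (LINT x|lebesgue_on K. f x))" .
    have gf: "integrable (lebesgue_on K') (\<lambda>x. g x * f x)" if "K' \<in> T" for K'
      by (rule integrable_mesh_cell[OF L2_integrable_times[OF g(1) fL2] that])
    have "l2_inner \<Omega> g f = (\<Sum>K'\<in>T. LINT x|lebesgue_on K'. g x * f x)"
      unfolding l2_inner_def using integral_mesh[OF gf] by simp
    also have "\<dots> = (\<Sum>K'\<in>T. if K' = K then LINT x|lebesgue_on K. g x * f x else 0)"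
    proof (rule sum.cong[OF refl])
      fix K' assume K': "K' \<in> T"
      have "(LINT x|lebesgue_on K'. g x * f x) = (LINT x|lebesgue_on K'. 0)" if "K' \<noteq> K"
        by (rule Bochner_Integration.integral_cong[OF refl]) (use off[OF K' _ that] in simp)
      then show "(LINT x|lebesgue_on K'. g x * f x) = (if K' = K then LINT x|lebesgue_on K. g x * f x else 0)"
        by simp
    qed
    also have "\<dots> = (LINT x|lebesgue_on K. g x * f x)" using K finite_T by simp
    finally have "(LINT x|lebesgue_on K. g x * f x) = real CARD('n) * b K * (LINT x|lebesgue_on K. f x)"
      using 1 g(2) f\<Omega> unfolding has_weak_div_def by fastforce
    then show ?thesis by (simp add: f_def mult_ac)
  qed
  have dct: "(\<lambda>k. LINT x|lebesgue_on K. w x * \<psi> k x) \<longlonglongrightarrow> (LINT x|lebesgue_on K. w x)"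
    if w: "integrable (lebesgue_on K) w" for w :: "real^'n \<Rightarrow> real"
  proof (rule integral_dominated_convergence[where w="\<lambda>x. \<bar>w x\<bar>"])
    show "w \<in> borel_measurable (lebesgue_on K)" using w by (rule borel_measurable_integrable)
    then show "(\<lambda>x. w x * \<psi> k x) \<in> borel_measurable (lebesgue_on K)" for k
      by (intro borel_measurable_times \<psi>m)
    show "integrable (lebesgue_on K) (\<lambda>x. \<bar>w x\<bar>)" using w by (rule integrable_abs)
    show "AE x in lebesgue_on K. (\<lambda>k. w x * \<psi> k x) \<longlonglongrightarrow> w x"
      using AE_interior[OF K]
    proof eventually_elim
      fix x assume "x \<in> interior K"
      then show "(\<lambda>k. w x * \<psi> k x) \<longlonglongrightarrow> w x" using tendsto_mult_left[OF lim, of x "w x"] by simp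
    qed
    show "AE x in lebesgue_on K. norm (w x * \<psi> k x) \<le> \<bar>w x\<bar>" for k
      by (rule AE_I2) (auto simp: abs_mult \<psi> intro!: mult_left_le)
  qed
  have "(\<lambda>k. real CARD('n) * b K * (LINT x|lebesgue_on K. \<phi> x * \<psi> k x)) \<longlonglongrightarrow> real CARD('n) * b K * (LINT x|lebesgue_on K. \<phi> x)"
    by (rule tendsto_mult_left[OF dct[OF \<phi>i]])
  then show ?thesis using dct[OF g\<phi>] unfolding step using LIMSEQ_unique by blast
qed

text \<open>An interior face has a relative interior point in \<open>\<Omega>\<close>. It lies on no other face: two faces of the mesh
meet in a common face of both, and a face of \<open>F\<close> that contains a relative interior point of \<open>F\<close> is \<open>F\<close>. So a small bump
around this point detects \<open>F\<close> alone.\<close>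

lemma interior_face_bump:
  assumes F: "F \<in> interior_faces \<Omega> T"
  obtains c \<rho> where "0 < \<rho>" "cball c \<rho> \<subseteq> \<Omega>" "0 < face_integral F (bump \<rho> c)"
    "\<And>F'. F' \<in> faces T \<Longrightarrow> F' \<noteq> F \<Longrightarrow> face_integral F' (bump \<rho> c) = 0"
proof -
  obtain K where K: "K \<in> T" "F facet_of K" using F by (auto simp: interior_faces_def faces_def)
  note fp = facet_props[OF K]
  have "F \<subseteq> closure \<Omega>" using fp(4) K(1) Union_T by blast
  moreover have "\<not> F \<subseteq> frontier \<Omega>" using F by (auto simp: interior_faces_def boundary_faces_def)
  ultimately obtain x where x: "x \<in> F" "x \<in> \<Omega>"
    using open_\<Omega> by (auto simp: frontier_def interior_open)
  have "x \<in> closure (rel_interior F)"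
    using convex_closure_rel_interior[OF fp(3)] x(1) closure_subset by blast
  then have "\<Omega> \<inter> rel_interior F \<noteq> {}"
    using x(2) open_\<Omega> open_Int_closure_eq_empty[of \<Omega> "rel_interior F"] by blast
  then obtain c where c: "c \<in> \<Omega>" "c \<in> rel_interior F" by blast
  have cF': "c \<notin> F'" if F': "F' \<in> faces T" "F' \<noteq> F" for F'
  proof
    assume cF': "c \<in> F'"
    obtain K' where K': "K' \<in> T" "F' facet_of K'" using F' by (auto simp: faces_def)
    note fp' = facet_props[OF K']
    let ?C = "K \<inter> K'"
    have C: "?C face_of K" "?C face_of K'"
      using face_of_T[OF K(1) K'(1)] face_of_T[OF K'(1) K(1)] by (simp_all add: Int_commute)
    have "F \<inter> ?C face_of K" using fp(6) C(1) by (rule face_of_Int)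
    then have 1: "F \<inter> ?C face_of ?C" by (rule face_of_subset) auto
    have "F' \<inter> ?C face_of K'" using fp'(6) C(2) by (rule face_of_Int)
    then have 2: "F' \<inter> ?C face_of ?C" by (rule face_of_subset) auto
    have "(F \<inter> ?C) \<inter> (F' \<inter> ?C) face_of ?C" by (rule face_of_Int[OF 1 2])
    moreover have "(F \<inter> ?C) \<inter> (F' \<inter> ?C) = F \<inter> F'" using fp(4) fp'(4) by blast
    ultimately have FF: "F \<inter> F' face_of ?C" by simp
    have fF: "F \<inter> F' face_of F"
      by (rule face_of_subset[OF face_of_trans[OF FF C(1)]]) (use fp(4) in auto)
    have fF': "F \<inter> F' face_of F'"
      by (rule face_of_subset[OF face_of_trans[OF FF C(2)]]) (use fp'(4) in auto)
    have "F \<inter> F' = F"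
      using face_of_disjoint_rel_interior[OF fF] c(2) cF' rel_interior_subset by blast
    then have "F face_of F'" using fF' by simp
    then show False
      using face_of_aff_dim_lt[OF fp'(3), of F] F'(2) fp(7) fp'(7) by auto
  qed
  define U where "U = \<Omega> - \<Union>(faces T - {F})"
  have "closed (\<Union>(faces T - {F}))"
    using finite_faces facet_props(2) by (intro closed_Union) (auto simp: faces_def intro: compact_imp_closed)
  then have "open U" unfolding U_def by (intro open_Diff open_\<Omega>)
  moreover have "c \<in> U" using c(1) cF' by (auto simp: U_def)
  ultimately obtain \<rho> where \<rho>: "\<rho> > 0" "cball c \<rho> \<subseteq> U"
    using open_contains_cball by blast
  have "0 < face_integral F (bump \<rho> c)"
    by (rule face_integral_pos[OF simplex_T[OF K(1)] K(2) Ck_continuous_on[OF Ck_bump[of 0]] bump_nonneg c(2)])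
       (use bump_pos_iff[OF \<rho>(1), of c c] \<rho>(1) in simp)
  moreover have "face_integral F' (bump \<rho> c) = 0" if "F' \<in> faces T" "F' \<noteq> F" for F'
  proof (rule face_integral_zero)
    fix x assume "x \<in> F'"
    then have "x \<notin> ball c \<rho>" using \<rho>(2) that ball_subset_cball unfolding U_def by blast
    then show "bump \<rho> c x = 0" by (rule bump_eq_0[OF \<rho>(1)])
  qed
  ultimately show thesis using that \<rho> U_def by blast
qed

lemma face_sum_bump:
  assumes "F \<in> interior_faces \<Omega> T"
    and "\<And>F'. F' \<in> faces T \<Longrightarrow> F' \<noteq> F \<Longrightarrow> face_integral F' \<phi> = 0"
  shows "(\<Sum>K\<in>T. \<Sum>F\<in>facets K. flux K F (a K) (b K) * face_integral F \<phi>) = netflux a b F * face_integral F \<phi>"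
proof -
  have "(\<Sum>G\<in>faces T. netflux a b G * face_integral G \<phi>) =
    (\<Sum>G\<in>faces T. if G = F then netflux a b F * face_integral F \<phi> else 0)"
    using assms(2) by (intro sum.cong) auto
  then show ?thesis using assms(1) finite_faces unfolding sum_facets_swap by (simp add: interior_faces_def)
qed

text \<open>Test with a bump that detects \<open>F\<close> alone. The volume terms cancel cell by cell.\<close>

lemma Hdiv_netflux:
  assumes \<tau>: "rt_data \<tau> a b" and g: "g \<in> L2 \<Omega>" "has_weak_div \<Omega> \<tau> g" and F: "F \<in> interior_faces \<Omega> T"
  shows "netflux a b F = 0"
proof -
  obtain c \<rho> where \<rho>: "0 < \<rho>" "cball c \<rho> \<subseteq> \<Omega>" and pos: "0 < face_integral F (bump \<rho> c)"
    and zero: "\<And>F'. F' \<in> faces T \<Longrightarrow> F' \<noteq> F \<Longrightarrow> face_integral F' (bump \<rho> c) = 0"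
    using interior_face_bump[OF F] by metis
  let ?\<phi> = "bump \<rho> c"
  have \<phi>L2: "?\<phi> \<in> L2 \<Omega>"
    by (rule L2_pw[where q="\<lambda>K. ?\<phi>"]) (auto intro: Ck_continuous_on[OF Ck_bump[of 0]])
  have gf: "integrable (lebesgue_on K') (\<lambda>x. g x * ?\<phi> x)" if "K' \<in> T" for K'
    by (rule integrable_mesh_cell[OF L2_integrable_times[OF g(1) \<phi>L2] that])
  have "l2_inner \<Omega> g ?\<phi> = (\<Sum>K\<in>T. LINT x|lebesgue_on K. g x * ?\<phi> x)"
    unfolding l2_inner_def using integral_mesh[OF gf] by simp
  also have "\<dots> = (\<Sum>K\<in>T. real CARD('n) * b K * (LINT x|lebesgue_on K. ?\<phi> x))"
    by (intro sum.cong refl weak_div_cell[OF \<tau> g Ck_bump])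
  finally have "netflux a b F * face_integral F ?\<phi> = 0"
    using g(2) bump_test_function[OF \<rho>] l2_inner_rt_grad[OF \<tau> Ck_bump[of "Suc 0" \<rho> c]] face_sum_bump[OF F zero]
    unfolding has_weak_div_def by fastforce
  then show ?thesis using pos by simp
qed

lemma netflux_has_weak_div:
  assumes \<tau>: "rt_data \<tau> a b" and 0: "\<And>F. F \<in> interior_faces \<Omega> T \<Longrightarrow> netflux a b F = 0"
  shows "has_weak_div \<Omega> \<tau> (glue (\<lambda>K x. real CARD('n) * b K))" "glue (\<lambda>K x. real CARD('n) * b K) \<in> L2 \<Omega>"
proof -
  let ?g = "glue (\<lambda>K x. real CARD('n) * b K)"
  show "?g \<in> L2 \<Omega>" by (rule L2_pw[OF _ glue_AE]) auto
  show "has_weak_div \<Omega> \<tau> ?g"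
    unfolding has_weak_div_def
  proof
    fix \<phi> assume \<phi>: "\<phi> \<in> test_functions \<Omega>"
    have \<phi>c: "continuous_on S \<phi>" for S by (rule Ck_continuous_on[OF test_function_Ck[OF \<phi>, of 0]])
    have "l2_inner \<Omega> ?g \<phi> = (\<Sum>K\<in>T. LINT x|lebesgue_on K. (real CARD('n) * b K) * \<phi> x)"
      unfolding inner_real_def[symmetric]
      by (rule l2_inner_pw[OF glue_AE]) (simp_all add: \<phi>c)
    then have "l2_inner \<Omega> ?g \<phi> = (\<Sum>K\<in>T. real CARD('n) * b K * (LINT x|lebesgue_on K. \<phi> x))"
      by (simp only: integral_mult_right_zero)
    then show "l2_inner \<Omega> \<tau> (grad \<phi>) = - l2_inner \<Omega> ?g \<phi>"
      using l2_inner_rt_grad[OF \<tau> test_function_Ck[OF \<phi>]]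
        sum_interior_faces[of "\<lambda>F. face_integral F \<phi>", OF boundary_face_integral[OF \<phi>] 0] by simp
  qed
qed

text \<open>For piecewise fields of Raviart--Thomas shape, membership in \<open>H(div)\<close> is a finite set of linear conditions.\<close>

lemma RT_iff:
  assumes \<tau>: "rt_data \<tau> a b"
  shows "\<tau> \<in> RT \<Omega> T \<longleftrightarrow> (\<forall>F\<in>interior_faces \<Omega> T. netflux a b F = 0)"
proof
  assume "\<tau> \<in> RT \<Omega> T"
  then show "\<forall>F\<in>interior_faces \<Omega> T. netflux a b F = 0"
    using Hdiv_netflux[OF \<tau>] by (auto simp: RT_def Hdiv_def)
next
  assume "\<forall>F\<in>interior_faces \<Omega> T. netflux a b F = 0"
  then show "\<tau> \<in> RT \<Omega> T"
    using netflux_has_weak_div[OF \<tau>] rt_data_L2[OF \<tau>] rt_data_piecewise[OF \<tau>]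
    by (auto simp: RT_def Hdiv_def)
qed

lemma wdiv_RT:
  assumes "\<tau> \<in> RT \<Omega> T"
  shows "wdiv \<Omega> \<tau> \<in> L2 \<Omega>" "has_weak_div \<Omega> \<tau> (wdiv \<Omega> \<tau>)"
proof -
  have "\<exists>g. g \<in> L2 \<Omega> \<and> has_weak_div \<Omega> \<tau> g" using assms by (auto simp: RT_def Hdiv_def)
  from someI_ex[OF this] show "wdiv \<Omega> \<tau> \<in> L2 \<Omega>" "has_weak_div \<Omega> \<tau> (wdiv \<Omega> \<tau>)"
    by (simp_all add: wdiv_def)
qed

abbreviation vol :: "(real^'n) set \<Rightarrow> real" where "vol K \<equiv> (LINT x|lebesgue_on K. 1)"

lemma integral_wdiv_cell:
  assumes "rt_data \<tau> a b" "\<tau> \<in> RT \<Omega> T" "K \<in> T"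
  shows "(LINT x|lebesgue_on K. wdiv \<Omega> \<tau> x) = real CARD('n) * b K * vol K"
  using weak_div_cell[OF assms(1) wdiv_RT[OF assms(2)] Ck_const[where c=1] assms(3)] by simp

text \<open>For the bump that detects \<open>F\<close>, the net flux times a positive number is the integral of a directional
derivative of the bump. This derivative is odd with respect to the centre of the bump, so the integral vanishes.\<close>

lemma netflux_const:
  assumes F: "F \<in> interior_faces \<Omega> T"
  shows "netflux (\<lambda>K. e) (\<lambda>K. 0) F = 0"
proof -
  obtain c \<rho> where \<rho>: "0 < \<rho>" "cball c \<rho> \<subseteq> \<Omega>" and pos: "0 < face_integral F (bump \<rho> c)"
    and zero: "\<And>F'. F' \<in> faces T \<Longrightarrow> F' \<noteq> F \<Longrightarrow> face_integral F' (bump \<rho> c) = 0"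
    using interior_face_bump[OF F] by metis
  let ?G = "\<lambda>x. e \<bullet> grad (bump \<rho> c) x"
  have cont: "continuous_on UNIV ?G" by (intro continuous_intros Ck_grad_continuous Ck_bump)
  have [measurable]: "?G \<in> borel_measurable borel" by (rule borel_measurable_continuous_onI[OF cont])
  have [measurable]: "\<Omega> \<in> sets borel" using open_\<Omega> by simp
  have \<tau>: "rt_data (\<lambda>x. e) (\<lambda>K. e) (\<lambda>K. 0)" by (simp add: rt_data_def)
  have "netflux (\<lambda>K. e) (\<lambda>K. 0) F * face_integral F (bump \<rho> c) = (LINT x|lebesgue_on \<Omega>. ?G x)"
    using l2_inner_rt_grad[OF \<tau> Ck_bump[of "Suc 0" \<rho> c]] face_sum_bump[OF F zero, of "\<lambda>K. e" "\<lambda>K. 0"]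
    by (simp add: l2_inner_def)
  also have "\<dots> = (LINT x|lborel. indicator \<Omega> x * ?G x)"
    by (rule integral_lebesgue_on_lborel) measurable
  also have "\<dots> = (LINT x|lborel. ?G x)"
    using test_function_zero(2)[OF bump_test_function[OF \<rho>]]
    by (intro Bochner_Integration.integral_cong) (auto simp: indicator_def)
  also have "\<dots> = 0"
  proof -
    have "(LINT x|lborel. ?G x) = (LINT x|density (distr lborel borel (\<lambda>x. (2 *\<^sub>R c) + (-1) *\<^sub>R x)) (\<lambda>_. ennreal 1). ?G x)"
      using lborel_affine[of "-1" "2 *\<^sub>R c"] by simp
    also have "\<dots> = (LINT x|lborel. ?G ((2 *\<^sub>R c) + (-1) *\<^sub>R x))"
      by (simp add: density_1) (subst integral_distr; simp)
    also have "\<dots> = (LINT x|lborel. - ?G x)"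
    proof (rule Bochner_Integration.integral_cong[OF refl])
      fix x
      have r: "(2 *\<^sub>R c) + (-1) *\<^sub>R x - c = - (x - c)" by (simp add: algebra_simps scaleR_2)
      show "?G ((2 *\<^sub>R c) + (-1) *\<^sub>R x) = - ?G x"
        unfolding grad_bump r by (simp del: minus_diff_eq)
    qed
    also have "\<dots> = - (LINT x|lborel. ?G x)" by (rule Bochner_Integration.integral_minus)
    finally show ?thesis by simp
  qed
  finally show ?thesis using pos by simp
qed

end

section \<open>Enriched Crouzeix--Raviart functions on a mesh\<close>

lemma face_integral_diff:
  fixes K :: "(real^'n) set"
  assumes K: "int CARD('n) simplex K" and F: "F facet_of K"
    and g: "continuous_on F g" and h: "continuous_on F h"
  shows "face_integral F (\<lambda>x. g x - h x) = face_integral F g - face_integral F h"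
proof -
  define \<nu> \<beta> where "\<nu> = normal K F" and "\<beta> = offset K F"
  note sf = simplex_facet_supporting[OF K F, folded \<nu>_def \<beta>_def]
  have \<nu>: "norm \<nu> = 1" and hull: "affine hull F = {x. \<nu> \<bullet> x = \<beta>}"
    using sf(1) by (auto simp: supporting_def)
  note eq = face_integral_slab[OF \<nu> hull compact_imp_closed[OF sf(2)]]
  note int = slab_integrand_integrable[OF \<nu> sf(2), where \<beta>=\<beta>]
  show ?thesis
    unfolding eq[OF g] eq[OF h] eq[OF continuous_on_diff[OF g h]] right_diff_distrib
    by (rule Bochner_Integration.integral_diff[OF int[OF g] int[OF h]])
qed

lemma frechet_vec:
  assumes "\<And>i. (f i has_derivative (\<lambda>v. g i \<bullet> v)) (at x)"
  shows "((\<lambda>x. \<chi> i. f i x) has_derivative (\<lambda>v. \<chi> i. g i \<bullet> v)) (at x)"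
  unfolding has_derivative_componentwise_within[of "\<lambda>x. \<chi> i. f i x"]
  using assms by (auto simp: Basis_vec_def inner_axis)

context meshed
begin

definition ecr_data :: "(real^'n \<Rightarrow> real) \<Rightarrow> ((real^'n) set \<Rightarrow> real) \<Rightarrow> ((real^'n) set \<Rightarrow> real^'n) \<Rightarrow>
    ((real^'n) set \<Rightarrow> real) \<Rightarrow> bool" where
  "ecr_data v c a b \<longleftrightarrow> (\<forall>K\<in>T. AE x in lebesgue_on K. v x = ecr (c K) (a K) (b K) x)"

lemma ecr_dataD: "ecr_data v c a b \<Longrightarrow> K \<in> T \<Longrightarrow> AE x in lebesgue_on K. v x = ecr (c K) (a K) (b K) x"
  by (simp add: ecr_data_def)

lemma ecr_data_exists:
  assumes "v \<in> V_ECR \<Omega> T"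
  obtains c a b where "ecr_data v c a b"
proof -
  have "\<forall>K\<in>T. \<exists>c a b. AE x in lebesgue_on K. v x = ecr c a b x"
    using assms by (fastforce simp: V_ECR_def piecewise_def ECR_shape_eq)
  then show thesis using that unfolding ecr_data_def by metis
qed

lemma ecr_continuous: "continuous_on S (ecr c a b)"
  by (rule Ck_continuous_on[OF Ck_ecr[of 0]])

lemma restr_ecr: "ecr_data v c a b \<Longrightarrow> K \<in> T \<Longrightarrow> x \<in> K \<Longrightarrow> restr K v x = ecr (c K) (a K) (b K) x"
  by (rule restr_eq[OF simplex_T ecr_continuous ecr_dataD])

text \<open>\<open>M F\<close> is the integral over \<open>F\<close> that all cells at \<open>F\<close> have in common.\<close>

lemma V_ECR_iff:
  assumes v: "ecr_data v c a b"
  shows "v \<in> V_ECR \<Omega> T \<longleftrightarrow> (\<exists>M. (\<forall>F\<in>boundary_faces \<Omega> T. M F = 0) \<and>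
     (\<forall>K\<in>T. \<forall>F. F facet_of K \<longrightarrow> face_integral F (ecr (c K) (a K) (b K)) = M F))"
proof -
  let ?I = "\<lambda>K F. face_integral F (ecr (c K) (a K) (b K))"
  have 1: "face_integral F (restr K v) = ?I K F" if "K \<in> T" "F facet_of K" for K F
    by (rule face_integral_cong) (use restr_ecr[OF v that(1)] facet_props(4)[OF that] in blast)
  have 2: "face_integral F (\<lambda>x. restr K v x - restr K' v x) = ?I K F - ?I K' F"
    if "K \<in> T" "F facet_of K" "K' \<in> T" "F facet_of K'" for K K' F
  proof -
    have "face_integral F (\<lambda>x. restr K v x - restr K' v x) =
      face_integral F (\<lambda>x. ecr (c K) (a K) (b K) x - ecr (c K') (a K') (b K') x)"
    proof (rule face_integral_cong)
      fix x assume "x \<in> F"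
      then have "x \<in> K" "x \<in> K'" using facet_props(4) that by blast+
      then show "restr K v x - restr K' v x = ecr (c K) (a K) (b K) x - ecr (c K') (a K') (b K') x"
        using restr_ecr[OF v] that by simp
    qed
    also have "\<dots> = ?I K F - ?I K' F"
      by (rule face_integral_diff[OF simplex_T[OF that(1)] that(2) ecr_continuous ecr_continuous])
    finally show ?thesis .
  qed
  have base: "v \<in> L2 \<Omega> \<inter> piecewise T ECR_shape"
  proof
    show "v \<in> L2 \<Omega>"
      by (rule L2_pw[where q="\<lambda>K. ecr (c K) (a K) (b K)"]) (auto intro: ecr_continuous ecr_dataD[OF v])
    show "v \<in> piecewise T ECR_shape"
      using v by (auto simp: piecewise_def ECR_shape_eq ecr_data_def)
  qed
  show ?thesis
  proof
    assume V: "v \<in> V_ECR \<Omega> T"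
    define M where "M F = ?I (SOME K. K \<in> T \<and> F facet_of K) F" for F
    have some: "(SOME K. K \<in> T \<and> F facet_of K) \<in> T" "F facet_of (SOME K. K \<in> T \<and> F facet_of K)"
      if "K \<in> T" "F facet_of K" for K F
      using someI[of "\<lambda>K. K \<in> T \<and> F facet_of K" K] that by auto
    have bd: "?I K F = 0" if "F \<in> boundary_faces \<Omega> T" "K \<in> T" "F facet_of K" for F K
      using V that 1[OF that(2,3)] unfolding V_ECR_def by auto
    have "M F = 0" if F: "F \<in> boundary_faces \<Omega> T" for F
    proof -
      obtain K where "K \<in> T" "F facet_of K" using F by (auto simp: boundary_faces_def faces_def)
      from some[OF this] show ?thesis unfolding M_def using bd[OF F] by blast
    qed
    moreover have "?I K F = M F" if K: "K \<in> T" "F facet_of K" for K F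
    proof (cases "F \<in> boundary_faces \<Omega> T")
      case True
      then show ?thesis using bd[OF True K] calculation by simp
    next
      case False
      then have F: "F \<in> interior_faces \<Omega> T" using facet_props(1)[OF K] by (simp add: interior_faces_def)
      let ?K = "SOME K. K \<in> T \<and> F facet_of K"
      show ?thesis
      proof (cases "K = ?K")
        case False
        then have "face_integral F (\<lambda>x. restr K v x - restr ?K v x) = 0"
          using V F K some[OF K] unfolding V_ECR_def by blast
        then show ?thesis using 2[OF K some[OF K]] by (simp add: M_def)
      qed (simp add: M_def)
    qed
    ultimately show "\<exists>M. (\<forall>F\<in>boundary_faces \<Omega> T. M F = 0) \<and> (\<forall>K\<in>T. \<forall>F. F facet_of K \<longrightarrow> ?I K F = M F)"
      by blast
  next
    assume "\<exists>M. (\<forall>F\<in>boundary_faces \<Omega> T. M F = 0) \<and> (\<forall>K\<in>T. \<forall>F. F facet_of K \<longrightarrow> ?I K F = M F)"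
    then obtain M where M: "\<And>F. F \<in> boundary_faces \<Omega> T \<Longrightarrow> M F = 0"
      "\<And>K F. K \<in> T \<Longrightarrow> F facet_of K \<Longrightarrow> ?I K F = M F" by blast
    show "v \<in> V_ECR \<Omega> T"
      unfolding V_ECR_def mem_Collect_eq
    proof (intro conjI ballI impI base)
      fix E K K' assume "K \<in> T" "K' \<in> T" "K \<noteq> K' \<and> E facet_of K \<and> E facet_of K'"
      then show "face_integral E (\<lambda>x. restr K v x - restr K' v x) = 0" using 2 M(2) by simp
    next
      fix E K assume "E \<in> boundary_faces \<Omega> T" "K \<in> T" "E facet_of K"
      then show "face_integral E (restr K v) = 0" using 1 M by simp
    qed
  qed
qed

text \<open>The facet terms are the common facet integrals of \<open>v\<close> times the net fluxes of the field; the former vanish on the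
boundary and the latter inside.\<close>

lemma green_ECR_RT:
  assumes v: "ecr_data v c a b" "v \<in> V_ECR \<Omega> T"
    and 0: "\<And>F. F \<in> interior_faces \<Omega> T \<Longrightarrow> netflux \<alpha> \<beta> F = 0"
  shows "(\<Sum>K\<in>T. LINT x|lebesgue_on K. (\<alpha> K + \<beta> K *\<^sub>R x) \<bullet> (a K + (2 * b K) *\<^sub>R x)) =
    - (\<Sum>K\<in>T. real CARD('n) * \<beta> K * (LINT x|lebesgue_on K. ecr (c K) (a K) (b K) x))"
proof -
  obtain M where M: "\<And>F. F \<in> boundary_faces \<Omega> T \<Longrightarrow> M F = 0"
    "\<And>K F. K \<in> T \<Longrightarrow> F facet_of K \<Longrightarrow> face_integral F (ecr (c K) (a K) (b K)) = M F"
    using v(2) unfolding V_ECR_iff[OF v(1)] by blast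
  have "(\<Sum>K\<in>T. (LINT x|lebesgue_on K. (\<alpha> K + \<beta> K *\<^sub>R x) \<bullet> (a K + (2 * b K) *\<^sub>R x)) +
     real CARD('n) * \<beta> K * (LINT x|lebesgue_on K. ecr (c K) (a K) (b K) x))
    = (\<Sum>K\<in>T. \<Sum>F\<in>facets K. flux K F (\<alpha> K) (\<beta> K) * M F)"
  proof (rule sum.cong[OF refl])
    fix K assume K: "K \<in> T"
    let ?e = "ecr (c K) (a K) (b K)"
    have "(\<Sum>F\<in>facets K. flux K F (\<alpha> K) (\<beta> K) * M F) = (\<Sum>F\<in>facets K. flux K F (\<alpha> K) (\<beta> K) * face_integral F ?e)"
      using M(2)[OF K] by (intro sum.cong) auto
    then show "(LINT x|lebesgue_on K. (\<alpha> K + \<beta> K *\<^sub>R x) \<bullet> (a K + (2 * b K) *\<^sub>R x)) +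
      real CARD('n) * \<beta> K * (LINT x|lebesgue_on K. ?e x) = (\<Sum>F\<in>facets K. flux K F (\<alpha> K) (\<beta> K) * M F)"
      using green_simplex_field[OF simplex_T[OF K] Ck_ecr[of "Suc 0" "c K" "a K" "b K"], of "\<alpha> K" "\<beta> K"]
      by (simp add: grad_ecr)
  qed
  also have "\<dots> = 0" by (rule sum_interior_faces[OF M(1) 0])
  finally show ?thesis by (simp add: sum.distrib)
qed

text \<open>The interpolant shares the facet integrals and the cell means with \<open>\<phi>\<close>, and Green's identity for a field of
Raviart--Thomas shape depends on nothing else.\<close>

lemma ecr_interpolation:
  assumes \<phi>: "\<phi> \<in> test_functions \<Omega>"
  obtains c a b where "glue (\<lambda>K. ecr (c K) (a K) (b K)) \<in> V_ECR \<Omega> T"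
    "ecr_data (glue (\<lambda>K. ecr (c K) (a K) (b K))) c a b"
    "\<And>K. K \<in> T \<Longrightarrow> (LINT x|lebesgue_on K. ecr (c K) (a K) (b K) x) = (LINT x|lebesgue_on K. \<phi> x)"
    "\<And>K \<alpha> \<beta>. K \<in> T \<Longrightarrow> (LINT x|lebesgue_on K. (\<alpha> + \<beta> *\<^sub>R x) \<bullet> grad (ecr (c K) (a K) (b K)) x) =
        (LINT x|lebesgue_on K. (\<alpha> + \<beta> *\<^sub>R x) \<bullet> grad \<phi> x)"
proof -
  have "\<forall>K\<in>T. \<exists>c a b. (\<forall>F. F facet_of K \<longrightarrow> face_integral F (ecr c a b) = face_integral F \<phi>) \<and>
     (LINT x|lebesgue_on K. ecr c a b x) = (LINT x|lebesgue_on K. \<phi> x)"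
  proof
    fix K assume K: "K \<in> T"
    show "\<exists>c a b. (\<forall>F. F facet_of K \<longrightarrow> face_integral F (ecr c a b) = face_integral F \<phi>) \<and>
     (LINT x|lebesgue_on K. ecr c a b x) = (LINT x|lebesgue_on K. \<phi> x)"
      by (rule ECR_unisolvence[OF simplex_T[OF K], of "\<lambda>F. face_integral F \<phi>" "LINT x|lebesgue_on K. \<phi> x"]) blast
  qed
  then obtain c a b where cab: "\<And>K F. K \<in> T \<Longrightarrow> F facet_of K \<Longrightarrow> face_integral F (ecr (c K) (a K) (b K)) = face_integral F \<phi>"
    and mean: "\<And>K. K \<in> T \<Longrightarrow> (LINT x|lebesgue_on K. ecr (c K) (a K) (b K) x) = (LINT x|lebesgue_on K. \<phi> x)"
    by metis
  let ?v = "glue (\<lambda>K. ecr (c K) (a K) (b K))"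
  have d: "ecr_data ?v c a b"
    unfolding ecr_data_def using glue_AE[where q="\<lambda>K. ecr (c K) (a K) (b K)"] by simp
  have V: "?v \<in> V_ECR \<Omega> T"
    unfolding V_ECR_iff[OF d]
    by (rule exI[of _ "\<lambda>F. face_integral F \<phi>"]) (simp add: cab boundary_face_integral[OF \<phi>])
  have "(LINT x|lebesgue_on K. (\<alpha> + \<beta> *\<^sub>R x) \<bullet> grad (ecr (c K) (a K) (b K)) x) =
        (LINT x|lebesgue_on K. (\<alpha> + \<beta> *\<^sub>R x) \<bullet> grad \<phi> x)" if K: "K \<in> T" for K \<alpha> \<beta>
  proof -
    have "(\<Sum>F\<in>facets K. flux K F \<alpha> \<beta> * face_integral F (ecr (c K) (a K) (b K))) =
      (\<Sum>F\<in>facets K. flux K F \<alpha> \<beta> * face_integral F \<phi>)"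
      using cab[OF K] by (intro sum.cong) auto
    then show ?thesis
      unfolding green_simplex_field[OF simplex_T[OF K] Ck_ecr]
        green_simplex_field[OF simplex_T[OF K] test_function_Ck[OF \<phi>]]
      using mean[OF K] by simp
  qed
  then show thesis using that[OF V d mean] by blast
qed

lemma grad_NC_eq:
  fixes u :: "real^'n \<Rightarrow> real^'n"
  assumes u: "\<And>i. ecr_data (\<lambda>x. u x $ i) (c i) (a i) (b i)"
  shows "grad_NC T u = glue (\<lambda>K x. \<chi> i. a i K + (2 * b i K) *\<^sub>R x)"
proof (rule glue_eqI)
  fix x K assume K: "K \<in> T" and x: "x \<in> interior K"
  let ?q = "\<lambda>x. \<chi> i. ecr (c i K) (a i K) (b i K) x"
  have the: "(THE K. K \<in> T \<and> x \<in> interior K) = K"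
    by (rule the_equality) (use K x interior_unique[OF _ K _ x] in blast)+
  have "AE x in lebesgue_on K. \<forall>i. u x $ i = ecr (c i K) (a i K) (b i K) x"
    using ecr_dataD[OF u K] by (simp add: AE_all_countable)
  then have "AE x in lebesgue_on K. u x = ?q x"
    by eventually_elim (simp add: vec_eq_iff)
  then have r: "restr K u y = ?q y" if "y \<in> K" for y
    by (rule restr_eq[OF simplex_T[OF K] _ _ that, rotated]) (intro continuous_on_vec_lambda ecr_continuous)
  have "(?q has_derivative (\<lambda>v. \<chi> i. grad (ecr (c i K) (a i K) (b i K)) x \<bullet> v)) (at x)"
    by (intro frechet_vec Ck_Suc_derivative[OF Ck_ecr])
  then have "(restr K u has_derivative (\<lambda>v. \<chi> i. grad (ecr (c i K) (a i K) (b i K)) x \<bullet> v)) (at x)"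
  proof (rule has_derivative_transform_within_open[where s="interior K"])
    show "?q y = restr K u y" if "y \<in> interior K" for y
      using r[of y] interior_subset[of K] that by auto
  qed (use x in auto)
  then have "frechet_derivative (restr K u) (at x) = (\<lambda>v. \<chi> i. (a i K + (2 * b i K) *\<^sub>R x) \<bullet> v)"
    by (simp add: frechet_derivative_at[symmetric] grad_ecr)
  then have "jacobian (restr K u) (at x) = (\<chi> i. a i K + (2 * b i K) *\<^sub>R x)"
    by (simp add: jacobian_def matrix_def vec_eq_iff inner_axis)
  then show "grad_NC T u x = (\<chi> i. a i K + (2 * b i K) *\<^sub>R x)"
    using K x by (auto simp: grad_NC_def the)
next
  fix x assume "\<forall>K\<in>T. x \<notin> interior K"
  then show "grad_NC T u x = 0" by (auto simp: grad_NC_def)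
qed

section \<open>Piecewise constants that are weakly constant\<close>

lemma pw_const_integrable:
  "integrable (lebesgue_on \<Omega>) (glue (\<lambda>K x. s K :: real))"
  by (rule integrable_pw[where q="\<lambda>K x. s K"]) (simp, rule glue_AE[where q="\<lambda>K x. s K"])

lemma integral_pw_const_times:
  fixes g :: "real^'n \<Rightarrow> real"
  assumes g: "continuous_on UNIV g"
  shows "(LINT x|lebesgue_on \<Omega>. glue (\<lambda>K x. s K) x * g x) = (\<Sum>K\<in>T. s K * (LINT x|lebesgue_on K. g x))"
proof -
  have "(LINT x|lebesgue_on \<Omega>. glue (\<lambda>K x. s K) x * g x) = (\<Sum>K\<in>T. LINT x|lebesgue_on K. s K * g x)"
  proof (rule integral_pw)
    fix K assume K: "K \<in> T"
    show "continuous_on K (\<lambda>x. s K * g x)"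
      by (intro continuous_intros continuous_on_subset[OF g]) auto
    show "AE x in lebesgue_on K. glue (\<lambda>K x. s K) x * g x = s K * g x"
      using glue_AE[OF K, of "\<lambda>K x. s K"] by eventually_elim simp
  qed
  then show ?thesis by (simp only: integral_mult_right_zero)
qed

text \<open>Integration against a bump inside \<open>K\<close> reads off the value on \<open>K\<close>.\<close>

lemma integral_pw_const_bump:
  assumes K: "K \<in> T" and \<rho>: "0 < \<rho>" "ball c \<rho> \<subseteq> interior K"
  shows "(LINT x|lebesgue_on \<Omega>. glue (\<lambda>K x. s K) x * bump \<rho> c x) = s K * (LINT x|lborel. bump \<rho> c x)"
proof -
  have c: "continuous_on UNIV (bump \<rho> c)" by (rule Ck_continuous_on[OF Ck_bump[of 0]])
  have [measurable]: "bump \<rho> c \<in> borel_measurable borel" by (rule borel_measurable_continuous_onI[OF c])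
  have "(LINT x|lebesgue_on K'. bump \<rho> c x) = (if K' = K then LINT x|lborel. bump \<rho> c x else 0)" if K': "K' \<in> T" for K'
  proof -
    have [measurable]: "K' \<in> sets borel" using borel_compact[OF compact_T[OF K']] .
    have "indicator K' x * bump \<rho> c x = (if K' = K then bump \<rho> c x else 0)" for x
    proof (cases "x \<in> ball c \<rho>")
      case True
      then have "x \<in> interior K" using \<rho>(2) by blast
      then have "x \<in> K' \<longleftrightarrow> K' = K" using disjoint_interiors[OF K' K] interior_subset[of K] by blast
      then show ?thesis by (simp add: indicator_def)
    next
      case False
      then show ?thesis using bump_eq_0[OF \<rho>(1) False] by simp
    qed
    then show ?thesis by (subst integral_lebesgue_on_lborel) auto
  qed
  then have "(\<Sum>K'\<in>T. s K' * (LINT x|lebesgue_on K'. bump \<rho> c x)) =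
    (\<Sum>K'\<in>T. if K' = K then s K * (LINT x|lborel. bump \<rho> c x) else 0)"
    by (intro sum.cong) auto
  then show ?thesis unfolding integral_pw_const_times[OF c] using K finite_T by simp
qed

lemma integral_bump:
  fixes c :: "real^'n"
  shows "(LINT x|lborel. bump \<rho> c x) = (LINT x|lborel. bump \<rho> (0 :: real^'n) x)"
proof -
  have c: "bump \<rho> c \<in> borel_measurable borel"
    by (rule borel_measurable_continuous_onI[OF Ck_continuous_on[OF Ck_bump[of 0]]])
  have "(LINT x|lborel. bump \<rho> c x) = (LINT x|distr lborel borel ((+) c). bump \<rho> c x)"
    by (simp add: lborel_distr_plus)
  also have "\<dots> = (LINT x|lborel. bump \<rho> c (c + x))"
    by (rule integral_distr) (use c in auto)
  also have "\<dots> = (LINT x|lborel. bump \<rho> (0 :: real^'n) x)" by (simp add: bump_def)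
  finally show ?thesis .
qed

lemma integral_bump_pos:
  fixes c :: "real^'n"
  assumes "0 < \<rho>"
  shows "0 < (LINT x|lborel. bump \<rho> c x)"
proof -
  let ?K = "cball c \<rho>"
  have cont: "continuous_on S (bump \<rho> c)" for S by (rule Ck_continuous_on[OF Ck_bump[of 0]])
  have "(LINT x|lborel. bump \<rho> c x) = (LINT x|lborel. indicator ?K x * bump \<rho> c x)"
    by (rule Bochner_Integration.integral_cong[OF refl])
       (use bump_eq_0[OF assms, of _ c] ball_subset_cball in \<open>auto simp: indicator_def\<close>)
  also have "\<dots> = (LINT x|lebesgue_on ?K. bump \<rho> c x)"
    by (rule integral_lebesgue_on_lborel[symmetric]) (auto intro: borel_measurable_continuous_onI cont)
  finally have eq: "(LINT x|lborel. bump \<rho> c x) = (LINT x|lebesgue_on ?K. bump \<rho> c x)" .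
  have "(LINT x|lebesgue_on ?K. bump \<rho> c x) \<noteq> 0"
  proof
    assume "(LINT x|lebesgue_on ?K. bump \<rho> c x) = 0"
    then have "bump \<rho> c c = 0"
      by (rule integral_nonneg_continuous_eq_0[OF compact_cball cont bump_nonneg])
         (use assms in \<open>simp add: interior_cball\<close>)
    then show False using bump_pos_iff[OF assms, of c c] assms by simp
  qed
  moreover have "0 \<le> (LINT x|lborel. bump \<rho> c x)" by (simp add: bump_nonneg)
  ultimately show ?thesis unfolding eq by linarith
qed

lemma pw_const_transport:
  assumes \<rho>: "0 < \<rho>"
    and zero: "\<And>r. 0 \<le> r \<Longrightarrow> r \<le> 1 \<Longrightarrow>
      (\<Sum>K\<in>T. s K * (LINT x|lebesgue_on K. e \<bullet> grad (bump \<rho> (c + r *\<^sub>R e)) x)) = 0"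
  shows "(LINT x|lebesgue_on \<Omega>. glue (\<lambda>K x. s K) x * bump \<rho> (c + e) x) =
    (LINT x|lebesgue_on \<Omega>. glue (\<lambda>K x. s K) x * bump \<rho> c x)"
proof (rule bump_transport[OF \<rho> pw_const_integrable])
  fix r :: real assume r: "0 \<le> r" "r \<le> 1"
  have "continuous_on UNIV (\<lambda>x. e \<bullet> grad (bump \<rho> (c + r *\<^sub>R e)) x)"
    by (intro continuous_intros Ck_grad_continuous Ck_bump)
  from integral_pw_const_times[OF this, of s] zero[OF r]
  show "(LINT x|lebesgue_on \<Omega>. glue (\<lambda>K x. s K) x * (e \<bullet> grad (bump \<rho> (c + r *\<^sub>R e)) x)) = 0" by simp
qed

text \<open>By duality: a piecewise constant \<open>w\<close> that is orthogonal to all divergences of Raviart--Thomas fields is zero.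
For a \<open>C\<^sup>1\<close> function \<open>\<phi>\<close> and a vector \<open>e\<close>, let \<open>\<tau>\<close> have the facet fluxes of the field \<open>\<phi> e\<close>. Its net fluxes vanish
because those of \<open>e\<close> do, and the integrals of \<open>div \<tau>\<close> and \<open>e \<bullet> grad \<phi>\<close> over each cell agree. So
\<open>w\<close> is orthogonal to \<open>e \<bullet> grad \<phi>\<close>, without any boundary condition on \<open>\<phi>\<close>. A bump in \<open>K\<close> can therefore be carried
out of \<open>\<Omega>\<close> without a change of its integral against \<open>w\<close>.\<close>

lemma div_surjective:
  assumes orth: "\<And>a b. (\<And>F. F \<in> interior_faces \<Omega> T \<Longrightarrow> netflux a b F = 0) \<Longrightarrow>
      (\<Sum>K\<in>T. w K * (real CARD('n) * b K * vol K)) = 0"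
    and K: "K \<in> T"
  shows "w K = 0"
proof -
  have key: "(\<Sum>K\<in>T. w K * (LINT x|lebesgue_on K. e \<bullet> grad \<phi> x)) = 0" if \<phi>: "Ck (Suc 0) \<phi>" for e \<phi>
  proof -
    have "\<forall>K\<in>T. \<exists>a b. \<forall>F. F facet_of K \<longrightarrow>
       flux K F a b = flux K F e 0 * (face_integral F \<phi> / face_integral F (\<lambda>x. 1))"
    proof
      fix K assume K: "K \<in> T"
      show "\<exists>a b. \<forall>F. F facet_of K \<longrightarrow>
       flux K F a b = flux K F e 0 * (face_integral F \<phi> / face_integral F (\<lambda>x. 1))"
        by (rule RT_unisolvence[OF simplex_T[OF K],
              of "\<lambda>F. flux K F e 0 * (face_integral F \<phi> / face_integral F (\<lambda>x. 1))"]) blast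
    qed
    then obtain a b where ab: "\<And>K F. K \<in> T \<Longrightarrow> F facet_of K \<Longrightarrow>
       flux K F (a K) (b K) = flux K F e 0 * (face_integral F \<phi> / face_integral F (\<lambda>x. 1))"
      by metis
    have "netflux a b F = 0" if F: "F \<in> interior_faces \<Omega> T" for F
    proof -
      have "netflux a b F = netflux (\<lambda>K. e) (\<lambda>K. 0) F * (face_integral F \<phi> / face_integral F (\<lambda>x. 1))"
        unfolding netflux_def sum_distrib_right using ab by (intro sum.cong) auto
      then show ?thesis using netflux_const[OF F, of e] by simp
    qed
    from orth[OF this] have "(\<Sum>K\<in>T. w K * (real CARD('n) * b K * vol K)) = 0" .
    moreover have "real CARD('n) * b K * vol K = (LINT x|lebesgue_on K. e \<bullet> grad \<phi> x)" if K: "K \<in> T" for K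
    proof -
      have g1: "grad (\<lambda>x. 1) x = (0 :: real^'n)" for x by (rule grad_eqI) simp
      have "real CARD('n) * b K * vol K = (LINT x|lebesgue_on K. real CARD('n) * b K * 1)"
        by (simp only: integral_mult_right_zero)
      also have "\<dots> = (\<Sum>F\<in>facets K. flux K F (a K) (b K) * face_integral F (\<lambda>x. 1))"
        using green_simplex[OF simplex_T[OF K] Ck_const[of "Suc 0" 1], of "a K" "b K"] by (simp add: g1)
      also have "\<dots> = (\<Sum>F\<in>facets K. flux K F e 0 * face_integral F \<phi>)"
      proof (rule sum.cong[OF refl])
        fix F assume F: "F \<in> facets K"
        then have "face_integral F (\<lambda>x. 1) \<noteq> 0"
          using face_integral_one_pos[OF simplex_T[OF K], of F] by simp
        then show "flux K F (a K) (b K) * face_integral F (\<lambda>x. 1) = flux K F e 0 * face_integral F \<phi>"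
          using ab[OF K, of F] F by simp
      qed
      also have "\<dots> = (LINT x|lebesgue_on K. e \<bullet> grad \<phi> x)"
        using green_simplex[OF simplex_T[OF K] \<phi>, of e 0] by simp
      finally show ?thesis .
    qed
    ultimately show ?thesis by simp
  qed
  obtain c where c: "c \<in> interior K" using simplex_interior_nonempty[OF simplex_T[OF K]] by blast
  then obtain \<rho> where \<rho>: "\<rho> > 0" "ball c \<rho> \<subseteq> interior K"
    using open_contains_ball open_interior by blast
  obtain B where B: "\<And>x. x \<in> \<Omega> \<Longrightarrow> norm x \<le> B"
    using domain unfolding polytopal_domain_def bounded_iff by blast
  obtain e :: "real^'n" where e: "norm e = norm c + \<bar>B\<bar> + \<rho> + 1"
    using vector_choose_size[of "norm c + \<bar>B\<bar> + \<rho> + 1"] \<rho>(1) by auto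
  have far: "bump \<rho> (c + e) x = 0" if "x \<in> \<Omega>" for x
  proof (rule bump_eq_0[OF \<rho>(1)])
    have "norm e \<le> norm (c + e - x) + norm c + norm x"
      using norm_triangle_ineq4[of "c + e - x" "c - x"] norm_triangle_ineq4[of c x] by simp
    then show "x \<notin> ball (c + e) \<rho>" using B[OF that] e by (simp add: dist_norm)
  qed
  have "w K * (LINT x|lborel. bump \<rho> c x) = (LINT x|lebesgue_on \<Omega>. glue (\<lambda>K x. w K) x * bump \<rho> c x)"
    by (rule integral_pw_const_bump[OF K \<rho>, symmetric])
  also have "\<dots> = (LINT x|lebesgue_on \<Omega>. glue (\<lambda>K x. w K) x * bump \<rho> (c + e) x)"
    by (rule pw_const_transport[OF \<rho>(1), symmetric]) (rule key[OF Ck_bump])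
  also have "\<dots> = (LINT x|lebesgue_on \<Omega>. 0)"
    by (rule Bochner_Integration.integral_cong[OF refl]) (simp add: far)
  finally show ?thesis using integral_bump_pos[OF \<rho>(1), of c] by simp
qed

text \<open>Two cells with a common point \<open>x\<close> in \<open>\<Omega>\<close> carry the same value: a small bump can be moved from one to the other within
a ball around \<open>x\<close>. So the unions of the cells with equal values are disjoint in \<open>\<Omega>\<close>; they are closed
and finite in number, and \<open>\<Omega>\<close> is connected.\<close>

lemma weak_grad_zero_const:
  assumes zero: "\<And>e \<phi>. \<phi> \<in> test_functions \<Omega> \<Longrightarrow> (\<Sum>K\<in>T. s K * (LINT x|lebesgue_on K. e \<bullet> grad \<phi> x)) = 0"
    and K: "K1 \<in> T" "K2 \<in> T"
  shows "s K1 = s K2"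
proof -
  have local: "s K = s K'" if x: "x \<in> \<Omega>" "x \<in> K" "x \<in> K'" and K: "K \<in> T" "K' \<in> T" for x K K'
  proof -
    obtain R where R: "R > 0" "cball x R \<subseteq> \<Omega>" using open_contains_cball open_\<Omega> x(1) by blast
    have near: "\<exists>y. y \<in> interior K \<and> dist x y < R / 2" if "x \<in> K" "K \<in> T" for K
    proof -
      have "x \<in> closure (interior K)" using simplex_interior_nonempty(2)[OF simplex_T[OF that(2)]] that(1) by simp
      then show ?thesis using R(1) closure_approachable[of x "interior K"]
        by (metis dist_commute half_gt_zero)
    qed
    obtain y where y: "y \<in> interior K" "dist x y < R / 2" using near[OF x(2) K(1)] by blast
    obtain y' where y': "y' \<in> interior K'" "dist x y' < R / 2" using near[OF x(3) K(2)] by blast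
    obtain r1 where r1: "r1 > 0" "ball y r1 \<subseteq> interior K" using y(1) open_contains_ball open_interior by blast
    obtain r2 where r2: "r2 > 0" "ball y' r2 \<subseteq> interior K'" using y'(1) open_contains_ball open_interior by blast
    define \<rho> where "\<rho> = min (min r1 r2) (R / 2)"
    have \<rho>: "\<rho> > 0" "\<rho> \<le> r1" "\<rho> \<le> r2" "\<rho> \<le> R / 2" using r1 r2 R by (auto simp: \<rho>_def)
    have "s K * (LINT z|lborel. bump \<rho> y z) = (LINT z|lebesgue_on \<Omega>. glue (\<lambda>K x. s K) z * bump \<rho> y z)"
      by (rule integral_pw_const_bump[OF K(1) \<rho>(1), symmetric]) (use r1(2) \<rho>(2) in auto)
    also have "\<dots> = (LINT z|lebesgue_on \<Omega>. glue (\<lambda>K x. s K) z * bump \<rho> (y + (y' - y)) z)"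
    proof (rule pw_const_transport[OF \<rho>(1), symmetric])
      fix r :: real assume r: "0 \<le> r" "r \<le> 1"
      have "y + r *\<^sub>R (y' - y) \<in> ball x (R / 2)"
        using convexD_alt[OF convex_ball, of y x "R / 2" y' r] y y' r by (simp add: algebra_simps)
      then have "cball (y + r *\<^sub>R (y' - y)) \<rho> \<subseteq> cball x R"
      proof (intro subsetI)
        fix z assume "z \<in> cball (y + r *\<^sub>R (y' - y)) \<rho>" "y + r *\<^sub>R (y' - y) \<in> ball x (R / 2)"
        then show "z \<in> cball x R"
          using dist_triangle[of x z "y + r *\<^sub>R (y' - y)"] \<rho>(4) by simp
      qed
      then show "(\<Sum>K\<in>T. s K * (LINT z|lebesgue_on K. (y' - y) \<bullet> grad (bump \<rho> (y + r *\<^sub>R (y' - y))) z)) = 0"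
        using R(2) by (intro zero bump_test_function[OF \<rho>(1)]) auto
    qed
    also have "\<dots> = s K' * (LINT z|lborel. bump \<rho> (y + (y' - y)) z)"
      by (rule integral_pw_const_bump[OF K(2) \<rho>(1)]) (use r2(2) \<rho>(3) in auto)
    finally show ?thesis
      using integral_bump_pos[OF \<rho>(1), of "0 :: real^'n"] unfolding integral_bump[of \<rho> y] integral_bump[of \<rho> "y + (y' - y)"]
      by simp
  qed
  define A where "A = \<Union>{K\<in>T. s K = s K1}"
  define B where "B = \<Union>{K\<in>T. s K \<noteq> s K1}"
  have "closed (\<Union>{K\<in>T. P K})" for P
    by (rule closed_Union) (use finite_T compact_imp_closed[OF compact_T] in auto)
  then have cl: "closed A" "closed B" by (simp_all add: A_def B_def)
  have "\<Omega> \<subseteq> \<Union>T" using closure_subset[of \<Omega>] Union_T by simp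
  moreover have "\<Union>T = A \<union> B" unfolding A_def B_def by blast
  ultimately have "\<Omega> \<subseteq> A \<union> B" by simp
  moreover have "A \<inter> B \<inter> \<Omega> = {}"
  proof (rule ccontr)
    assume "A \<inter> B \<inter> \<Omega> \<noteq> {}"
    then obtain x K K' where "x \<in> \<Omega>" "x \<in> K" "x \<in> K'" "K \<in> T" "K' \<in> T" "s K = s K1" "s K' \<noteq> s K1"
      unfolding A_def B_def by blast
    then show False using local[of x K K'] by simp
  qed
  ultimately have "A \<inter> \<Omega> = {} \<or> B \<inter> \<Omega> = {}"
    using connected_closed[of \<Omega>] connected_\<Omega> cl by blast
  moreover have "A \<inter> \<Omega> \<noteq> {}"
    using simplex_interior_nonempty(1)[OF simplex_T[OF K(1)]] interior_subset_\<Omega>[OF K(1)] interior_subset[of K1] K(1)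
    by (auto simp: A_def)
  ultimately have "B \<inter> \<Omega> = {}" by blast
  obtain x where "x \<in> interior K2" using simplex_interior_nonempty(1)[OF simplex_T[OF K(2)]] by blast
  then have "x \<in> \<Omega>" "x \<in> K2" using interior_subset_\<Omega>[OF K(2)] interior_subset[of K2] by blast+
  then have "x \<notin> B" using \<open>B \<inter> \<Omega> = {}\<close> by blast
  then show ?thesis using K(2) \<open>x \<in> K2\<close> unfolding B_def by force
qed

end

section \<open>Equality of the two discretizations\<close>

lemma mat1_inner: "(mat 1 :: real^'n^'n) \<bullet> B = trace B"
proof -
  have "(mat 1 :: real^'n^'n) $ i \<bullet> B $ i = B $ i $ i" for i
  proof -
    have "(mat 1 :: real^'n^'n) $ i = axis i 1" by (simp add: vec_eq_iff mat_def axis_def)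
    then show ?thesis by (simp add: inner_axis')
  qed
  then show ?thesis by (simp add: inner_vec_def[of "mat 1 :: real^'n^'n"] trace_def)
qed

lemma inner_rows: "A \<bullet> B = (\<Sum>i\<in>UNIV. A $ i \<bullet> B $ i)" for A B :: "real^'n^'n"
  by (rule inner_vec_def)

lemma trace_scaleR: "trace (r *\<^sub>R A) = r * trace (A :: real^'n^'n)"
  by (simp add: trace_def sum_distrib_left)

lemma dev_inner: "dev A \<bullet> dev B = A \<bullet> B - trace A * (1 / real CARD('n) * trace B)"
  for A B :: "real^'n^'n"
proof -
  have "A \<bullet> mat 1 = trace A" using mat1_inner[of A] by (simp add: inner_commute)
  moreover have "(mat 1 :: real^'n^'n) \<bullet> mat 1 = real CARD('n)" by (simp add: mat1_inner trace_I)
  ultimately show ?thesis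
    by (simp add: dev_def inner_diff_left inner_diff_right mat1_inner)
qed

lemma dev_add_mat: "dev (A + r *\<^sub>R mat 1) = dev (A :: real^'n^'n)"
  by (simp add: dev_def trace_add trace_scaleR trace_I add_divide_distrib scaleR_add_left)

lemma dev_diff: "dev (A - B) = dev A - dev (B :: real^'n^'n)"
  by (simp add: dev_def trace_sub diff_divide_distrib scaleR_diff_left)

lemma continuous_on_trace:
  "continuous_on S G \<Longrightarrow> continuous_on S (\<lambda>x. trace (G x :: real^'n^'n))"
  unfolding trace_def by (intro continuous_intros)

lemma continuous_on_dev:
  "continuous_on S G \<Longrightarrow> continuous_on S (\<lambda>x. dev (G x :: real^'n^'n))"
  unfolding dev_def by (intro continuous_intros continuous_on_trace) auto

context meshed
begin

lemma comps_ecr_data: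
  assumes "u \<in> comps (V_ECR \<Omega> T)"
  obtains c a b where "\<And>i. ecr_data (\<lambda>x. u x $ i) (c i) (a i) (b i)"
proof -
  have "\<forall>i. \<exists>c a b. ecr_data (\<lambda>x. u x $ i) c a b"
  proof
    fix i
    have "(\<lambda>x. u x $ i) \<in> V_ECR \<Omega> T" using assms by (simp add: comps_def)
    then show "\<exists>c a b. ecr_data (\<lambda>x. u x $ i) c a b" by (rule ecr_data_exists) blast
  qed
  then show thesis using that by metis
qed

lemma comps_rt_data:
  assumes "\<tau> \<in> comps (RT \<Omega> T)"
  obtains a b where "\<And>i. rt_data (\<lambda>x. \<tau> x $ i) (a i) (b i)"
proof -
  have "\<forall>i. \<exists>a b. rt_data (\<lambda>x. \<tau> x $ i) a b"
  proof
    fix i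
    have "(\<lambda>x. \<tau> x $ i) \<in> piecewise T RT_shape" using assms by (simp add: comps_def RT_def)
    then show "\<exists>a b. rt_data (\<lambda>x. \<tau> x $ i) a b" by (rule rt_data_exists) blast
  qed
  then show thesis using that by metis
qed

lemma piecewise_const_data:
  assumes "q \<in> piecewise T P0"
  obtains Q where "\<And>K. K \<in> T \<Longrightarrow> AE x in lebesgue_on K. q x = Q K"
proof -
  have "\<forall>K\<in>T. \<exists>Q. AE x in lebesgue_on K. q x = Q"
    using assms by (fastforce simp: piecewise_def P0_def)
  then obtain Q where "\<forall>K\<in>T. AE x in lebesgue_on K. q x = Q K" by metis
  then show thesis using that[of Q] by simp
qed

lemma U_RT_iff: "v \<in> U_RT \<Omega> T \<longleftrightarrow> (\<exists>Q. \<forall>K\<in>T. AE x in lebesgue_on K. v x = Q K)"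
proof
  assume "v \<in> U_RT \<Omega> T"
  then have "v \<in> piecewise T P0" by (simp add: U_RT_def)
  then obtain Q where "\<And>K. K \<in> T \<Longrightarrow> AE x in lebesgue_on K. v x = Q K" by (rule piecewise_const_data) blast
  then show "\<exists>Q. \<forall>K\<in>T. AE x in lebesgue_on K. v x = Q K" by (intro exI[of _ Q]) simp
next
  assume "\<exists>Q. \<forall>K\<in>T. AE x in lebesgue_on K. v x = Q K"
  then obtain Q where Q: "\<And>K. K \<in> T \<Longrightarrow> AE x in lebesgue_on K. v x = Q K" by blast
  have "v \<in> L2 \<Omega>" by (rule L2_pw[where q="\<lambda>K x. Q K"]) (use Q in auto)
  moreover have "v \<in> piecewise T P0"
    unfolding piecewise_def mem_Collect_eq
  proof
    fix K assume "K \<in> T"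
    from Q[OF this] show "\<exists>p\<in>P0. AE x in lebesgue_on K. v x = p x"
      by (intro bexI[of _ "\<lambda>x. Q K"]) (auto simp: P0_def)
  qed
  ultimately show "v \<in> U_RT \<Omega> T" by (simp add: U_RT_def)
qed

lemma comps_U_RT_data:
  assumes "l \<in> comps (U_RT \<Omega> T)"
  obtains L where "\<And>K. K \<in> T \<Longrightarrow> AE x in lebesgue_on K. l x = (L K :: real^'n)"
proof -
  have "\<forall>i. \<exists>Q. \<forall>K\<in>T. AE x in lebesgue_on K. l x $ i = Q K"
    using assms unfolding comps_def U_RT_iff by blast
  then obtain Q where Q: "\<And>i K. K \<in> T \<Longrightarrow> AE x in lebesgue_on K. l x $ i = Q i K" by metis
  have "AE x in lebesgue_on K. l x = (\<chi> i. Q i K)" if K: "K \<in> T" for K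
  proof -
    have "AE x in lebesgue_on K. \<forall>i. l x $ i = Q i K"
      unfolding AE_all_countable using Q[OF K] by blast
    then show ?thesis by eventually_elim (simp add: vec_eq_iff)
  qed
  then show thesis by (rule that)
qed

lemma comps_U_RT_I:
  assumes "\<And>K. K \<in> T \<Longrightarrow> AE x in lebesgue_on K. l x = (L K :: real^'n)"
  shows "l \<in> comps (U_RT \<Omega> T)"
  unfolding comps_def mem_Collect_eq U_RT_iff
proof (rule allI)
  fix i
  have "AE x in lebesgue_on K. l x $ i = L K $ i" if "K \<in> T" for K
    using assms[OF that] by eventually_elim simp
  then show "\<exists>Q. \<forall>K\<in>T. AE x in lebesgue_on K. l x $ i = Q K"
    by (intro exI[of _ "\<lambda>K. L K $ i"]) simp
qed

text \<open>The weak divergence enters only through its means on the cells, which do not depend on the representative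
that \<open>wdiv\<close> picks.\<close>

lemma l2_inner_row_div:
  assumes \<tau>: "\<tau> \<in> comps (RT \<Omega> T)" and ab: "\<And>i. rt_data (\<lambda>x. \<tau> x $ i) (a i) (b i)"
    and l: "\<And>K. K \<in> T \<Longrightarrow> AE x in lebesgue_on K. l x = L K"
  shows "l2_inner \<Omega> l (row_div \<Omega> \<tau>) = (\<Sum>K\<in>T. \<Sum>i\<in>UNIV. L K $ i * (real CARD('n) * b i K * vol K))"
proof -
  have R: "(\<lambda>x. \<tau> x $ i) \<in> RT \<Omega> T" for i using \<tau> by (simp add: comps_def)
  have int: "integrable (lebesgue_on K) (wdiv \<Omega> (\<lambda>y. \<tau> y $ i))" if "K \<in> T" for i K
    by (rule integrable_mesh_cell[OF L2_integrable[OF wdiv_RT(1)[OF R]] that])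
  have "l2_inner \<Omega> l (row_div \<Omega> \<tau>) = (\<Sum>K\<in>T. LINT x|lebesgue_on K. (\<Sum>i\<in>UNIV. L K $ i * wdiv \<Omega> (\<lambda>y. \<tau> y $ i) x))"
    unfolding l2_inner_def
  proof (rule integral_cells)
    fix K assume K: "K \<in> T"
    show "integrable (lebesgue_on K) (\<lambda>x. \<Sum>i\<in>UNIV. L K $ i * wdiv \<Omega> (\<lambda>y. \<tau> y $ i) x)"
      by (intro Bochner_Integration.integrable_sum integrable_mult_right int K)
    show "AE x in lebesgue_on K. l x \<bullet> row_div \<Omega> \<tau> x = (\<Sum>i\<in>UNIV. L K $ i * wdiv \<Omega> (\<lambda>y. \<tau> y $ i) x)"
      using l[OF K] by eventually_elim (simp add: inner_vec_def row_div_def)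
  qed
  also have "\<dots> = (\<Sum>K\<in>T. \<Sum>i\<in>UNIV. L K $ i * (real CARD('n) * b i K * vol K))"
  proof (rule sum.cong[OF refl])
    fix K assume K: "K \<in> T"
    have "(LINT x|lebesgue_on K. (\<Sum>i\<in>UNIV. L K $ i * wdiv \<Omega> (\<lambda>y. \<tau> y $ i) x)) =
      (\<Sum>i\<in>UNIV. LINT x|lebesgue_on K. L K $ i * wdiv \<Omega> (\<lambda>y. \<tau> y $ i) x)"
      by (rule Bochner_Integration.integral_sum) (intro integrable_mult_right int K)
    then show "(LINT x|lebesgue_on K. (\<Sum>i\<in>UNIV. L K $ i * wdiv \<Omega> (\<lambda>y. \<tau> y $ i) x)) =
      (\<Sum>i\<in>UNIV. L K $ i * (real CARD('n) * b i K * vol K))"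
      using integral_wdiv_cell[OF ab R K] by (simp only: integral_mult_right_zero)
  qed
  finally show ?thesis .
qed

lemma integral_const_cell: "K \<in> T \<Longrightarrow> (LINT x|lebesgue_on K. (r :: real)) = r * vol K"
  using integral_mult_right_zero[of "lebesgue_on K" r "\<lambda>x. 1"] by simp

lemma L2_proj_data:
  assumes v: "v \<in> L2 \<Omega>"
  obtains W where "\<And>K. K \<in> T \<Longrightarrow> AE x in lebesgue_on K. L2_proj \<Omega> (U_RT \<Omega> T) v x = W K"
    "\<And>K. K \<in> T \<Longrightarrow> W K * vol K = (LINT x|lebesgue_on K. v x)"
proof -
  have vi: "integrable (lebesgue_on K) v" if "K \<in> T" for K
    by (rule integrable_mesh_cell[OF L2_integrable[OF v] that])
  have inner: "l2_inner \<Omega> (\<lambda>x. v x - w x) q =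
      (\<Sum>K\<in>T. ((LINT x|lebesgue_on K. v x) - W K * vol K) * Q K)"
    if w: "\<And>K. K \<in> T \<Longrightarrow> AE x in lebesgue_on K. w x = W K"
      and q: "\<And>K. K \<in> T \<Longrightarrow> AE x in lebesgue_on K. q x = Q K" for w W q Q
  proof -
    have c: "integrable (lebesgue_on K) (\<lambda>x. W K)" if "K \<in> T" for K
      by (rule integrable_lebesgue_on_compact[OF compact_T[OF that]]) simp
    have "l2_inner \<Omega> (\<lambda>x. v x - w x) q = (\<Sum>K\<in>T. LINT x|lebesgue_on K. (v x - W K) * Q K)"
      unfolding l2_inner_def
    proof (rule integral_cells)
      fix K assume K: "K \<in> T"
      show "integrable (lebesgue_on K) (\<lambda>x. (v x - W K) * Q K)"
        by (intro integrable_mult_left Bochner_Integration.integrable_diff vi c K)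
      show "AE x in lebesgue_on K. (v x - w x) \<bullet> q x = (v x - W K) * Q K"
        using w[OF K] q[OF K] by eventually_elim simp
    qed
    also have "\<dots> = (\<Sum>K\<in>T. ((LINT x|lebesgue_on K. v x) - W K * vol K) * Q K)"
    proof (rule sum.cong[OF refl])
      fix K assume K: "K \<in> T"
      show "(LINT x|lebesgue_on K. (v x - W K) * Q K) = ((LINT x|lebesgue_on K. v x) - W K * vol K) * Q K"
        using Bochner_Integration.integral_diff[OF vi[OF K] c[OF K]] integral_const_cell[OF K, of "W K"]
        by (simp only: integral_mult_left_zero)
    qed
    finally show ?thesis .
  qed
  let ?P = "\<lambda>w. w \<in> U_RT \<Omega> T \<and> (\<forall>q\<in>U_RT \<Omega> T. l2_inner \<Omega> (\<lambda>x. v x - w x) q = 0)"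
  define W0 where "W0 K = (LINT x|lebesgue_on K. v x) / vol K" for K
  have vol: "vol K \<noteq> 0" if "K \<in> T" for K using simplex_measure_pos[OF simplex_T[OF that]] by simp
  have g: "AE x in lebesgue_on K. glue (\<lambda>K x. W0 K) x = W0 K" if "K \<in> T" for K
    using glue_AE[OF that, of "\<lambda>K x. W0 K"] .
  have W0: "?P (glue (\<lambda>K x. W0 K))"
  proof
    show "glue (\<lambda>K x. W0 K) \<in> U_RT \<Omega> T" unfolding U_RT_iff using g by blast
    show "\<forall>q\<in>U_RT \<Omega> T. l2_inner \<Omega> (\<lambda>x. v x - glue (\<lambda>K x. W0 K) x) q = 0"
    proof
      fix q assume "q \<in> U_RT \<Omega> T"
      then obtain Q where "\<And>K. K \<in> T \<Longrightarrow> AE x in lebesgue_on K. q x = Q K"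
        unfolding U_RT_iff by blast
      from inner[OF g this] show "l2_inner \<Omega> (\<lambda>x. v x - glue (\<lambda>K x. W0 K) x) q = 0"
        using vol by (simp add: W0_def)
    qed
  qed
  have P: "?P (L2_proj \<Omega> (U_RT \<Omega> T) v)"
    unfolding L2_proj_def by (rule someI[of ?P, OF W0])
  then obtain W where W: "\<And>K. K \<in> T \<Longrightarrow> AE x in lebesgue_on K. L2_proj \<Omega> (U_RT \<Omega> T) v x = W K"
    unfolding U_RT_iff by blast
  have "W K * vol K = (LINT x|lebesgue_on K. v x)" if K: "K \<in> T" for K
  proof -
    define Q where "Q K' = (if K' = K then 1 else 0 :: real)" for K'
    have q: "AE x in lebesgue_on K'. glue (\<lambda>K x. Q K) x = Q K'" if "K' \<in> T" for K'
      using glue_AE[OF that, of "\<lambda>K x. Q K"] .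
    have "glue (\<lambda>K x. Q K) \<in> U_RT \<Omega> T" unfolding U_RT_iff using q by blast
    then have "(\<Sum>K\<in>T. ((LINT x|lebesgue_on K. v x) - W K * vol K) * Q K) = 0"
      using P inner[OF W q] by simp
    also have "(\<Sum>K\<in>T. ((LINT x|lebesgue_on K. v x) - W K * vol K) * Q K) =
       (\<Sum>K'\<in>T. if K' = K then (LINT x|lebesgue_on K. v x) - W K * vol K else 0)"
      by (intro sum.cong) (auto simp: Q_def)
    finally show ?thesis using K finite_T by simp
  qed
  then show thesis using that W by blast
qed

lemma ecr_data_L2: "ecr_data v c a b \<Longrightarrow> v \<in> L2 \<Omega>"
  by (rule L2_pw[where q="\<lambda>K. ecr (c K) (a K) (b K)"]) (auto intro: ecr_continuous dest: ecr_dataD)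

lemma ecr_data_integral:
  assumes "ecr_data v c a b" "K \<in> T"
  shows "(LINT x|lebesgue_on K. v x) = (LINT x|lebesgue_on K. ecr (c K) (a K) (b K) x)"
  by (rule lebesgue_on_cong_AE(2)[OF sets_T[OF assms(2)] _ ecr_dataD[OF assms]])
     (rule Ck_measurable_lebesgue_on[OF Ck_ecr[of 0]])

lemma Pi0_data:
  assumes u: "\<And>i. ecr_data (\<lambda>x. u x $ i) (c i) (a i) (b i)"
  obtains W where "\<And>K. K \<in> T \<Longrightarrow> AE x in lebesgue_on K. Pi0 \<Omega> T u x = (W K :: real^'n)"
    "\<And>K i. K \<in> T \<Longrightarrow> W K $ i * vol K = (LINT x|lebesgue_on K. ecr (c i K) (a i K) (b i K) x)"
proof -
  have "\<forall>i. \<exists>W. \<forall>K\<in>T. (AE x in lebesgue_on K. L2_proj \<Omega> (U_RT \<Omega> T) (\<lambda>y. u y $ i) x = W K) \<and>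
      W K * vol K = (LINT x|lebesgue_on K. u x $ i)"
  proof
    fix i
    show "\<exists>W. \<forall>K\<in>T. (AE x in lebesgue_on K. L2_proj \<Omega> (U_RT \<Omega> T) (\<lambda>y. u y $ i) x = W K) \<and>
      W K * vol K = (LINT x|lebesgue_on K. u x $ i)"
      by (rule L2_proj_data[OF ecr_data_L2[OF u[of i]]]) blast
  qed
  then obtain W where W: "\<And>i K. K \<in> T \<Longrightarrow> AE x in lebesgue_on K. L2_proj \<Omega> (U_RT \<Omega> T) (\<lambda>y. u y $ i) x = W i K"
    "\<And>i K. K \<in> T \<Longrightarrow> W i K * vol K = (LINT x|lebesgue_on K. u x $ i)" by metis
  have "AE x in lebesgue_on K. Pi0 \<Omega> T u x = (\<chi> i. W i K)" if K: "K \<in> T" for K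
  proof -
    have "AE x in lebesgue_on K. \<forall>i. L2_proj \<Omega> (U_RT \<Omega> T) (\<lambda>y. u y $ i) x = W i K"
      unfolding AE_all_countable using W(1)[OF K] by blast
    then show ?thesis by eventually_elim (simp add: vec_eq_iff Pi0_def)
  qed
  moreover have "(\<chi> i. W i K) $ i * vol K = (LINT x|lebesgue_on K. ecr (c i K) (a i K) (b i K) x)" if "K \<in> T" for K i
    using W(2)[OF that] ecr_data_integral[OF u that] by simp
  ultimately show thesis using that[of "\<lambda>K. \<chi> i. W i K"] by blast
qed

lemma rt_data_mat:
  assumes "\<And>i. rt_data (\<lambda>x. \<tau> x $ i) (\<alpha> i) (\<beta> i)" and K: "K \<in> T"
  shows "AE x in lebesgue_on K. \<tau> x = (\<chi> i. \<alpha> i K + \<beta> i K *\<^sub>R x)"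
proof -
  have "AE x in lebesgue_on K. \<forall>i. \<tau> x $ i = \<alpha> i K + \<beta> i K *\<^sub>R x"
    unfolding AE_all_countable using rt_dataD[OF assms(1) K] by blast
  then show ?thesis by eventually_elim (simp add: vec_eq_iff)
qed

lemma continuous_on_rt_mat: "continuous_on S (\<lambda>x. \<chi> i. \<alpha> i + \<beta> i *\<^sub>R (x::real^'n) :: real^'n^'n)"
  by (intro continuous_on_vec_lambda continuous_intros)

lemma netflux_of_RT:
  "rt_data \<tau> a b \<Longrightarrow> \<tau> \<in> RT \<Omega> T \<Longrightarrow> F \<in> interior_faces \<Omega> T \<Longrightarrow> netflux a b F = 0"
  using RT_iff by blast

text \<open>The pointwise identity \<open>dev G \<bullet> dev H = G \<bullet> H - tr G tr H / n\<close> splits the left-hand side. Row by row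
\<open>(\<nabla>\<^sub>N\<^sub>C u\<^sub>i, \<tau>\<^sub>i) = - (u\<^sub>i, div \<tau>\<^sub>i)\<close>, and \<open>u\<^sub>i\<close> may be replaced by its cell means because \<open>div \<tau>\<^sub>i\<close> is constant on
each cell.\<close>

lemma grad_NC_dev_pairing:
  assumes u: "u \<in> comps (V_ECR \<Omega> T)" "\<And>i. ecr_data (\<lambda>x. u x $ i) (c i) (a i) (b i)"
    and \<tau>: "\<tau> \<in> comps (RT \<Omega> T)"
  shows "l2_inner \<Omega> (\<lambda>x. dev (grad_NC T u x)) (\<lambda>x. dev (\<tau> x)) + l2_inner \<Omega> (Pi0 \<Omega> T u) (row_div \<Omega> \<tau>)
    = - l2_inner \<Omega> (div_NC T u) (\<lambda>x. 1 / real CARD('n) * trace (\<tau> x))"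
proof -
  obtain \<alpha> \<beta> where r: "\<And>i. rt_data (\<lambda>x. \<tau> x $ i) (\<alpha> i) (\<beta> i)" by (rule comps_rt_data[OF \<tau>]) blast
  obtain W where W: "\<And>K. K \<in> T \<Longrightarrow> AE x in lebesgue_on K. Pi0 \<Omega> T u x = W K"
    "\<And>K i. K \<in> T \<Longrightarrow> W K $ i * vol K = (LINT x|lebesgue_on K. ecr (c i K) (a i K) (b i K) x)"
    by (rule Pi0_data[OF u(2)]) blast
  define G where "G K x = (\<chi> i. a i K + (2 * b i K) *\<^sub>R x)" for K x
  define H where "H K x = (\<chi> i. \<alpha> i K + \<beta> i K *\<^sub>R x)" for K x
  have Gc: "continuous_on S (G K)" and Hc: "continuous_on S (H K)" for S K
    unfolding G_def[abs_def] H_def[abs_def] by (rule continuous_on_rt_mat)+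
  have Gae: "AE x in lebesgue_on K. grad_NC T u x = G K x" if "K \<in> T" for K
    using glue_AE[OF that, of G] grad_NC_eq[OF u(2)] unfolding G_def[abs_def] by simp
  have Hae: "AE x in lebesgue_on K. \<tau> x = H K x" if "K \<in> T" for K
    using rt_data_mat[OF r that] unfolding H_def .
  have "l2_inner \<Omega> (\<lambda>x. dev (grad_NC T u x)) (\<lambda>x. dev (\<tau> x)) =
      (\<Sum>K\<in>T. LINT x|lebesgue_on K. dev (G K x) \<bullet> dev (H K x))"
    by (rule l2_inner_pw[OF AE_arg_cong AE_arg_cong]) (auto intro: Gae Hae continuous_on_dev Gc Hc)
  also have "\<dots> = (\<Sum>K\<in>T. (\<Sum>i\<in>UNIV. LINT x|lebesgue_on K. (\<alpha> i K + \<beta> i K *\<^sub>R x) \<bullet> (a i K + (2 * b i K) *\<^sub>R x))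
      - (LINT x|lebesgue_on K. trace (G K x) * (1 / real CARD('n) * trace (H K x))))"
  proof (rule sum.cong[OF refl])
    fix K assume K: "K \<in> T"
    have i1: "integrable (lebesgue_on K) (\<lambda>x. (\<alpha> i K + \<beta> i K *\<^sub>R x) \<bullet> (a i K + (2 * b i K) *\<^sub>R x))" for i
      by (intro integrable_lebesgue_on_compact[OF compact_T[OF K]] continuous_intros)
    have i2: "integrable (lebesgue_on K) (\<lambda>x. trace (G K x) * (1 / real CARD('n) * trace (H K x)))"
      by (intro integrable_lebesgue_on_compact[OF compact_T[OF K]] continuous_intros continuous_on_trace Gc Hc)
    have "(LINT x|lebesgue_on K. dev (G K x) \<bullet> dev (H K x)) =
      (LINT x|lebesgue_on K. (\<Sum>i\<in>UNIV. (\<alpha> i K + \<beta> i K *\<^sub>R x) \<bullet> (a i K + (2 * b i K) *\<^sub>R x))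
        - trace (G K x) * (1 / real CARD('n) * trace (H K x)))"
    proof (rule Bochner_Integration.integral_cong[OF refl])
      fix x
      have "G K x \<bullet> H K x = (\<Sum>i\<in>UNIV. (\<alpha> i K + \<beta> i K *\<^sub>R x) \<bullet> (a i K + (2 * b i K) *\<^sub>R x))"
        unfolding inner_rows G_def H_def vec_lambda_beta by (intro sum.cong refl inner_commute)
      then show "dev (G K x) \<bullet> dev (H K x) = (\<Sum>i\<in>UNIV. (\<alpha> i K + \<beta> i K *\<^sub>R x) \<bullet> (a i K + (2 * b i K) *\<^sub>R x))
        - trace (G K x) * (1 / real CARD('n) * trace (H K x))"
        unfolding dev_inner by simp
    qed
    also have "\<dots> = (LINT x|lebesgue_on K. (\<Sum>i\<in>UNIV. (\<alpha> i K + \<beta> i K *\<^sub>R x) \<bullet> (a i K + (2 * b i K) *\<^sub>R x)))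
        - (LINT x|lebesgue_on K. trace (G K x) * (1 / real CARD('n) * trace (H K x)))"
      by (rule Bochner_Integration.integral_diff[OF Bochner_Integration.integrable_sum[OF i1] i2])
    also have "(LINT x|lebesgue_on K. (\<Sum>i\<in>UNIV. (\<alpha> i K + \<beta> i K *\<^sub>R x) \<bullet> (a i K + (2 * b i K) *\<^sub>R x)))
        = (\<Sum>i\<in>UNIV. LINT x|lebesgue_on K. (\<alpha> i K + \<beta> i K *\<^sub>R x) \<bullet> (a i K + (2 * b i K) *\<^sub>R x))"
      by (rule Bochner_Integration.integral_sum[OF i1])
    finally show "(LINT x|lebesgue_on K. dev (G K x) \<bullet> dev (H K x)) =
       (\<Sum>i\<in>UNIV. LINT x|lebesgue_on K. (\<alpha> i K + \<beta> i K *\<^sub>R x) \<bullet> (a i K + (2 * b i K) *\<^sub>R x))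
      - (LINT x|lebesgue_on K. trace (G K x) * (1 / real CARD('n) * trace (H K x)))" .
  qed
  also have "\<dots> = (\<Sum>i\<in>UNIV. \<Sum>K\<in>T. LINT x|lebesgue_on K. (\<alpha> i K + \<beta> i K *\<^sub>R x) \<bullet> (a i K + (2 * b i K) *\<^sub>R x))
      - (\<Sum>K\<in>T. LINT x|lebesgue_on K. trace (G K x) * (1 / real CARD('n) * trace (H K x)))"
    unfolding sum_subtractf by (subst sum.swap) (rule refl)
  also have "(\<Sum>i\<in>UNIV. \<Sum>K\<in>T. LINT x|lebesgue_on K. (\<alpha> i K + \<beta> i K *\<^sub>R x) \<bullet> (a i K + (2 * b i K) *\<^sub>R x))
      = (\<Sum>i\<in>UNIV. - (\<Sum>K\<in>T. real CARD('n) * \<beta> i K * (LINT x|lebesgue_on K. ecr (c i K) (a i K) (b i K) x)))"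
  proof (rule sum.cong[OF refl])
    fix i
    have V: "(\<lambda>x. u x $ i) \<in> V_ECR \<Omega> T" and R: "(\<lambda>x. \<tau> x $ i) \<in> RT \<Omega> T"
      using u(1) \<tau> by (simp_all add: comps_def)
    show "(\<Sum>K\<in>T. LINT x|lebesgue_on K. (\<alpha> i K + \<beta> i K *\<^sub>R x) \<bullet> (a i K + (2 * b i K) *\<^sub>R x))
      = - (\<Sum>K\<in>T. real CARD('n) * \<beta> i K * (LINT x|lebesgue_on K. ecr (c i K) (a i K) (b i K) x))"
      by (rule green_ECR_RT[OF u(2) V netflux_of_RT[OF r R]])
  qed
  also have "\<dots> = - (\<Sum>K\<in>T. \<Sum>i\<in>UNIV. W K $ i * (real CARD('n) * \<beta> i K * vol K))"
  proof -
    have "(\<Sum>i\<in>UNIV. \<Sum>K\<in>T. real CARD('n) * \<beta> i K * (LINT x|lebesgue_on K. ecr (c i K) (a i K) (b i K) x))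
      = (\<Sum>i\<in>UNIV. \<Sum>K\<in>T. W K $ i * (real CARD('n) * \<beta> i K * vol K))"
      by (intro sum.cong refl) (simp add: W(2)[symmetric])
    also have "\<dots> = (\<Sum>K\<in>T. \<Sum>i\<in>UNIV. W K $ i * (real CARD('n) * \<beta> i K * vol K))"
      by (rule sum.swap)
    finally show ?thesis by (simp add: sum_negf)
  qed
  also have "(\<Sum>K\<in>T. \<Sum>i\<in>UNIV. W K $ i * (real CARD('n) * \<beta> i K * vol K)) = l2_inner \<Omega> (Pi0 \<Omega> T u) (row_div \<Omega> \<tau>)"
    by (rule l2_inner_row_div[OF \<tau> r W(1), symmetric])
  also have "(\<Sum>K\<in>T. LINT x|lebesgue_on K. trace (G K x) * (1 / real CARD('n) * trace (H K x))) =
      l2_inner \<Omega> (div_NC T u) (\<lambda>x. 1 / real CARD('n) * trace (\<tau> x))"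
    unfolding div_NC_def inner_real_def[symmetric]
    by (rule l2_inner_pw[OF AE_arg_cong AE_arg_cong, symmetric])
       (auto intro!: Gae Hae continuous_intros continuous_on_trace Gc Hc)
  finally show ?thesis by simp
qed

lemma zero_V_ECR: "(\<lambda>x. 0) \<in> V_ECR \<Omega> T" "ecr_data (\<lambda>x. 0) (\<lambda>K. 0) (\<lambda>K. 0) (\<lambda>K. 0)"
proof -
  have z: "ecr 0 0 0 = (\<lambda>x::real^'n. 0)" by (simp add: ecr_def[abs_def])
  show d: "ecr_data (\<lambda>x. 0) (\<lambda>K. 0) (\<lambda>K. 0) (\<lambda>K. 0)" by (simp add: ecr_data_def z)
  show "(\<lambda>x. 0) \<in> V_ECR \<Omega> T"
    unfolding V_ECR_iff[OF d] z by (rule exI[of _ "\<lambda>F. 0"]) (simp add: face_integral_zero)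
qed

text \<open>Row \<open>i\<close> of the stress \<open>\<nabla>\<^sub>N\<^sub>C u + p id\<close> is \<open>\<alpha> + \<beta> x\<close> on each cell. Testing the momentum equation with the
interpolant of a test function \<open>\<phi>\<close>, placed in component \<open>i\<close>, shows that this row has weak divergence
\<open>- f\<^sub>i\<close>. Both claims follow from the description of weak divergences by fluxes and cell means.\<close>

lemma ECR_stress_equilibrium:
  assumes sol: "ECR_solution \<Omega> T f u p"
    and u: "\<And>i. ecr_data (\<lambda>x. u x $ i) (c i) (a i) (b i)"
    and p: "\<And>K. K \<in> T \<Longrightarrow> AE x in lebesgue_on K. p x = P K"
    and f: "\<And>K. K \<in> T \<Longrightarrow> AE x in lebesgue_on K. f x = \<f> K"
  shows "F \<in> interior_faces \<Omega> T \<Longrightarrow> netflux (\<lambda>K. a i K + P K *\<^sub>R axis i 1) (\<lambda>K. 2 * b i K) F = 0"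
    and "K \<in> T \<Longrightarrow> real CARD('n) * (2 * b i K) = - \<f> K $ i"
proof -
  define \<alpha> where "\<alpha> K = a i K + P K *\<^sub>R axis i 1" for K
  define \<beta> where "\<beta> K = 2 * b i K" for K
  define \<sigma> where "\<sigma> = glue (\<lambda>K x. \<alpha> K + \<beta> K *\<^sub>R x)"
  define g where "g = glue (\<lambda>K x. - \<f> K $ i)"
  have \<sigma>: "rt_data \<sigma> \<alpha> \<beta>"
    unfolding rt_data_def \<sigma>_def using glue_AE[where q="\<lambda>K x. \<alpha> K + \<beta> K *\<^sub>R x"] by simp
  have gae: "AE x in lebesgue_on K. g x = - \<f> K $ i" if "K \<in> T" for K
    unfolding g_def using glue_AE[OF that, of "\<lambda>K x. - \<f> K $ i"] .
  have gL2: "g \<in> L2 \<Omega>" by (rule L2_pw[where q="\<lambda>K x. - \<f> K $ i"]) (use gae in auto)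
  have weak: "has_weak_div \<Omega> \<sigma> g"
    unfolding has_weak_div_def
  proof
    fix \<phi> assume \<phi>: "\<phi> \<in> test_functions \<Omega>"
    obtain cw aw bw where wV: "glue (\<lambda>K. ecr (cw K) (aw K) (bw K)) \<in> V_ECR \<Omega> T"
      and wd: "ecr_data (glue (\<lambda>K. ecr (cw K) (aw K) (bw K))) cw aw bw"
      and mean: "\<And>K. K \<in> T \<Longrightarrow> (LINT x|lebesgue_on K. ecr (cw K) (aw K) (bw K) x) = (LINT x|lebesgue_on K. \<phi> x)"
      and gr: "\<And>K \<alpha> \<beta>. K \<in> T \<Longrightarrow> (LINT x|lebesgue_on K. (\<alpha> + \<beta> *\<^sub>R x) \<bullet> grad (ecr (cw K) (aw K) (bw K)) x) =
        (LINT x|lebesgue_on K. (\<alpha> + \<beta> *\<^sub>R x) \<bullet> grad \<phi> x)"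
      by (rule ecr_interpolation[OF \<phi>]) blast
    define w where "w = glue (\<lambda>K. ecr (cw K) (aw K) (bw K))"
    define v where "v x = w x *\<^sub>R axis i (1::real)" for x
    have vj: "(\<lambda>x. v x $ j) = (if j = i then w else (\<lambda>x. 0))" for j
      by (auto simp: v_def axis_def)
    have vV: "v \<in> comps (V_ECR \<Omega> T)"
      unfolding comps_def mem_Collect_eq vj using wV zero_V_ECR(1) by (simp add: w_def)
    define X where "X K x = aw K + (2 * bw K) *\<^sub>R x" for K and x :: "real^'n"
    have Xc: "continuous_on S (X K)" for S K unfolding X_def by (intro continuous_intros)
    have "ecr_data (\<lambda>x. v x $ j) (if j = i then cw else (\<lambda>K. 0)) (if j = i then aw else (\<lambda>K. 0))
       (if j = i then bw else (\<lambda>K. 0))" for j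
      unfolding vj using wd zero_V_ECR(2) by (simp add: w_def)
    from grad_NC_eq[OF this]
    have "grad_NC T v = glue (\<lambda>K x. \<chi> j. if j = i then X K x else 0)"
    proof -
      assume "grad_NC T v = glue (\<lambda>K x. \<chi> j. (if j = i then aw else (\<lambda>K. 0)) K +
         (2 * (if j = i then bw else (\<lambda>K. 0)) K) *\<^sub>R x)"
      also have "(\<lambda>K x. \<chi> j. (if j = i then aw else (\<lambda>K. 0)) K +
         (2 * (if j = i then bw else (\<lambda>K. 0)) K) *\<^sub>R x) = (\<lambda>K x. \<chi> j. if j = i then X K x else 0)"
        by (auto simp: fun_eq_iff vec_eq_iff X_def)
      finally show ?thesis .
    qed
    then have vg: "AE x in lebesgue_on K. grad_NC T v x = (\<chi> j. if j = i then X K x else 0)" if "K \<in> T" for K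
      using glue_AE[OF that, of "\<lambda>K x. \<chi> j. if j = i then X K x else 0"] by simp
    have ug: "AE x in lebesgue_on K. grad_NC T u x = (\<chi> j. a j K + (2 * b j K) *\<^sub>R x)" if "K \<in> T" for K
      using glue_AE[OF that, of "\<lambda>K x. \<chi> j. a j K + (2 * b j K) *\<^sub>R x"] grad_NC_eq[OF u] by simp
    have e1: "l2_inner \<Omega> (grad_NC T u) (grad_NC T v) =
        (\<Sum>K\<in>T. LINT x|lebesgue_on K. (a i K + \<beta> K *\<^sub>R x) \<bullet> X K x)"
      unfolding l2_inner_def
    proof (rule integral_pw)
      fix K assume K: "K \<in> T"
      show "continuous_on K (\<lambda>x. (a i K + \<beta> K *\<^sub>R x) \<bullet> X K x)" by (intro continuous_intros Xc)
      show "AE x in lebesgue_on K. grad_NC T u x \<bullet> grad_NC T v x = (a i K + \<beta> K *\<^sub>R x) \<bullet> X K x"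
        using vg[OF K] ug[OF K]
      proof eventually_elim
        fix x assume 1: "grad_NC T v x = (\<chi> j. if j = i then X K x else 0)"
          "grad_NC T u x = (\<chi> j. a j K + (2 * b j K) *\<^sub>R x)"
        have "grad_NC T u x \<bullet> grad_NC T v x =
          (\<Sum>j\<in>UNIV. (a j K + (2 * b j K) *\<^sub>R x) \<bullet> (if j = i then X K x else 0))"
          unfolding 1 inner_vec_def[of "\<chi> j. a j K + (2 * b j K) *\<^sub>R x"] by simp
        also have "\<dots> = (\<Sum>j\<in>UNIV. if j = i then (a i K + \<beta> K *\<^sub>R x) \<bullet> X K x else 0)"
          by (intro sum.cong) (auto simp: \<beta>_def)
        finally show "grad_NC T u x \<bullet> grad_NC T v x = (a i K + \<beta> K *\<^sub>R x) \<bullet> X K x" by simp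
      qed
    qed
    have e2: "l2_inner \<Omega> (div_NC T v) p = (\<Sum>K\<in>T. LINT x|lebesgue_on K. (P K *\<^sub>R axis i 1) \<bullet> X K x)"
      unfolding l2_inner_def
    proof (rule integral_pw)
      fix K assume K: "K \<in> T"
      show "continuous_on K (\<lambda>x. (P K *\<^sub>R axis i 1) \<bullet> X K x)" by (intro continuous_intros Xc)
      show "AE x in lebesgue_on K. div_NC T v x \<bullet> p x = (P K *\<^sub>R axis i 1) \<bullet> X K x"
        using vg[OF K] p[OF K]
      proof eventually_elim
        fix x assume 1: "grad_NC T v x = (\<chi> j. if j = i then X K x else 0)" "p x = P K"
        have "div_NC T v x = (\<Sum>j\<in>UNIV. if j = i then X K x $ i else 0)"
          unfolding div_NC_def 1 trace_def by (intro sum.cong) auto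
        then show "div_NC T v x \<bullet> p x = (P K *\<^sub>R axis i 1) \<bullet> X K x"
          using 1(2) by (simp add: inner_axis')
      qed
    qed
    have e3: "l2_inner \<Omega> f v = (\<Sum>K\<in>T. LINT x|lebesgue_on K. \<f> K $ i * ecr (cw K) (aw K) (bw K) x)"
      unfolding l2_inner_def
    proof (rule integral_pw)
      fix K assume K: "K \<in> T"
      show "continuous_on K (\<lambda>x. \<f> K $ i * ecr (cw K) (aw K) (bw K) x)"
        by (intro continuous_intros ecr_continuous)
      show "AE x in lebesgue_on K. f x \<bullet> v x = \<f> K $ i * ecr (cw K) (aw K) (bw K) x"
        using f[OF K] ecr_dataD[OF wd K] by eventually_elim (simp add: v_def w_def inner_axis)
    qed
    have XI: "(LINT x|lebesgue_on K. (a i K + \<beta> K *\<^sub>R x) \<bullet> X K x) + (LINT x|lebesgue_on K. (P K *\<^sub>R axis i 1) \<bullet> X K x)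
        = (LINT x|lebesgue_on K. (\<alpha> K + \<beta> K *\<^sub>R x) \<bullet> grad \<phi> x)" if K: "K \<in> T" for K
    proof -
      have i1: "integrable (lebesgue_on K) (\<lambda>x. (a i K + \<beta> K *\<^sub>R x) \<bullet> X K x)"
        and i2: "integrable (lebesgue_on K) (\<lambda>x. (P K *\<^sub>R axis i 1) \<bullet> X K x)"
        by (intro integrable_lebesgue_on_compact[OF compact_T[OF K]] continuous_intros Xc)+
      have "(LINT x|lebesgue_on K. (\<alpha> K + \<beta> K *\<^sub>R x) \<bullet> grad (ecr (cw K) (aw K) (bw K)) x) =
        (LINT x|lebesgue_on K. (a i K + \<beta> K *\<^sub>R x) \<bullet> X K x + (P K *\<^sub>R axis i 1) \<bullet> X K x)"
        by (intro Bochner_Integration.integral_cong) (auto simp: grad_ecr X_def \<alpha>_def inner_add_left)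
      then show ?thesis using Bochner_Integration.integral_add[OF i1 i2] gr[OF K, of "\<alpha> K" "\<beta> K"] by simp
    qed
    have "l2_inner \<Omega> (grad_NC T u) (grad_NC T v) + l2_inner \<Omega> (div_NC T v) p = l2_inner \<Omega> f v"
      using sol vV by (simp add: ECR_solution_def)
    then have main: "(\<Sum>K\<in>T. LINT x|lebesgue_on K. (\<alpha> K + \<beta> K *\<^sub>R x) \<bullet> grad \<phi> x) =
        (\<Sum>K\<in>T. \<f> K $ i * (LINT x|lebesgue_on K. \<phi> x))"
      unfolding e1 e2 e3 sum.distrib[symmetric] using XI mean by (simp add: integral_mult_right_zero)
    have "l2_inner \<Omega> \<sigma> (grad \<phi>) = (\<Sum>K\<in>T. LINT x|lebesgue_on K. (\<alpha> K + \<beta> K *\<^sub>R x) \<bullet> grad \<phi> x)"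
      by (rule l2_inner_pw[OF rt_dataD[OF \<sigma>]])
         (auto intro!: continuous_intros Ck_grad_continuous test_function_Ck[OF \<phi>])
    moreover have "l2_inner \<Omega> g \<phi> = (\<Sum>K\<in>T. (- \<f> K $ i) * (LINT x|lebesgue_on K. \<phi> x))"
      unfolding l2_inner_def g_def
      using integral_pw_const_times[OF Ck_continuous_on[OF test_function_Ck[OF \<phi>, of 0]], of "\<lambda>K. - \<f> K $ i"]
      by simp
    ultimately show "l2_inner \<Omega> \<sigma> (grad \<phi>) = - l2_inner \<Omega> g \<phi>"
      using main by (simp add: sum_negf)
  qed
  show "netflux (\<lambda>K. a i K + P K *\<^sub>R axis i 1) (\<lambda>K. 2 * b i K) F = 0" if F: "F \<in> interior_faces \<Omega> T"
    using Hdiv_netflux[OF \<sigma> gL2 weak F] unfolding \<alpha>_def[abs_def] \<beta>_def[abs_def] .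
  show "real CARD('n) * (2 * b i K) = - \<f> K $ i" if K: "K \<in> T"
  proof -
    have "(LINT x|lebesgue_on K. g x) = (LINT x|lebesgue_on K. - \<f> K $ i)"
      by (rule lebesgue_on_cong_AE(2)[OF sets_T[OF K] _ gae[OF K]]) simp
    then have "real CARD('n) * \<beta> K * vol K = - \<f> K $ i * vol K"
      using weak_div_cell[OF \<sigma> gL2 weak Ck_const[where c=1] K] integral_const_cell[OF K, of "- \<f> K $ i"] by simp
    moreover have "vol K \<noteq> 0" using simplex_measure_pos[OF simplex_T[OF K]] by linarith
    ultimately show ?thesis
      using mult_right_cancel[of "vol K" "real CARD('n) * \<beta> K" "- \<f> K $ i"] unfolding \<beta>_def by simp
  qed
qed

text \<open>Pair row \<open>i\<close> of the gradient with the constant field \<open>axis i 1\<close>, whose divergence is zero.\<close>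

lemma integral_div_NC_zero:
  assumes u: "u \<in> comps (V_ECR \<Omega> T)" "\<And>i. ecr_data (\<lambda>x. u x $ i) (c i) (a i) (b i)"
  shows "(LINT x|lebesgue_on \<Omega>. div_NC T u x) = 0"
proof -
  have "(LINT x|lebesgue_on \<Omega>. div_NC T u x) =
    (\<Sum>K\<in>T. LINT x|lebesgue_on K. (\<Sum>i\<in>UNIV. (axis i 1 + 0 *\<^sub>R x) \<bullet> (a i K + (2 * b i K) *\<^sub>R x)))"
  proof (rule integral_pw)
    fix K assume K: "K \<in> T"
    show "continuous_on K (\<lambda>x. \<Sum>i\<in>UNIV. (axis i 1 + 0 *\<^sub>R x) \<bullet> (a i K + (2 * b i K) *\<^sub>R x))"
      by (intro continuous_intros)
    have "AE x in lebesgue_on K. grad_NC T u x = (\<chi> j. a j K + (2 * b j K) *\<^sub>R x)"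
      using glue_AE[OF K, of "\<lambda>K x. \<chi> j. a j K + (2 * b j K) *\<^sub>R x"] grad_NC_eq[OF u(2)] by simp
    then show "AE x in lebesgue_on K. div_NC T u x =
        (\<Sum>i\<in>UNIV. (axis i 1 + 0 *\<^sub>R x) \<bullet> (a i K + (2 * b i K) *\<^sub>R x))"
      by eventually_elim (simp add: div_NC_def trace_def inner_axis')
  qed
  also have "\<dots> = (\<Sum>K\<in>T. \<Sum>i\<in>UNIV. LINT x|lebesgue_on K. (axis i 1 + 0 *\<^sub>R x) \<bullet> (a i K + (2 * b i K) *\<^sub>R x))"
  proof (rule sum.cong[OF refl])
    fix K assume K: "K \<in> T"
    show "(LINT x|lebesgue_on K. (\<Sum>i\<in>UNIV. (axis i 1 + 0 *\<^sub>R x) \<bullet> (a i K + (2 * b i K) *\<^sub>R x))) =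
      (\<Sum>i\<in>UNIV. LINT x|lebesgue_on K. (axis i 1 + 0 *\<^sub>R x) \<bullet> (a i K + (2 * b i K) *\<^sub>R x))"
      by (rule Bochner_Integration.integral_sum)
         (intro integrable_lebesgue_on_compact[OF compact_T[OF K]] continuous_intros)
  qed
  also have "\<dots> = (\<Sum>i\<in>UNIV. \<Sum>K\<in>T. LINT x|lebesgue_on K. (axis i 1 + 0 *\<^sub>R x) \<bullet> (a i K + (2 * b i K) *\<^sub>R x))"
    by (rule sum.swap)
  also have "\<dots> = 0"
  proof (rule sum.neutral, rule ballI)
    fix i
    have "(\<lambda>x. u x $ i) \<in> V_ECR \<Omega> T" using u(1) by (simp add: comps_def)
    from green_ECR_RT[OF u(2) this netflux_const, of "axis i 1"]
    show "(\<Sum>K\<in>T. LINT x|lebesgue_on K. (axis i 1 + 0 *\<^sub>R x) \<bullet> (a i K + (2 * b i K) *\<^sub>R x)) = 0"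
      by simp
  qed
  finally show ?thesis .
qed

lemma netflux_diff:
  "netflux (\<lambda>K. a K - a' K) (\<lambda>K. b K - b' K) F = netflux a b F - netflux a' b' F"
  by (simp add: netflux_def flux_linear sum_subtractf)

lemma RT_stress_divergence:
  assumes sol: "RT_solution \<Omega> T f \<sigma> u"
    and \<alpha>\<beta>: "\<And>i. rt_data (\<lambda>x. \<sigma> x $ i) (\<alpha> i) (\<beta> i)"
    and f: "\<And>K. K \<in> T \<Longrightarrow> AE x in lebesgue_on K. f x = \<f> K"
    and K: "K \<in> T"
  shows "real CARD('n) * \<beta> i K = - \<f> K $ i"
proof -
  have \<sigma>R: "\<sigma> \<in> comps (RT \<Omega> T)" using sol by (simp add: RT_solution_def RT_hat_def)
  define e where "e K' = (if K' = K then axis i 1 else 0 :: real^'n)" for K'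
  define v where "v = glue (\<lambda>K' x. e K')"
  have v: "AE x in lebesgue_on K'. v x = e K'" if "K' \<in> T" for K'
    unfolding v_def using glue_AE[OF that, of "\<lambda>K' x. e K'"] .
  have "v \<in> comps (U_RT \<Omega> T)" by (rule comps_U_RT_I[OF v])
  then have "l2_inner \<Omega> (row_div \<Omega> \<sigma>) v = - l2_inner \<Omega> f v" using sol by (simp add: RT_solution_def)
  moreover have "l2_inner \<Omega> (row_div \<Omega> \<sigma>) v = l2_inner \<Omega> v (row_div \<Omega> \<sigma>)"
    by (simp add: l2_inner_def inner_commute)
  moreover have "l2_inner \<Omega> v (row_div \<Omega> \<sigma>) =
      (\<Sum>K'\<in>T. \<Sum>j\<in>UNIV. e K' $ j * (real CARD('n) * \<beta> j K' * vol K'))"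
    by (rule l2_inner_row_div[OF \<sigma>R \<alpha>\<beta> v])
  moreover have "\<dots> = (\<Sum>K'\<in>T. if K' = K then real CARD('n) * \<beta> i K * vol K else 0)"
  proof (rule sum.cong[OF refl])
    fix K'
    have "(\<Sum>j\<in>UNIV. axis i 1 $ j * (real CARD('n) * \<beta> j K * vol K)) =
      (\<Sum>j\<in>UNIV. if j = i then real CARD('n) * \<beta> i K * vol K else 0)"
      by (intro sum.cong) (auto simp: axis_def)
    then show "(\<Sum>j\<in>UNIV. e K' $ j * (real CARD('n) * \<beta> j K' * vol K')) =
      (if K' = K then real CARD('n) * \<beta> i K * vol K else 0)" by (simp add: e_def)
  qed
  moreover have "l2_inner \<Omega> f v = (\<Sum>K'\<in>T. LINT x|lebesgue_on K'. \<f> K' \<bullet> e K')"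
    by (rule l2_inner_pw[OF f v]) auto
  moreover have "\<dots> = (\<Sum>K'\<in>T. if K' = K then \<f> K $ i * vol K else 0)"
    using integral_const_cell by (intro sum.cong) (auto simp: e_def inner_axis)
  ultimately have "real CARD('n) * \<beta> i K * vol K = (- \<f> K $ i) * vol K"
    using K finite_T by simp
  moreover have "vol K \<noteq> 0" using simplex_measure_pos[OF simplex_T[OF K]] by linarith
  ultimately show ?thesis
    using mult_right_cancel[of "vol K" "real CARD('n) * \<beta> i K" "- \<f> K $ i"] by simp
qed

text \<open>Here \<open>\<delta> = s id\<close> with a piecewise constant \<open>s\<close>. Its rows are \<open>s\<close> times the coordinate vectors; that their
normal components are continuous means that the weak gradient of \<open>s\<close> is zero.\<close>

lemma dev_free_RT_hat_zero:
  assumes \<delta>: "\<delta> \<in> RT_hat \<Omega> T"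
    and D: "\<And>K. K \<in> T \<Longrightarrow> AE x in lebesgue_on K. \<delta> x = D K"
    and dev: "\<And>K. K \<in> T \<Longrightarrow> dev (D K) = 0" and K: "K \<in> T"
  shows "D K = 0"
proof -
  define s where "s K = trace (D K) / real CARD('n)" for K
  have Ds: "D K = s K *\<^sub>R mat 1" if "K \<in> T" for K
    using dev[OF that] by (simp add: dev_def s_def)
  have rows: "(\<lambda>x. \<delta> x $ i) \<in> RT \<Omega> T" for i using \<delta> by (simp add: RT_hat_def comps_def)
  have row: "rt_data (\<lambda>x. \<delta> x $ i) (\<lambda>K. s K *\<^sub>R axis i 1) (\<lambda>K. 0)" for i
    unfolding rt_data_def
  proof
    fix K assume K: "K \<in> T"
    have "(mat 1 :: real^'n^'n) $ i = axis i 1" by (simp add: vec_eq_iff mat_def axis_def)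
    then have Di: "D K $ i = s K *\<^sub>R axis i 1" using Ds[OF K] by simp
    show "AE x in lebesgue_on K. \<delta> x $ i = s K *\<^sub>R axis i 1 + 0 *\<^sub>R x"
      using D[OF K] by eventually_elim (simp add: Di)
  qed
  have nf: "netflux (\<lambda>K. s K *\<^sub>R e) (\<lambda>K. 0) F = 0" if F: "F \<in> interior_faces \<Omega> T" for e F
  proof -
    have "netflux (\<lambda>K. s K *\<^sub>R e) (\<lambda>K. 0) F = (\<Sum>i\<in>UNIV. e $ i * netflux (\<lambda>K. s K *\<^sub>R axis i 1) (\<lambda>K. 0) F)"
    proof -
      have "flux K F (s K *\<^sub>R e) 0 = (\<Sum>i\<in>UNIV. e $ i * flux K F (s K *\<^sub>R axis i 1) 0)" for K
        by (simp add: flux_def inner_axis' inner_vec_def[of e] sum_distrib_left mult_ac)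
      then show ?thesis
        unfolding netflux_def sum_distrib_left by (simp add: sum.swap[of _ UNIV])
    qed
    then show ?thesis using netflux_of_RT[OF row rows F] by simp
  qed
  have zero: "(\<Sum>K\<in>T. s K * (LINT x|lebesgue_on K. e \<bullet> grad \<phi> x)) = 0" if \<phi>: "\<phi> \<in> test_functions \<Omega>" for e \<phi>
  proof -
    have "s K * (LINT x|lebesgue_on K. e \<bullet> grad \<phi> x) =
      (\<Sum>F\<in>facets K. flux K F (s K *\<^sub>R e) 0 * face_integral F \<phi>)" if K: "K \<in> T" for K
      using green_simplex[OF simplex_T[OF K] test_function_Ck[OF \<phi>], of "s K *\<^sub>R e" 0] by simp
    then have "(\<Sum>K\<in>T. s K * (LINT x|lebesgue_on K. e \<bullet> grad \<phi> x)) =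
      (\<Sum>K\<in>T. \<Sum>F\<in>facets K. flux K F (s K *\<^sub>R e) 0 * face_integral F \<phi>)"
      by (intro sum.cong) auto
    also have "\<dots> = 0"
      by (rule sum_interior_faces[of "\<lambda>F. face_integral F \<phi>" "\<lambda>K. s K *\<^sub>R e" "\<lambda>K. 0",
            OF boundary_face_integral[OF \<phi>] nf])
    finally show ?thesis .
  qed
  have const: "s K' = s K" if "K' \<in> T" for K' by (rule weak_grad_zero_const[OF zero that K])
  have "0 = (LINT x|lebesgue_on \<Omega>. trace (\<delta> x))" using \<delta> by (simp add: RT_hat_def)
  also have "\<dots> = (\<Sum>K'\<in>T. LINT x|lebesgue_on K'. real CARD('n) * s K)"
  proof (rule integral_pw)
    fix K' assume K': "K' \<in> T"
    have tr: "trace (D K') = real CARD('n) * s K" using const[OF K'] by (simp add: s_def)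
    show "AE x in lebesgue_on K'. trace (\<delta> x) = real CARD('n) * s K"
      using D[OF K'] by eventually_elim (simp add: tr)
  qed simp
  also have "\<dots> = real CARD('n) * s K * (\<Sum>K'\<in>T. vol K')"
    using integral_const_cell[of _ "real CARD('n) * s K"] by (simp add: sum_distrib_left mult_ac)
  finally have "real CARD('n) * s K * (\<Sum>K'\<in>T. vol K') = 0" by simp
  moreover have "0 < (\<Sum>K'\<in>T. vol K')"
    using finite_T K simplex_measure_pos[OF simplex_T] by (intro sum_pos) blast+
  ultimately have "s K = 0" by simp
  then show ?thesis using Ds[OF K] by simp
qed

text \<open>A scalar Raviart--Thomas field is placed in row \<open>i\<close>; subtracting a multiple \<open>t\<close> of the identity restores the
mean zero of the trace and does not change the divergence.\<close>

lemma row_div_RT_hat_surjective: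
  assumes orth: "\<And>\<tau> \<alpha> \<beta>. \<tau> \<in> RT_hat \<Omega> T \<Longrightarrow> (\<And>i. rt_data (\<lambda>x. \<tau> x $ i) (\<alpha> i) (\<beta> i)) \<Longrightarrow>
      (\<Sum>K\<in>T. \<Sum>i\<in>UNIV. W K $ i * (real CARD('n) * \<beta> i K * vol K)) = 0"
    and K: "K \<in> T"
  shows "W K = (0 :: real^'n)"
proof -
  have "W K $ i = 0" for i
  proof (rule div_surjective[OF _ K, of "\<lambda>K. W K $ i"])
    fix a b assume ab: "\<And>F. F \<in> interior_faces \<Omega> T \<Longrightarrow> netflux a b F = 0"
    define H where "H K x = (\<chi> j. if j = i then a K + b K *\<^sub>R x else 0 :: real^'n^'n)" for K x
    have Hc: "continuous_on S (H K)" for S K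
    proof -
      have "continuous_on S (\<lambda>x. if j = i then a K + b K *\<^sub>R x else 0)" for j
        by (cases "j = i") (auto intro!: continuous_intros)
      then show ?thesis unfolding H_def by (rule continuous_on_vec_lambda)
    qed
    define I where "I = (\<Sum>K\<in>T. LINT x|lebesgue_on K. trace (H K x))"
    define t where "t = I / (real CARD('n) * (\<Sum>K\<in>T. vol K))"
    have vol: "0 < (\<Sum>K\<in>T. vol K)"
      using finite_T K simplex_measure_pos[OF simplex_T] by (intro sum_pos) blast+
    define \<tau> where "\<tau> x = glue H x - t *\<^sub>R mat 1" for x
    have Hae: "AE x in lebesgue_on K. glue H x = H K x" if "K \<in> T" for K by (rule glue_AE[OF that])
    define \<alpha> where "\<alpha> j = (\<lambda>K. (if j = i then a K else 0) - t *\<^sub>R axis j 1)" for j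
    define \<beta> where "\<beta> j = (\<lambda>K. (if j = i then b K else 0) - 0)" for j
    have d: "rt_data (\<lambda>x. \<tau> x $ j) (\<alpha> j) (\<beta> j)" for j
      unfolding rt_data_def
    proof
      fix K assume K: "K \<in> T"
      have mat: "(mat 1 :: real^'n^'n) $ j = axis j 1" by (simp add: vec_eq_iff mat_def axis_def)
      show "AE x in lebesgue_on K. \<tau> x $ j = \<alpha> j K + \<beta> j K *\<^sub>R x"
        using Hae[OF K] by eventually_elim (simp add: \<tau>_def H_def \<alpha>_def \<beta>_def mat)
    qed
    have "netflux (\<alpha> j) (\<beta> j) F = 0" if F: "F \<in> interior_faces \<Omega> T" for j F
    proof -
      have "netflux (\<lambda>K. if j = i then a K else 0) (\<lambda>K. if j = i then b K else 0) F = 0"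
        by (cases "j = i") (use ab[OF F] netflux_const[OF F, of 0] in simp_all)
      then show ?thesis
        unfolding \<alpha>_def \<beta>_def netflux_diff using netflux_const[OF F] by simp
    qed
    then have "\<tau> \<in> comps (RT \<Omega> T)" unfolding comps_def using RT_iff[OF d] by simp
    moreover have "(LINT x|lebesgue_on \<Omega>. trace (\<tau> x)) = 0"
    proof -
      have "(LINT x|lebesgue_on \<Omega>. trace (\<tau> x)) = (\<Sum>K\<in>T. LINT x|lebesgue_on K. trace (H K x) - t * real CARD('n))"
      proof (rule integral_pw)
        fix K assume K: "K \<in> T"
        show "continuous_on K (\<lambda>x. trace (H K x) - t * real CARD('n))"
          by (intro continuous_intros continuous_on_trace Hc)
        show "AE x in lebesgue_on K. trace (\<tau> x) = trace (H K x) - t * real CARD('n)"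
          using Hae[OF K] by eventually_elim (simp add: \<tau>_def trace_sub trace_scaleR trace_I)
      qed
      also have "\<dots> = (\<Sum>K\<in>T. (LINT x|lebesgue_on K. trace (H K x)) - t * real CARD('n) * vol K)"
      proof (rule sum.cong[OF refl])
        fix K assume K: "K \<in> T"
        have i1: "integrable (lebesgue_on K) (\<lambda>x. trace (H K x))"
          and i2: "integrable (lebesgue_on K) (\<lambda>x. t * real CARD('n))"
          by (intro integrable_lebesgue_on_compact[OF compact_T[OF K]] continuous_on_trace Hc continuous_on_const)+
        show "(LINT x|lebesgue_on K. trace (H K x) - t * real CARD('n)) =
          (LINT x|lebesgue_on K. trace (H K x)) - t * real CARD('n) * vol K"
          using Bochner_Integration.integral_diff[OF i1 i2] integral_const_cell[OF K, of "t * real CARD('n)"] by simp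
      qed
      also have "\<dots> = I - t * real CARD('n) * (\<Sum>K\<in>T. vol K)"
        by (simp only: sum_subtractf I_def sum_distrib_left)
      also have "\<dots> = 0" unfolding t_def using vol by (simp del: lebesgue_integral_const)
      finally show ?thesis .
    qed
    ultimately have "\<tau> \<in> RT_hat \<Omega> T" by (simp add: RT_hat_def)
    from orth[OF this d] have "(\<Sum>K\<in>T. \<Sum>j\<in>UNIV. W K $ j * (real CARD('n) * \<beta> j K * vol K)) = 0" .
    moreover have "(\<Sum>j\<in>UNIV. W K $ j * (real CARD('n) * \<beta> j K * vol K)) = W K $ i * (real CARD('n) * b K * vol K)" for K
    proof -
      have "(\<Sum>j\<in>UNIV. W K $ j * (real CARD('n) * \<beta> j K * vol K)) =
        (\<Sum>j\<in>UNIV. if j = i then W K $ i * (real CARD('n) * b K * vol K) else 0)"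
        by (intro sum.cong) (auto simp: \<beta>_def)
      then show ?thesis by simp
    qed
    ultimately show "(\<Sum>K\<in>T. W K $ i * (real CARD('n) * b K * vol K)) = 0" by simp
  qed
  then show ?thesis by (simp add: vec_eq_iff)
qed

end

theorem theorem3p5:
  fixes \<Omega> :: "(real^'n) set" and T :: "(real^'n) set set"
    and f u_ECR u_RT :: "real^'n \<Rightarrow> real^'n"
    and p_ECR :: "real^'n \<Rightarrow> real"
    and \<sigma>_RT :: "real^'n \<Rightarrow> real^'n^'n"
  assumes "polytopal_domain \<Omega>"
    and "mesh \<Omega> T"
    and "f \<in> piecewise T P0"
    and "ECR_solution \<Omega> T f u_ECR p_ECR"
    and "RT_solution \<Omega> T f \<sigma>_RT u_RT"
  shows "(AE x in lebesgue_on \<Omega>. \<sigma>_RT x = grad_NC T u_ECR x + p_ECR x *\<^sub>R mat 1) \<and>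
         (\<exists>l. is_L \<Omega> T u_ECR l) \<and>
         (\<forall>l. is_L \<Omega> T u_ECR l \<longrightarrow>
            (AE x in lebesgue_on \<Omega>. u_RT x = Pi0 \<Omega> T u_ECR x + l x))"
proof -
  interpret meshed \<Omega> T using assms(1,2) by unfold_locales
  note ECR = assms(4)[unfolded ECR_solution_def] and RT = assms(5)[unfolded RT_solution_def]
  have u: "u_ECR \<in> comps (V_ECR \<Omega> T)" and p: "p_ECR \<in> Q_ECR \<Omega> T" using ECR by blast+
  have \<sigma>: "\<sigma>_RT \<in> RT_hat \<Omega> T" and uRT: "u_RT \<in> comps (U_RT \<Omega> T)" using RT by blast+
  have \<sigma>R: "\<sigma>_RT \<in> comps (RT \<Omega> T)" using \<sigma> by (simp add: RT_hat_def)
  obtain c a b where cab: "\<And>i. ecr_data (\<lambda>x. u_ECR x $ i) (c i) (a i) (b i)"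
    by (rule comps_ecr_data[OF u]) blast
  obtain P where P: "\<And>K. K \<in> T \<Longrightarrow> AE x in lebesgue_on K. p_ECR x = P K"
    by (rule piecewise_const_data[of p_ECR]) (use p in \<open>auto simp: Q_ECR_def\<close>)
  obtain \<f> where \<f>: "\<And>K. K \<in> T \<Longrightarrow> AE x in lebesgue_on K. f x = \<f> K"
    by (rule piecewise_const_data[OF assms(3)]) blast
  obtain \<alpha> \<beta> where \<alpha>\<beta>: "\<And>i. rt_data (\<lambda>x. \<sigma>_RT x $ i) (\<alpha> i) (\<beta> i)"
    by (rule comps_rt_data[OF \<sigma>R]) blast
  obtain U where U: "\<And>K. K \<in> T \<Longrightarrow> AE x in lebesgue_on K. u_RT x = U K"
    by (rule comps_U_RT_data[OF uRT]) blast
  obtain W where W: "\<And>K. K \<in> T \<Longrightarrow> AE x in lebesgue_on K. Pi0 \<Omega> T u_ECR x = W K"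
    by (rule Pi0_data[OF cab]) blast
  have eq1: "netflux (\<lambda>K. a i K + P K *\<^sub>R axis i 1) (\<lambda>K. 2 * b i K) F = 0"
    if "F \<in> interior_faces \<Omega> T" for i F
    by (rule ECR_stress_equilibrium(1)[OF assms(4) cab P \<f> that])
  have eq2: "real CARD('n) * (2 * b i K) = - \<f> K $ i" if "K \<in> T" for i K
    by (rule ECR_stress_equilibrium(2)[OF assms(4) cab P \<f> that])
  define G where "G K x = (\<chi> i. a i K + (2 * b i K) *\<^sub>R x)" for K x
  have G: "AE x in lebesgue_on K. grad_NC T u_ECR x = G K x" if "K \<in> T" for K
    using glue_AE[OF that, of G] grad_NC_eq[OF cab] unfolding G_def[abs_def] by simp

  have \<beta>: "\<beta> i K = 2 * b i K" if K: "K \<in> T" for i K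
  proof -
    have "real CARD('n) * \<beta> i K = real CARD('n) * (2 * b i K)"
      unfolding eq2[OF K] by (rule RT_stress_divergence[OF assms(5) \<alpha>\<beta> \<f> K])
    then show ?thesis by simp
  qed

  (* The difference of the stresses: the linear parts cancel since both stresses have divergence - f, which
     leaves the constant matrix D K on each cell K. *)
  define \<delta> where "\<delta> x = \<sigma>_RT x - (grad_NC T u_ECR x + p_ECR x *\<^sub>R mat 1)" for x
  define D where "D K = (\<chi> i. \<alpha> i K - (a i K + P K *\<^sub>R axis i 1))" for K
  have D: "AE x in lebesgue_on K. \<delta> x = D K" if K: "K \<in> T" for K
    using rt_data_mat[OF \<alpha>\<beta> K] G[OF K] P[OF K]
  proof eventually_elim
    fix x assume 1: "\<sigma>_RT x = (\<chi> i. \<alpha> i K + \<beta> i K *\<^sub>R x)" "grad_NC T u_ECR x = G K x" "p_ECR x = P K"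
    have "(mat 1 :: real^'n^'n) $ i = axis i 1" for i by (simp add: vec_eq_iff mat_def axis_def)
    then have "\<delta> x $ i = D K $ i" for i
      by (simp add: \<delta>_def D_def 1 G_def \<beta>[OF K])
    then show "\<delta> x = D K" by (simp add: vec_eq_iff[of "\<delta> x"])
  qed
  have \<delta>row: "rt_data (\<lambda>x. \<delta> x $ i) (\<lambda>K. \<alpha> i K - (a i K + P K *\<^sub>R axis i 1)) (\<lambda>K. 0)" for i
    unfolding rt_data_def
  proof
    fix K assume "K \<in> T"
    from D[OF this] show "AE x in lebesgue_on K. \<delta> x $ i = \<alpha> i K - (a i K + P K *\<^sub>R axis i 1) + 0 *\<^sub>R x"
      by eventually_elim (simp add: D_def)
  qed
  have \<delta>RT: "\<delta> \<in> comps (RT \<Omega> T)"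
  proof -
    have "netflux (\<lambda>K. \<alpha> i K - (a i K + P K *\<^sub>R axis i 1)) (\<lambda>K. 0) F = 0"
      if F: "F \<in> interior_faces \<Omega> T" for i F
    proof -
      have "(\<lambda>x. \<sigma>_RT x $ i) \<in> RT \<Omega> T" using \<sigma>R by (simp add: comps_def)
      then have "netflux (\<alpha> i) (\<beta> i) F = 0" using netflux_of_RT[OF \<alpha>\<beta> _ F] by blast
      then have "netflux (\<lambda>K. \<alpha> i K - (a i K + P K *\<^sub>R axis i 1)) (\<lambda>K. \<beta> i K - 2 * b i K) F = 0"
        unfolding netflux_diff using eq1[OF F] by simp
      moreover have "netflux (\<lambda>K. \<alpha> i K - (a i K + P K *\<^sub>R axis i 1)) (\<lambda>K. \<beta> i K - 2 * b i K) F =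
        netflux (\<lambda>K. \<alpha> i K - (a i K + P K *\<^sub>R axis i 1)) (\<lambda>K. 0) F"
        unfolding netflux_def by (intro sum.cong) (auto simp: \<beta>)
      ultimately show ?thesis by simp
    qed
    then show ?thesis unfolding comps_def using RT_iff[OF \<delta>row] by simp
  qed
  have trG: "continuous_on S (\<lambda>x. trace (G K x))" for S K
    unfolding G_def by (intro continuous_on_trace continuous_on_rt_mat)
  have tr\<delta>: "(LINT x|lebesgue_on \<Omega>. trace (\<delta> x)) = 0"
  proof -
    have i1: "integrable (lebesgue_on \<Omega>) (\<lambda>x. trace (\<sigma>_RT x))"
    proof (rule integrable_pw[where q="\<lambda>K x. trace (\<chi> i. \<alpha> i K + \<beta> i K *\<^sub>R x)"])
      fix K assume K: "K \<in> T"
      show "continuous_on K (\<lambda>x. trace (\<chi> i. \<alpha> i K + \<beta> i K *\<^sub>R x))"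
        by (intro continuous_on_trace continuous_on_rt_mat)
      show "AE x in lebesgue_on K. trace (\<sigma>_RT x) = trace (\<chi> i. \<alpha> i K + \<beta> i K *\<^sub>R x)"
        using rt_data_mat[OF \<alpha>\<beta> K] by eventually_elim simp
    qed
    have i2: "integrable (lebesgue_on \<Omega>) (div_NC T u_ECR)"
    proof (rule integrable_pw[where q="\<lambda>K x. trace (G K x)"])
      fix K assume K: "K \<in> T"
      show "continuous_on K (\<lambda>x. trace (G K x))" by (rule trG)
      show "AE x in lebesgue_on K. div_NC T u_ECR x = trace (G K x)"
        using G[OF K] by eventually_elim (simp add: div_NC_def)
    qed
    have i3: "integrable (lebesgue_on \<Omega>) p_ECR" using p L2_integrable by (simp add: Q_ECR_def)
    have "(LINT x|lebesgue_on \<Omega>. trace (\<delta> x)) =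
      (LINT x|lebesgue_on \<Omega>. trace (\<sigma>_RT x) - (div_NC T u_ECR x + p_ECR x * real CARD('n)))"
      by (simp add: \<delta>_def trace_sub trace_add trace_scaleR trace_I div_NC_def)
    also have "\<dots> = (LINT x|lebesgue_on \<Omega>. trace (\<sigma>_RT x)) -
      ((LINT x|lebesgue_on \<Omega>. div_NC T u_ECR x) + (LINT x|lebesgue_on \<Omega>. p_ECR x) * real CARD('n))"
      using i1 i2 i3 by simp
    also have "\<dots> = 0"
      using \<sigma> p integral_div_NC_zero[OF u cab] by (simp add: RT_hat_def Q_ECR_def)
    finally show ?thesis .
  qed
  have \<delta>hat: "\<delta> \<in> RT_hat \<Omega> T" using \<delta>RT tr\<delta> by (simp add: RT_hat_def)

  (* Testing both problems with \<delta>. *)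
  have rd: "l2_inner \<Omega> l (row_div \<Omega> \<delta>) = 0" if "\<And>K. K \<in> T \<Longrightarrow> AE x in lebesgue_on K. l x = L K" for l L
    using l2_inner_row_div[OF \<delta>RT \<delta>row that] by simp
  have RT\<delta>: "l2_inner \<Omega> (\<lambda>x. dev (\<sigma>_RT x)) (\<lambda>x. dev (\<delta> x)) = 0"
    using RT \<delta>hat rd[OF U] by force
  have ECR\<delta>: "l2_inner \<Omega> (\<lambda>x. dev (grad_NC T u_ECR x)) (\<lambda>x. dev (\<delta> x)) = 0"
  proof -
    have "(\<lambda>x. 1 / real CARD('n) * trace (\<delta> x)) \<in> U_RT \<Omega> T"
      unfolding U_RT_iff
    proof (intro exI[of _ "\<lambda>K. 1 / real CARD('n) * trace (D K)"] ballI)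
      fix K assume "K \<in> T"
      from D[OF this] show "AE x in lebesgue_on K. 1 / real CARD('n) * trace (\<delta> x) = 1 / real CARD('n) * trace (D K)"
        by eventually_elim simp
    qed
    then have "(\<lambda>x. 1 / real CARD('n) * trace (\<delta> x)) \<in> Q_ECR \<Omega> T"
      using tr\<delta> by (simp add: Q_ECR_def U_RT_def)
    then have "l2_inner \<Omega> (div_NC T u_ECR) (\<lambda>x. 1 / real CARD('n) * trace (\<delta> x)) = 0" using ECR by blast
    then show ?thesis using grad_NC_dev_pairing[OF u cab \<delta>RT] rd[OF W] by simp
  qed
  have dev\<sigma>: "AE x in lebesgue_on K. dev (\<sigma>_RT x) = dev (grad_NC T u_ECR x) + dev (D K)" if K: "K \<in> T" for K
    using D[OF K]
  proof eventually_elim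
    fix x assume "\<delta> x = D K"
    then have "dev (D K) = dev (\<sigma>_RT x) - dev (grad_NC T u_ECR x + p_ECR x *\<^sub>R mat 1)"
      unfolding \<delta>_def dev_diff[symmetric] by simp
    then show "dev (\<sigma>_RT x) = dev (grad_NC T u_ECR x) + dev (D K)" by (simp add: dev_add_mat)
  qed
  have Gc: "continuous_on S (G K)" for S K unfolding G_def[abs_def] by (rule continuous_on_rt_mat)
  have dev0: "dev (D K) = 0" if K: "K \<in> T" for K
  proof -
    have "l2_inner \<Omega> (\<lambda>x. dev (\<sigma>_RT x)) (\<lambda>x. dev (\<delta> x)) =
      (\<Sum>K\<in>T. LINT x|lebesgue_on K. dev (G K x) \<bullet> dev (D K) + dev (D K) \<bullet> dev (D K))"
      unfolding l2_inner_def
    proof (rule integral_pw)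
      fix K assume K: "K \<in> T"
      show "continuous_on K (\<lambda>x. dev (G K x) \<bullet> dev (D K) + dev (D K) \<bullet> dev (D K))"
        by (intro continuous_intros continuous_on_dev Gc)
      show "AE x in lebesgue_on K. dev (\<sigma>_RT x) \<bullet> dev (\<delta> x) = dev (G K x) \<bullet> dev (D K) + dev (D K) \<bullet> dev (D K)"
        using dev\<sigma>[OF K] D[OF K] G[OF K] by eventually_elim (simp add: inner_add_left)
    qed
    also have "\<dots> = (\<Sum>K\<in>T. (LINT x|lebesgue_on K. dev (G K x) \<bullet> dev (D K)) + (dev (D K) \<bullet> dev (D K)) * vol K)"
    proof (rule sum.cong[OF refl])
      fix K assume K: "K \<in> T"
      have i1: "integrable (lebesgue_on K) (\<lambda>x. dev (G K x) \<bullet> dev (D K))"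
        and i2: "integrable (lebesgue_on K) (\<lambda>x. dev (D K) \<bullet> dev (D K))"
        by (intro integrable_lebesgue_on_compact[OF compact_T[OF K]] continuous_intros continuous_on_dev Gc)+
      show "(LINT x|lebesgue_on K. dev (G K x) \<bullet> dev (D K) + dev (D K) \<bullet> dev (D K)) =
        (LINT x|lebesgue_on K. dev (G K x) \<bullet> dev (D K)) + (dev (D K) \<bullet> dev (D K)) * vol K"
        using Bochner_Integration.integral_add[OF i1 i2] integral_const_cell[OF K, of "dev (D K) \<bullet> dev (D K)"] by simp
    qed
    also have "\<dots> = l2_inner \<Omega> (\<lambda>x. dev (grad_NC T u_ECR x)) (\<lambda>x. dev (\<delta> x)) +
       (\<Sum>K\<in>T. (dev (D K) \<bullet> dev (D K)) * vol K)"
    proof -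
      have "l2_inner \<Omega> (\<lambda>x. dev (grad_NC T u_ECR x)) (\<lambda>x. dev (\<delta> x)) =
        (\<Sum>K\<in>T. LINT x|lebesgue_on K. dev (G K x) \<bullet> dev (D K))"
        by (rule l2_inner_pw[OF AE_arg_cong AE_arg_cong]) (auto intro: G D continuous_on_dev Gc)
      then show ?thesis by (simp only: sum.distrib)
    qed
    finally have "(\<Sum>K\<in>T. (dev (D K) \<bullet> dev (D K)) * vol K) = 0" using RT\<delta> ECR\<delta> by simp
    moreover have "0 \<le> (dev (D K) \<bullet> dev (D K)) * vol K" if "K \<in> T" for K
      using simplex_measure_pos[OF simplex_T[OF that]] by (intro mult_nonneg_nonneg) (simp_all del: lebesgue_integral_const)
    ultimately have "(dev (D K) \<bullet> dev (D K)) * vol K = 0"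
      using sum_nonneg_eq_0_iff[OF finite_T, of "\<lambda>K. (dev (D K) \<bullet> dev (D K)) * vol K"] K by blast
    then show ?thesis using simplex_measure_pos[OF simplex_T[OF K]] by (simp del: lebesgue_integral_const)
  qed
  have D0: "D K = 0" if "K \<in> T" for K
    by (rule dev_free_RT_hat_zero[OF \<delta>hat D dev0 that])
  have stress: "AE x in lebesgue_on \<Omega>. \<sigma>_RT x = grad_NC T u_ECR x + p_ECR x *\<^sub>R mat 1"
    unfolding AE_mesh_iff
  proof
    fix K assume K: "K \<in> T"
    show "AE x in lebesgue_on K. \<sigma>_RT x = grad_NC T u_ECR x + p_ECR x *\<^sub>R mat 1"
      using D[OF K] by eventually_elim (simp add: \<delta>_def D0[OF K])
  qed

  (* With equal stresses the first mixed equation identifies the displacement. *)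
  define l0 where "l0 x = u_RT x - Pi0 \<Omega> T u_ECR x" for x
  have l0: "AE x in lebesgue_on K. l0 x = U K - W K" if "K \<in> T" for K
    using U[OF that] W[OF that] by eventually_elim (simp add: l0_def)
  have pair: "l2_inner \<Omega> l0 (row_div \<Omega> \<tau>) = l2_inner \<Omega> (div_NC T u_ECR) (\<lambda>x. 1 / real CARD('n) * trace (\<tau> x))"
    if \<tau>: "\<tau> \<in> RT_hat \<Omega> T" for \<tau>
  proof -
    have \<tau>R: "\<tau> \<in> comps (RT \<Omega> T)" using \<tau> by (simp add: RT_hat_def)
    obtain \<alpha>' \<beta>' where r: "\<And>i. rt_data (\<lambda>x. \<tau> x $ i) (\<alpha>' i) (\<beta>' i)" by (rule comps_rt_data[OF \<tau>R]) blast
    note d = l2_inner_row_div[OF \<tau>R r]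
    have "l2_inner \<Omega> l0 (row_div \<Omega> \<tau>) = l2_inner \<Omega> u_RT (row_div \<Omega> \<tau>) - l2_inner \<Omega> (Pi0 \<Omega> T u_ECR) (row_div \<Omega> \<tau>)"
      by (simp add: d[OF l0] d[OF U] d[OF W] sum_subtractf left_diff_distrib del: lebesgue_integral_const)
    moreover have "l2_inner \<Omega> (\<lambda>x. dev (\<sigma>_RT x)) (\<lambda>x. dev (\<tau> x)) =
        l2_inner \<Omega> (\<lambda>x. dev (grad_NC T u_ECR x)) (\<lambda>x. dev (\<tau> x))"
    proof -
      let ?H = "\<lambda>K x. \<chi> i. \<alpha>' i K + \<beta>' i K *\<^sub>R x"
      have "AE x in lebesgue_on K. dev (\<sigma>_RT x) = dev (G K x)" if K: "K \<in> T" for K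
        using dev\<sigma>[OF K] G[OF K] by eventually_elim (simp add: dev0[OF K])
      then have "l2_inner \<Omega> (\<lambda>x. dev (\<sigma>_RT x)) (\<lambda>x. dev (\<tau> x)) =
          (\<Sum>K\<in>T. LINT x|lebesgue_on K. dev (G K x) \<bullet> dev (?H K x))"
        by (rule l2_inner_pw[OF _ AE_arg_cong])
           (auto intro: rt_data_mat[OF r] continuous_on_dev Gc continuous_on_rt_mat)
      moreover have "l2_inner \<Omega> (\<lambda>x. dev (grad_NC T u_ECR x)) (\<lambda>x. dev (\<tau> x)) =
          (\<Sum>K\<in>T. LINT x|lebesgue_on K. dev (G K x) \<bullet> dev (?H K x))"
        by (rule l2_inner_pw[OF AE_arg_cong AE_arg_cong])
           (auto intro: G rt_data_mat[OF r] continuous_on_dev Gc continuous_on_rt_mat)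
      ultimately show ?thesis by simp
    qed
    moreover have "l2_inner \<Omega> (\<lambda>x. dev (\<sigma>_RT x)) (\<lambda>x. dev (\<tau> x)) + l2_inner \<Omega> u_RT (row_div \<Omega> \<tau>) = 0"
      using RT \<tau> by blast
    ultimately show ?thesis using grad_NC_dev_pairing[OF u cab \<tau>R] by linarith
  qed
  have "is_L \<Omega> T u_ECR l0"
    unfolding is_L_def using comps_U_RT_I[OF l0] pair by blast
  moreover have "AE x in lebesgue_on \<Omega>. u_RT x = Pi0 \<Omega> T u_ECR x + l x" if l: "is_L \<Omega> T u_ECR l" for l
  proof -
    have lU: "l \<in> comps (U_RT \<Omega> T)" using l by (simp add: is_L_def)
    obtain L where L: "\<And>K. K \<in> T \<Longrightarrow> AE x in lebesgue_on K. l x = L K"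
      by (rule comps_U_RT_data[OF lU]) blast
    have "U K - W K - L K = 0" if K: "K \<in> T" for K
    proof (rule row_div_RT_hat_surjective[OF _ K, of "\<lambda>K. U K - W K - L K"])
      fix \<tau> \<alpha>' \<beta>' assume \<tau>: "\<tau> \<in> RT_hat \<Omega> T" and r: "\<And>i. rt_data (\<lambda>x. \<tau> x $ i) (\<alpha>' i) (\<beta>' i)"
      have \<tau>R: "\<tau> \<in> comps (RT \<Omega> T)" using \<tau> by (simp add: RT_hat_def)
      note d = l2_inner_row_div[OF \<tau>R r]
      have "l2_inner \<Omega> l0 (row_div \<Omega> \<tau>) = l2_inner \<Omega> l (row_div \<Omega> \<tau>)"
        using pair[OF \<tau>] l \<tau> by (simp add: is_L_def)
      then show "(\<Sum>K\<in>T. \<Sum>i\<in>UNIV. (U K - W K - L K) $ i * (real CARD('n) * \<beta>' i K * vol K)) = 0"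
        by (simp add: d[OF l0] d[OF L] sum_subtractf left_diff_distrib del: lebesgue_integral_const)
    qed
    then show ?thesis
      unfolding AE_mesh_iff
    proof (intro ballI)
      fix K assume *: "\<And>K. K \<in> T \<Longrightarrow> U K - W K - L K = 0" and K: "K \<in> T"
      show "AE x in lebesgue_on K. u_RT x = Pi0 \<Omega> T u_ECR x + l x"
        using U[OF K] W[OF K] L[OF K] by eventually_elim (use *[OF K] in \<open>simp add: algebra_simps\<close>)
    qed
  qed
  ultimately show ?thesis using stress by blast
qed

end
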